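(* Let $n\ge3$, take $m=n-2$, and let $I$, $d_i$, $g_i$, $S$, $\mathcal{K}$, $s$, $\sigma_1\ge\cdots\ge\sigma_s$ be as in the context. Then $s=2$ and $\sigma_1+\sigma_2=\sum_{i=1}^{n-2}d_i$, and the minimal generators of $\mathcal{K}$ having $x$-degree $\ge d_{n-2}$ consist of the generator $g_{n-2}$ and any other $g_k$ ($k\le n-2$) having bidegree $(d_{n-2},1)$, and also: (i) if $\sigma_2=0$: one generator of bidegree $(d_{n-1}-j\sigma_1,\,j+1)$ for each integer $j$ with $0\le j\le\frac{d_{n-1}-d_{n-2}}{\sigma_1}$; (ii) if $\sigma_1>\sigma_2>0$: one generator of bidegree $(d_{n-1}-i\sigma_1-(j-i)\sigma_2,\,j+1)$ for each pair of integers $(j,i)$ with $0\le j\le\frac{d_{n-1}-d_{n-2}}{\sigma_2}$ and $0\le i\le\min\{j,\frac{d_{n-1}-d_{n-2}-j\sigma_2}{\sigma_1-\sigma_2}\}$; (iii) if $\sigma_1=\sigma_2$: $j+1$ generators of bidegree $(d_{n-1}-j\sigma_1,\,j+1)$ for each integer $j$ with $0\le j\le\frac{d_{n-1}-d_{n-2}}{\sigma_1}$.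
   Context: Let $\Bbbk$ be a field, $R=\Bbbk[x_0,x_1]$ with the standard grading, $\mathfrak{m}=(x_0,x_1)$. For a finitely generated $R$-module $E$, the Rees algebra $\mathcal{R}(E)$ is the symmetric algebra of $E$ modulo its $R$-torsion. Let $I\subset R$ be a height two ideal minimally generated by $n$ forms $f_1,\dots,f_n$ of degree $d$, with graded free (Hilbert-Burch) resolution $0\to\bigoplus_{i=1}^{n-1}R(-d_i)\xrightarrow{\varphi}R^n\to I(d)\to0$, $1\le d_1\le\cdots\le d_{n-1}$. Let $S=R[T_1,\dots,T_n]$, bigraded by $\deg x_i=(1,0)$, $\deg T_i=(0,1)$; the first degree is called $x$-degree. Let $[g_1\ \cdots\ g_{n-1}]=[T_1\ \cdots\ T_n]\varphi$, so $g_i\in S$ has bidegree $(d_i,1)$. Let $\mathcal{K}\subset S$ be the ideal of defining equations of the Rees algebra of $I$, i.e. the kernel of the surjection $S\to\mathcal{R}(I(d))$, $T_i\mapsto f_i$ (a bihomogeneous ideal). For $1\le m\le n-1$ let $\varphi_m$ be the matrix of the first $m$ columns of $\varphi$ and $E_m=\operatorname{coker}\varphi_m$. With $m=n-2$, set $s=n-m$, $E=E_m$ (a torsionfree module of rank $s$), $F=E^{**}$ where $-^*=\operatorname{Hom}_R(-,R)$; $F$ is graded free and we write $F\cong\bigoplus_{i=1}^sR(\sigma_i)$ with $\sigma_1\ge\cdots\ge\sigma_s\ge0$; moreover $\sigma_1>0$. *)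

theory Defs
  imports
    "HOL-Computational_Algebra.Computational_Algebra"
    "HOL-Library.Poly_Mapping"
    "HOL-Library.Extended_Nat"
    "HOL-Library.Cardinality"
begin

section \<open>Ideals and height\<close>

text \<open>Ideals of a commutative ring are the submodules of the ring over itself.\<close>

abbreviation ideal_gen :: "'a::comm_ring_1 set \<Rightarrow> 'a set" where
  "ideal_gen \<equiv> module.span times"

definition prime_ideal :: "'a::comm_ring_1 set \<Rightarrow> bool" where
  "prime_ideal P \<longleftrightarrow> module.subspace times P \<and> 1 \<notin> P \<and>
     (\<forall>a b. a * b \<in> P \<longrightarrow> a \<in> P \<or> b \<in> P)"

definition prime_height :: "'a::comm_ring_1 set \<Rightarrow> enat" where
  "prime_height P = Sup {enat k | k. \<exists>Q. (\<forall>i\<le>k. prime_ideal (Q i)) \<and>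
     (\<forall>i<k. Q i \<subset> Q (Suc i)) \<and> Q k = P}"

definition ideal_height :: "'a::comm_ring_1 set \<Rightarrow> enat" where
  "ideal_height I = Inf {prime_height P | P. prime_ideal P \<and> I \<subseteq> P}"

definition minimally_generates :: "('v \<Rightarrow> 'a::comm_ring_1) \<Rightarrow> 'a set \<Rightarrow> bool" where
  "minimally_generates f I \<longleftrightarrow>
     ideal_gen (range f) = I \<and> (\<forall>i. ideal_gen (f ` (UNIV - {i})) \<noteq> I)"


section \<open>The ring R and graded modules over it\<close>

text \<open>The ring \<open>R = k[x\<^sub>0, x\<^sub>1]\<close> is represented as \<open>k[x\<^sub>0][x\<^sub>1]\<close>: the coefficient of
  \<open>x\<^sub>0\<^sup>i x\<^sub>1\<^sup>j\<close> in \<open>p\<close> is \<open>coeff (coeff p j) i\<close>.\<close>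

type_synonym 'k bipoly = "'k poly poly"

text \<open>The graded component of \<open>R\<close> in degree \<open>k\<close>; it is \<open>{0}\<close> for negative \<open>k\<close>.\<close>

definition homog :: "int \<Rightarrow> 'k::field bipoly set" where
  "homog k = {p. \<forall>i j. coeff (coeff p j) i \<noteq> 0 \<longrightarrow> int i + int j = k}"

record ('r, 'e) gmod =
  gcarrier :: "'e set"
  gadd :: "'e \<Rightarrow> 'e \<Rightarrow> 'e"
  gscale :: "'r \<Rightarrow> 'e \<Rightarrow> 'e"
  gcomp :: "int \<Rightarrow> 'e set"

definition graded_iso :: "('k::field bipoly, 'e) gmod \<Rightarrow> ('k bipoly, 'f) gmod \<Rightarrow> bool" where
  "graded_iso M N \<longleftrightarrow> (\<exists>\<psi>. bij_betw \<psi> (gcarrier M) (gcarrier N) \<and>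
     (\<forall>x\<in>gcarrier M. \<forall>y\<in>gcarrier M. \<psi> (gadd M x y) = gadd N (\<psi> x) (\<psi> y)) \<and>
     (\<forall>r. \<forall>x\<in>gcarrier M. \<psi> (gscale M r x) = gscale N r (\<psi> x)) \<and>
     (\<forall>k. \<psi> ` gcomp M k = gcomp N k))"

text \<open>\<open>Hom\<^sub>R(M, R)\<close>. Homomorphisms are set to \<open>0\<close> outside the carrier of \<open>M\<close>, so that equality
  of homomorphisms is equality of functions; those of degree \<open>k\<close> map \<open>M\<^sub>l\<close> into \<open>R\<^sub>l\<^sub>+\<^sub>k\<close>.\<close>

definition dual_carrier :: "('k::field bipoly, 'e) gmod \<Rightarrow> ('e \<Rightarrow> 'k bipoly) set" where
  "dual_carrier M = {h. (\<forall>x. x \<notin> gcarrier M \<longrightarrow> h x = 0) \<and>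
     (\<forall>x\<in>gcarrier M. \<forall>y\<in>gcarrier M. h (gadd M x y) = h x + h y) \<and>
     (\<forall>r. \<forall>x\<in>gcarrier M. h (gscale M r x) = r * h x)}"

definition dual :: "('k::field bipoly, 'e) gmod \<Rightarrow> ('k bipoly, 'e \<Rightarrow> 'k bipoly) gmod" where
  "dual M = \<lparr> gcarrier = dual_carrier M,
     gadd = (\<lambda>g h x. g x + h x),
     gscale = (\<lambda>r h x. r * h x),
     gcomp = (\<lambda>k. {h \<in> dual_carrier M. \<forall>l. \<forall>x\<in>gcomp M l. h x \<in> homog (l + k)}) \<rparr>"

text \<open>The graded free module \<open>R(\<sigma>\<^sub>1) \<oplus> \<dots> \<oplus> R(\<sigma>\<^sub>s)\<close>, where \<open>R(a)\<^sub>k = R\<^sub>a\<^sub>+\<^sub>k\<close>.\<close>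

definition twisted_free :: "nat \<Rightarrow> (nat \<Rightarrow> int) \<Rightarrow> ('k::field bipoly, nat \<Rightarrow> 'k bipoly) gmod" where
  "twisted_free s \<sigma> = \<lparr> gcarrier = {v. \<forall>i. i \<notin> {1..s} \<longrightarrow> v i = 0},
     gadd = (\<lambda>v w i. v i + w i),
     gscale = (\<lambda>r v i. r * v i),
     gcomp = (\<lambda>k. {v. (\<forall>i. i \<notin> {1..s} \<longrightarrow> v i = 0) \<and>
                      (\<forall>i\<in>{1..s}. v i \<in> homog (\<sigma> i + k))}) \<rparr>"

text \<open>The twisted ideal \<open>I(d)\<close>.\<close>

definition ideal_mod :: "'k::field bipoly set \<Rightarrow> nat \<Rightarrow> ('k bipoly, 'k bipoly) gmod" where
  "ideal_mod I d = \<lparr> gcarrier = I, gadd = plus, gscale = times,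
     gcomp = (\<lambda>k. I \<inter> homog (int d + k)) \<rparr>"

text \<open>Rows of a matrix \<open>\<phi>\<close> are indexed by a finite type, columns by \<open>1, 2, \<dots>\<close>;
  \<open>E\<^sub>m\<close> is the cokernel of the first \<open>m\<close> columns, with elements the cosets in \<open>R\<^sup>n\<close>.\<close>

definition column_span :: "('v \<Rightarrow> nat \<Rightarrow> 'k::field bipoly) \<Rightarrow> nat \<Rightarrow> ('v \<Rightarrow> 'k bipoly) set" where
  "column_span \<phi> m = {(\<lambda>i. \<Sum>j=1..m. \<phi> i j * c j) | c. True}"

definition column_coset ::
    "('v \<Rightarrow> nat \<Rightarrow> 'k::field bipoly) \<Rightarrow> nat \<Rightarrow> ('v \<Rightarrow> 'k bipoly) \<Rightarrow> ('v \<Rightarrow> 'k bipoly) set" where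
  "column_coset \<phi> m v = {(\<lambda>i. v i + w i) | w. w \<in> column_span \<phi> m}"

definition coker ::
    "('v \<Rightarrow> nat \<Rightarrow> 'k::field bipoly) \<Rightarrow> nat \<Rightarrow> ('k bipoly, ('v \<Rightarrow> 'k bipoly) set) gmod" where
  "coker \<phi> m = \<lparr> gcarrier = range (column_coset \<phi> m),
     gadd = (\<lambda>X Y. {(\<lambda>i. x i + y i) | x y. x \<in> X \<and> y \<in> Y}),
     gscale = (\<lambda>r X. {(\<lambda>i. r * x i + w i) | x w. x \<in> X \<and> w \<in> column_span \<phi> m}),
     gcomp = (\<lambda>k. column_coset \<phi> m ` {v. \<forall>i. v i \<in> homog k}) \<rparr>"

text \<open>\<open>0 \<rightarrow> R(-d\<^sub>1) \<oplus> \<dots> \<oplus> R(-d\<^sub>N) \<rightarrow> R\<^sup>n \<rightarrow> I(d) \<rightarrow> 0\<close> with maps \<open>\<phi>\<close> and \<open>(f\<^sub>i)\<close> is a graded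
  exact sequence; surjectivity onto \<open>I\<close> is part of \<open>minimally_generates\<close>.\<close>

definition graded_resolution ::
    "('v::finite \<Rightarrow> 'k::field bipoly) \<Rightarrow> ('v \<Rightarrow> nat \<Rightarrow> 'k bipoly) \<Rightarrow> nat \<Rightarrow> (nat \<Rightarrow> nat) \<Rightarrow> bool" where
  "graded_resolution f \<phi> N d \<longleftrightarrow>
     (\<forall>i. \<forall>j\<in>{1..N}. \<phi> i j \<in> homog (int (d j))) \<and>
     (\<forall>c. (\<forall>i. (\<Sum>j=1..N. \<phi> i j * c j) = 0) \<longrightarrow> (\<forall>j\<in>{1..N}. c j = 0)) \<and>
     {a. (\<Sum>i\<in>UNIV. a i * f i) = 0} = column_span \<phi> N"


section \<open>Polynomial rings over R, symmetric and Rees algebras\<close>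

text \<open>\<open>R[T\<^sub>v : v \<in> 'v]\<close>; keys are the exponent vectors of monomials.\<close>

type_synonym ('k, 'v) tpoly = "('v \<Rightarrow>\<^sub>0 nat) \<Rightarrow>\<^sub>0 'k bipoly"

definition tconst :: "'k::field bipoly \<Rightarrow> ('k, 'v) tpoly" where
  "tconst r = Poly_Mapping.single 0 r"

definition tvar :: "'v \<Rightarrow> ('k::field, 'v) tpoly" where
  "tvar v = Poly_Mapping.single (Poly_Mapping.single v 1) 1"

text \<open>The \<open>R\<close>-algebra homomorphism with \<open>T\<^sub>v \<mapsto> \<theta> v\<close>.\<close>

definition tsubst :: "('v \<Rightarrow> ('k::field, 'w) tpoly) \<Rightarrow> ('k, 'v) tpoly \<Rightarrow> ('k, 'w) tpoly" where
  "tsubst \<theta> h = (\<Sum>\<mu>\<in>Poly_Mapping.keys h. tconst (Poly_Mapping.lookup h \<mu>) *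
     (\<Prod>v\<in>Poly_Mapping.keys \<mu>. \<theta> v ^ Poly_Mapping.lookup \<mu> v))"

text \<open>Bidegree \<open>(a, b)\<close>: \<open>a\<close> is the degree in \<open>x\<^sub>0, x\<^sub>1\<close> and \<open>b\<close> the degree in the \<open>T\<^sub>v\<close>;
  \<open>0\<close> has every bidegree.\<close>

definition bihomog :: "int \<Rightarrow> nat \<Rightarrow> ('k::field, 'v) tpoly set" where
  "bihomog a b = {h. \<forall>\<mu>\<in>Poly_Mapping.keys h. Poly_Mapping.lookup h \<mu> \<in> homog a \<and>
     (\<Sum>v\<in>Poly_Mapping.keys \<mu>. Poly_Mapping.lookup \<mu> v) = b}"

text \<open>The symmetric algebra \<open>Sym(M)\<close> is the polynomial ring with one variable \<open>T\<^sub>e\<close> for each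
  \<open>e \<in> M\<close> modulo the relations making \<open>e \<mapsto> T\<^sub>e\<close> linear. Since variables range over a whole type,
  those not belonging to \<open>M\<close> are killed as well.\<close>

definition sym_ideal :: "('k::field bipoly, 'e) gmod \<Rightarrow> ('k, 'e) tpoly set" where
  "sym_ideal M = ideal_gen
     ({tvar (gadd M x y) - tvar x - tvar y | x y. x \<in> gcarrier M \<and> y \<in> gcarrier M} \<union>
      {tvar (gscale M r x) - tconst r * tvar x | r x. x \<in> gcarrier M} \<union>
      {tvar x | x. x \<notin> gcarrier M})"

text \<open>The Rees algebra of \<open>M\<close> is \<open>Sym(M)\<close> modulo its \<open>R\<close>-torsion, i.e. the same polynomial ring
  modulo the following ideal.\<close>

definition rees_ideal :: "('k::field bipoly, 'e) gmod \<Rightarrow> ('k, 'e) tpoly set" where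
  "rees_ideal M = {h. \<exists>r. r \<noteq> 0 \<and> tconst r * h \<in> sym_ideal M}"

text \<open>The kernel of \<open>S = R[T\<^sub>i : i \<in> 'v] \<rightarrow> Rees(M)\<close>, \<open>T\<^sub>i \<mapsto> f\<^sub>i\<close>.\<close>

definition rees_equations ::
    "('k::field bipoly, 'e) gmod \<Rightarrow> ('v \<Rightarrow> 'e) \<Rightarrow> ('k, 'v) tpoly set" where
  "rees_equations M f = {h. tsubst (\<lambda>i. tvar (f i)) h \<in> rees_ideal M}"

definition syzygy_form ::
    "('v::finite \<Rightarrow> nat \<Rightarrow> 'k::field bipoly) \<Rightarrow> nat \<Rightarrow> ('k, 'v) tpoly" where
  "syzygy_form \<phi> j = (\<Sum>i\<in>UNIV. tvar i * tconst (\<phi> i j))"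

definition minimal_bihomog_generators ::
    "('k::field, 'v) tpoly set \<Rightarrow> ('k, 'v) tpoly set \<Rightarrow> bool" where
  "minimal_bihomog_generators K G \<longleftrightarrow>
     (\<forall>h\<in>G. \<exists>a b. h \<in> bihomog a b) \<and> ideal_gen G = K \<and>
     (\<forall>h\<in>G. ideal_gen (G - {h}) \<noteq> K)"

text \<open>The minimal generators of \<open>K\<close> of \<open>x\<close>-degree at least \<open>e\<close> consist of the elements of \<open>B\<close>
  and of one generator of bidegree \<open>\<beta> x\<close> for each \<open>x \<in> J\<close>. Minimal generators are
  not unique, only their bidegrees are: \<open>B\<close> is part of some minimal generating set, and in
  every minimal generating set the number of elements of each bidegree is the stated one.\<close>

definition high_generators ::
    "('k::field, 'v) tpoly set \<Rightarrow> int \<Rightarrow> ('k, 'v) tpoly set \<Rightarrow> 'j set \<Rightarrow> ('j \<Rightarrow> int \<times> nat) \<Rightarrow> bool"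
  where
  "high_generators K e B J \<beta> \<longleftrightarrow>
     (\<exists>G. minimal_bihomog_generators K G \<and> B \<subseteq> G) \<and> finite J \<and>
     (\<forall>G. minimal_bihomog_generators K G \<longrightarrow> finite G \<and>
        (\<forall>a b. e \<le> a \<longrightarrow>
           card (G \<inter> bihomog a b) = card (B \<inter> bihomog a b) + card {x \<in> J. \<beta> x = (a, b)}))"

end

theory Submission
  imports Defs "HOL-Library.Function_Algebras"
begin

text \<open>Write \<open>R = k[x\<^sub>0, x\<^sub>1]\<close>, \<open>m = n - 2\<close>, \<open>D = d\<^sub>m\<close> and \<open>N = d\<^sub>m\<^sub>+\<^sub>1\<close>. The module \<open>E\<close> presented by
the first \<open>m\<close> columns has rank two and embeds into its bidual \<open>F = R(\<sigma>\<^sub>1) \<oplus> R(\<sigma>\<^sub>2)\<close>. Hence the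
symmetric algebra of \<open>F\<close> is a polynomial ring \<open>R[z\<^sub>1, z\<^sub>2]\<close>, where \<open>z\<^sub>k\<close> has bidegree
\<open>(-\<sigma>\<^sub>k, 1)\<close>, and the \<open>T\<^sub>v\<close> are mapped to linear forms by a homomorphism \<open>A : S \<rightarrow> R[z\<^sub>1, z\<^sub>2]\<close>.
The last column becomes a linear form \<open>H\<close> of bidegree \<open>(N, 1)\<close>. The map \<open>E \<rightarrow> I\<close> extends to
\<open>F \<rightarrow> R\<close>, the kernel of this extension is generated by the coefficient vector of \<open>H\<close>
(\<open>koszul_syzygy\<close>), and therefore \<open>K\<close> is the preimage of the ideal \<open>(H)\<close> under \<open>A\<close>
(\<open>comp_Suc_iff\<close>).

Both \<open>F\<close> and \<open>E\<close> are accessible through their Hilbert functions. The two complexes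
\<open>0 \<rightarrow> \<Oplus> R(-d\<^sub>j) \<rightarrow> R\<^sup>n \<rightarrow> F\<close> and \<open>0 \<rightarrow> F\<^sup>* \<rightarrow> R\<^sup>n \<rightarrow> \<Oplus> R(d\<^sub>j)\<close> are exact at \<open>R\<^sup>n\<close>. Comparing
dimensions in one degree of each gives the two inequalities between \<open>\<sigma>\<^sub>1 + \<sigma>\<^sub>2\<close> and
\<open>\<Sum> d\<^sub>j\<close>, and the resulting equality shows that \<open>E\<close> and \<open>F\<close> agree in all degrees
\<open>\<ge> D - 1\<close> (\<open>rank_two_coordinates\<close>). As \<open>E\<close> is generated in degree \<open>0\<close>, this spreads to
products: \<open>A\<close> is onto in \<open>x\<close>-degrees \<open>\<ge> D - 1\<close> (\<open>A_surj\<close>).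

Let \<open>M\<close> be the ideal of \<open>S\<close> generated by all variables. Minimal bihomogeneous generators of
\<open>K\<close> of bidegree \<open>(a, b)\<close> are bases of \<open>(K/M K)\<^sub>a\<^sub>,\<^sub>b\<close> (\<open>minimal_generators_basis_mod\<close>
and \<open>basis_mod_minimal_generators\<close>), so these quotients have to be computed for \<open>a \<ge> D\<close>. For
\<open>b = 1\<close> the columns of the resolution give the answer. For \<open>b \<ge> 2\<close> the kernel of \<open>A\<close> contributes
nothing (\<open>kernel_low\<close>): if \<open>A \<kappa> = 0\<close>, write \<open>\<kappa> = x\<^sub>1 s - x\<^sub>0 t\<close>. By the exactness of the Koszul
complex, \<open>A s = x\<^sub>0 w\<close> and \<open>A t = x\<^sub>1 w\<close>, and since \<open>w\<close> is a sum of products of some \<open>T\<^sub>v\<close> with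
elements \<open>w\<^sub>v\<close> for which \<open>x\<^sub>0 w\<^sub>v\<close> and \<open>x\<^sub>1 w\<^sub>v\<close> lift to \<open>S\<close>, the element \<open>\<kappa>\<close> lies in
\<open>M K\<close>. In the boundary case \<open>a = D\<close> the element \<open>w\<close> has \<open>x\<close>-degree \<open>D - 2\<close>, where \<open>E\<close> and
\<open>F\<close> may differ; there the decomposition of \<open>w\<close> still exists because \<open>\<sigma>\<^sub>1 > 0\<close>
(\<open>C_subset_EC_top\<close>). What remains is \<open>(H)\<close> modulo multiples of \<open>H\<close> by \<open>(x\<^sub>0, x\<^sub>1)\<close> and by the images
of the \<open>T\<^sub>v\<close>. If \<open>\<sigma>\<^sub>2 > 0\<close>, these images are zero modulo \<open>(x\<^sub>0, x\<^sub>1)\<close>, and all monomials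
\<open>z\<^sub>1\<^sup>i z\<^sub>2\<^sup>l H\<close> survive; if \<open>\<sigma>\<^sub>2 = 0\<close>, the form \<open>z\<^sub>2\<close> is such an image modulo \<open>(x\<^sub>0, x\<^sub>1)\<close>, and only the
\<open>z\<^sub>1\<^sup>i H\<close> survive (\<open>lift_basis_mod\<close>). Their bidegrees
\<open>(N - i \<sigma>\<^sub>1 - l \<sigma>\<^sub>2, i + l + 1)\<close> are those of the theorem.\<close>

section \<open>Bases modulo a subspace and rank-nullity\<close>

text \<open>The images of \<open>X\<close> form a basis of \<open>V/U\<close>. Representatives are used because quotient spaces
  would need new types.\<close>

definition basis_mod ::
    "('a::comm_ring_1 \<Rightarrow> 'b \<Rightarrow> 'b::ab_group_add) \<Rightarrow> 'b set \<Rightarrow> 'b set \<Rightarrow> 'b set \<Rightarrow> bool" where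
  "basis_mod scale U V X \<longleftrightarrow> X \<subseteq> V \<and> V \<subseteq> module.span scale (U \<union> X) \<and>
     (\<forall>x\<in>X. x \<notin> module.span scale (U \<union> (X - {x})))"

context vector_space
begin

lemma basis_mod_exists:
  assumes "subspace U" "U \<subseteq> V"
  shows "\<exists>X. basis_mod scale U V X"
proof -
  obtain BU where BU: "BU \<subseteq> U" "independent BU" "U \<subseteq> span BU"
    using maximal_independent_subset[of U] by auto
  obtain W where W: "BU \<subseteq> W" "W \<subseteq> V" "independent W" "V \<subseteq> span W"
    using maximal_independent_subset_extend[OF subset_trans[OF BU(1) assms(2)] BU(2)] by blast
  have "V \<subseteq> span (U \<union> (W - BU))"
    using W(4) BU(1) span_mono[of W "U \<union> (W - BU)"] by blast
  moreover have "x \<notin> span (U \<union> (W - BU - {x}))" if "x \<in> W - BU" for x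
  proof
    assume x: "x \<in> span (U \<union> (W - BU - {x}))"
    have "U \<union> (W - BU - {x}) \<subseteq> span (W - {x})"
    proof -
      have "U \<subseteq> span (W - {x})"
        using BU(3) span_mono[of BU "W - {x}"] W(1) that by blast
      thus ?thesis using span_superset[of "W - {x}"] by blast
    qed
    hence "x \<in> span (W - {x})"
      using x span_minimal[OF _ subspace_span] by blast
    thus False using W(3) that unfolding dependent_def by blast
  qed
  ultimately show ?thesis
    using W(2) unfolding basis_mod_def by (intro exI[of _ "W - BU"]) auto
qed

text \<open>This makes the usual exchange argument available for bases modulo \<open>U\<close>: together with a basis of
  \<open>U\<close> they are independent in the ambient space.\<close>

lemma independent_Un_basis_mod:
  assumes "finite Y'" "Y' \<subseteq> Y" "basis_mod scale U V Y" "BU \<subseteq> U" "independent BU"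
  shows "independent (BU \<union> Y')"
  using assms(1,2)
proof (induction rule: finite_induct)
  case empty
  thus ?case using assms by simp
next
  case (insert y T)
  have "y \<notin> span (BU \<union> T)"
  proof
    assume "y \<in> span (BU \<union> T)"
    moreover have "BU \<union> T \<subseteq> U \<union> (Y - {y})" using insert assms by auto
    ultimately have "y \<in> span (U \<union> (Y - {y}))" using span_mono by blast
    thus False using assms(3) insert.prems unfolding basis_mod_def by blast
  qed
  thus ?case using insert independent_insertI by simp
qed

text \<open>The space \<open>U\<close> may have infinite dimension, but only finitely many elements of a basis of \<open>U\<close>
  are needed to express finitely many elements by \<open>U\<close> and \<open>X\<close>. Adding these to both sides, the exchange
  lemma compares finite sets, and the added elements cancel.\<close>

lemma basis_mod_card_bound:
  assumes "subspace U" "basis_mod scale U V X" "basis_mod scale U V Y" "finite X" "finite Y'" "Y' \<subseteq> Y"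
  shows "card Y' \<le> card X"
proof -
  obtain BU where BU: "BU \<subseteq> U" "independent BU" "U \<subseteq> span BU"
    using maximal_independent_subset[of U] by auto
  have "\<exists>F. finite F \<and> F \<subseteq> BU \<and> y \<in> span (F \<union> X)" if "y \<in> Y'" for y
  proof -
    have "y \<in> span (U \<union> X)"
      using that assms unfolding basis_mod_def by blast
    moreover have "U \<union> X \<subseteq> span (BU \<union> X)"
      using BU(3) span_mono[of BU "BU \<union> X"] span_superset[of "BU \<union> X"] by blast
    ultimately have "y \<in> span (BU \<union> X)"
      using span_minimal[OF _ subspace_span] by blast
    then obtain t r where t: "finite t" "t \<subseteq> BU \<union> X" "y = (\<Sum>a\<in>t. scale (r a) a)"
      unfolding span_explicit by blast
    have "y \<in> span ((t \<inter> BU) \<union> X)"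
      unfolding t(3) using t(2) by (intro span_sum span_scale span_base) auto
    thus ?thesis using t(1) by (intro exI[of _ "t \<inter> BU"]) auto
  qed
  then obtain F where F: "\<And>y. y \<in> Y' \<Longrightarrow> finite (F y) \<and> F y \<subseteq> BU \<and> y \<in> span (F y \<union> X)"
    by metis
  define G where "G = (\<Union>y\<in>Y'. F y)"
  have G: "finite G" "G \<subseteq> BU" using F assms(5) unfolding G_def by auto
  have sub: "G \<union> Y' \<subseteq> span (G \<union> X)"
  proof -
    have "Y' \<subseteq> span (G \<union> X)"
    proof
      fix y assume y: "y \<in> Y'"
      have "F y \<union> X \<subseteq> G \<union> X" using y unfolding G_def by auto
      thus "y \<in> span (G \<union> X)" using F[OF y] span_mono by blast
    qed
    thus ?thesis using span_superset[of "G \<union> X"] by blast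
  qed
  have ind: "independent (G \<union> Y')"
    using independent_Un_basis_mod[OF assms(5,6,3) BU(1,2)] independent_mono[of "BU \<union> Y'" "G \<union> Y'"] G(2)
    by blast
  have disj: "G \<inter> Y' = {}"
  proof -
    have "y \<notin> U" if "y \<in> Y'" for y
      using that assms(3,6) span_base[of y "U \<union> (Y - {y})"] unfolding basis_mod_def by blast
    thus ?thesis using G(2) BU(1) by blast
  qed
  have "card (G \<union> Y') \<le> card (G \<union> X)"
    using independent_span_bound[OF _ ind sub] G(1) assms(4) by auto
  also have "\<dots> \<le> card G + card X" by (rule card_Un_le)
  finally show ?thesis
    using card_Un_disjoint[OF G(1) assms(5) disj] by simp
qed

lemma basis_mod_card_eq:
  assumes "subspace U" "basis_mod scale U V X" "basis_mod scale U V Y" "finite X"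
  shows "finite Y \<and> card Y = card X"
proof -
  have finY: "finite Y"
  proof (rule ccontr)
    assume "infinite Y"
    then obtain Y' where "Y' \<subseteq> Y" "finite Y'" "card Y' = Suc (card X)"
      using infinite_arbitrarily_large by blast
    thus False using basis_mod_card_bound[OF assms(1,2,3,4)] by fastforce
  qed
  thus ?thesis
    using basis_mod_card_bound[OF assms(1,2,3,4) finY] basis_mod_card_bound[OF assms(1,3,2) finY assms(4)]
    by auto
qed

end

context vector_space_pair
begin

text \<open>The useful half of rank-nullity, for spaces of which only finite spanning sets are known: preimages of a basis of the
  image, together with a spanning set of the kernel, span \<open>V\<close>.\<close>

lemma independent_card_le_kernel_image:
  assumes f: "Vector_Spaces.linear s1 s2 f" and V: "vs1.subspace V"
    and K: "{x \<in> V. f x = 0} \<subseteq> vs1.span K" "finite K"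
    and L: "f ` V \<subseteq> vs2.span L" "finite L"
    and X: "X \<subseteq> V" "vs1.independent X"
  shows "card X \<le> card K + card L"
proof -
  interpret f: Vector_Spaces.linear s1 s2 f by fact
  obtain Y where Y: "Y \<subseteq> f ` V" "vs2.independent Y" "f ` V \<subseteq> vs2.span Y"
    using vs2.maximal_independent_subset[of "f ` V"] by auto
  have Yc: "finite Y" "card Y \<le> card L"
    using vs2.independent_span_bound[OF L(2) Y(2)] Y(1) L(1) by auto
  obtain Z where Z: "Z \<subseteq> V" "Y = f ` Z" "inj_on f Z"
    using Y(1) by (meson subset_image_inj)
  have "V \<subseteq> vs1.span (K \<union> Z)"
  proof
    fix x assume x: "x \<in> V"
    have "f x \<in> f ` vs1.span Z"
      using x Y(3) Z(2) f.span_image by blast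
    then obtain z where z: "z \<in> vs1.span Z" "f x = f z" by auto
    have "z \<in> V" using z(1) vs1.span_minimal[OF Z(1) V] by auto
    hence "x - z \<in> vs1.span K"
      using K(1) x V vs1.subspace_diff z(2) f.diff by auto
    hence "x - z \<in> vs1.span (K \<union> Z)" "z \<in> vs1.span (K \<union> Z)"
      using z(1) vs1.span_mono[of K "K \<union> Z"] vs1.span_mono[of Z "K \<union> Z"] by auto
    hence "(x - z) + z \<in> vs1.span (K \<union> Z)" by (rule vs1.span_add)
    thus "x \<in> vs1.span (K \<union> Z)" by simp
  qed
  moreover have finZ: "finite Z" using Yc(1) Z(2,3) finite_image_iff by blast
  ultimately have "card X \<le> card (K \<union> Z)"
    using vs1.independent_span_bound[OF _ X(2)] K(2) X(1) by auto
  also have "\<dots> \<le> card K + card Z" by (rule card_Un_le)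
  also have "card Z = card Y" using Z(2,3) by (simp add: card_image)
  finally show ?thesis using Yc(2) by simp
qed

text \<open>If the previous bound is attained, a proper image is impossible: its dimension would be smaller than the number of
  elements of \<open>L\<close>.\<close>

lemma image_eq_if_card_ge:
  assumes f: "Vector_Spaces.linear s1 s2 f" and V: "vs1.subspace V"
    and K: "{x \<in> V. f x = 0} \<subseteq> vs1.span K" "finite K"
    and L: "f ` V \<subseteq> vs2.span L" "finite L"
    and X: "X \<subseteq> V" "vs1.independent X"
    and c: "card K + card L \<le> card X"
  shows "f ` V = vs2.span L"
proof (rule ccontr)
  interpret f: Vector_Spaces.linear s1 s2 f by fact
  assume "f ` V \<noteq> vs2.span L"
  then obtain y where y: "y \<in> vs2.span L" "y \<notin> f ` V" using L(1) by auto
  obtain Y where Y: "Y \<subseteq> f ` V" "vs2.independent Y" "f ` V \<subseteq> vs2.span Y"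
    using vs2.maximal_independent_subset[of "f ` V"] by auto
  have "vs2.span Y \<subseteq> f ` V"
    using vs2.span_minimal[OF Y(1)] f.subspace_image[OF V] by auto
  hence yn: "y \<notin> vs2.span Y" using y(2) by auto
  hence ind: "vs2.independent (insert y Y)" using Y(2) by (rule vs2.independent_insertI)
  have "insert y Y \<subseteq> vs2.span L" using y(1) Y(1) L(1) by auto
  hence b: "finite (insert y Y)" "card (insert y Y) \<le> card L"
    using vs2.independent_span_bound[OF L(2) ind] by auto
  have "y \<notin> Y" using yn vs2.span_base by auto
  hence "Suc (card Y) \<le> card L" using b by simp
  moreover have "card X \<le> card K + card Y"
    using independent_card_le_kernel_image[OF f V K Y(3) _ X] b(1) by auto
  ultimately show False using c by simp
qed

end

section \<open>Hilbert's basis theorem\<close>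

definition is_subring :: "'a::comm_ring_1 set \<Rightarrow> bool" where
  "is_subring A \<longleftrightarrow> 0 \<in> A \<and> 1 \<in> A \<and> (\<forall>x\<in>A. \<forall>y\<in>A. x + y \<in> A \<and> x * y \<in> A) \<and> (\<forall>x\<in>A. - x \<in> A)"

definition combinations :: "'a::comm_ring_1 set \<Rightarrow> (nat \<Rightarrow> 'a) \<Rightarrow> nat \<Rightarrow> 'a set" where
  "combinations A q N = {\<Sum>k<N. c k * q k | c. range c \<subseteq> A}"

text \<open>The ascending chain condition in the form that is used for irredundant sets: in every sequence some term lies in the
  ideal generated by its predecessors. Subrings of one ambient type are considered so that variables can be adjoined one after the
  other.\<close>

definition noetherian_on :: "'a::comm_ring_1 set \<Rightarrow> bool" where
  "noetherian_on A \<longleftrightarrow> is_subring A \<and> (\<forall>h. range h \<subseteq> A \<longrightarrow> (\<exists>N. h N \<in> combinations A h N))"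

definition adjoin :: "'a::comm_ring_1 set \<Rightarrow> 'a \<Rightarrow> 'a set" where
  "adjoin A t = {poly p t | p. range (coeff p) \<subseteq> A}"

lemma subring_sum: "is_subring A \<Longrightarrow> (\<And>i. i \<in> X \<Longrightarrow> g i \<in> A) \<Longrightarrow> sum g X \<in> A"
  by (induction X rule: infinite_finite_induct) (auto simp: is_subring_def)

lemma subring_poly:
  assumes "is_subring A"
  shows "is_subring {p. range (coeff p) \<subseteq> A}"
proof -
  have "(\<Sum>i\<le>n. coeff p i * coeff q (n - i)) \<in> A" if "range (coeff p) \<subseteq> A" "range (coeff q) \<subseteq> A" for p q n
    using that assms by (intro subring_sum[OF assms]) (auto simp: is_subring_def)
  thus ?thesis
    using assms unfolding is_subring_def image_subset_iff by (simp add: coeff_mult coeff_1)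
qed

lemma combinations_closed:
  assumes A: "is_subring A"
  shows "0 \<in> combinations A q N"
    and "x \<in> combinations A q N \<Longrightarrow> y \<in> combinations A q N \<Longrightarrow> x + y \<in> combinations A q N"
    and "a \<in> A \<Longrightarrow> x \<in> combinations A q N \<Longrightarrow> a * x \<in> combinations A q N"
    and "k < N \<Longrightarrow> q k \<in> combinations A q N"
    and "M \<le> N \<Longrightarrow> combinations A q M \<subseteq> combinations A q N"
proof -
  show "0 \<in> combinations A q N"
    unfolding combinations_def using A
    by (intro CollectI exI[of _ "\<lambda>_. 0"]) (auto simp: is_subring_def)
  show "x + y \<in> combinations A q N" if "x \<in> combinations A q N" "y \<in> combinations A q N"
  proof -
    obtain c d where "x = (\<Sum>k<N. c k * q k)" "y = (\<Sum>k<N. d k * q k)" "range c \<subseteq> A" "range d \<subseteq> A"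
      using \<open>x \<in> combinations A q N\<close> \<open>y \<in> combinations A q N\<close> unfolding combinations_def by auto
    thus ?thesis unfolding combinations_def using A
      by (intro CollectI exI[of _ "\<lambda>k. c k + d k"])
         (auto simp: is_subring_def sum.distrib distrib_right image_subset_iff)
  qed
  show "a * x \<in> combinations A q N" if "a \<in> A" "x \<in> combinations A q N"
  proof -
    obtain c where "x = (\<Sum>k<N. c k * q k)" "range c \<subseteq> A"
      using \<open>x \<in> combinations A q N\<close> unfolding combinations_def by auto
    thus ?thesis unfolding combinations_def using A \<open>a \<in> A\<close>
      by (intro CollectI exI[of _ "\<lambda>k. a * c k"])
         (auto simp: is_subring_def sum_distrib_left mult.assoc image_subset_iff)
  qed
  show "q k \<in> combinations A q N" if "k < N"
  proof -
    have "q k = (\<Sum>j<N. (if j = k then 1 else 0) * q j)"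
      using that by (simp add: if_distrib[of "\<lambda>x. x * _"] cong: if_cong)
    thus ?thesis unfolding combinations_def using A
      by (intro CollectI exI[of _ "\<lambda>j. if j = k then 1 else 0"]) (auto simp: is_subring_def)
  qed
  show "combinations A q M \<subseteq> combinations A q N" if "M \<le> N"
  proof
    fix x assume "x \<in> combinations A q M"
    then obtain c where c: "x = (\<Sum>k<M. c k * q k)" "range c \<subseteq> A"
      unfolding combinations_def by auto
    have "x = (\<Sum>k<N. (if k < M then c k else 0) * q k)"
      unfolding c(1) by (rule sum.mono_neutral_cong_left) (use that in auto)
    thus "x \<in> combinations A q N"
      unfolding combinations_def using A c(2)
      by (intro CollectI exI[of _ "\<lambda>k. if k < M then c k else 0"]) (auto simp: is_subring_def)
  qed
qed

lemma combinations_sum: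
  assumes "is_subring A" "\<And>k. k \<in> X \<Longrightarrow> g k \<in> combinations A q N"
  shows "sum g X \<in> combinations A q N"
  using assms(2)
  by (induction X rule: infinite_finite_induct)
     (auto intro: combinations_closed(1,2)[OF assms(1)])

lemma combinations_trans:
  assumes A: "is_subring A" and "\<And>k. k < N \<Longrightarrow> q k \<in> combinations A p M"
  shows "combinations A q N \<subseteq> combinations A p M"
proof
  fix x assume "x \<in> combinations A q N"
  then obtain c where "x = (\<Sum>k<N. c k * q k)" "range c \<subseteq> A"
    unfolding combinations_def by auto
  thus "x \<in> combinations A p M"
    using assms by (auto intro!: combinations_sum combinations_closed(3)[OF A])
qed

text \<open>Hilbert's argument. If the ideal of the sequence were not generated by an initial segment, one could choose
  \<open>q\<^sub>0, q\<^sub>1, \<dots>\<close> in it, each of least degree outside the ideal of its predecessors. The degrees do not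
  decrease, so as soon as a leading coefficient is a combination of the earlier ones, a combination of the earlier
  \<open>q\<^sub>k\<close> can be subtracted to lower the degree.\<close>

lemma noetherian_poly:
  assumes noeth: "noetherian_on A" and p: "\<And>k. range (coeff (p k)) \<subseteq> A"
  shows "\<exists>M. p M \<in> combinations {p. range (coeff p) \<subseteq> A} p M"
proof (rule ccontr)
  define P where "P = {p. range (coeff p) \<subseteq> A}"
  assume "\<nexists>M. p M \<in> combinations {p. range (coeff p) \<subseteq> A} p M"
  hence no: "p M \<notin> combinations P p M" for M unfolding P_def by auto
  have A: "is_subring A" using noeth unfolding noetherian_on_def by simp
  have P: "is_subring P" unfolding P_def using subring_poly[OF A] .
  note cl = combinations_closed[OF P]
  define I where "I = (\<Union>M. combinations P p M)"
  have I_mult: "a * x \<in> I" if "a \<in> P" "x \<in> I" for a x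
    using that cl(3) unfolding I_def by blast
  have I_add: "x + y \<in> I" if xy: "x \<in> I" "y \<in> I" for x y
  proof -
    obtain M M' where "x \<in> combinations P p M" "y \<in> combinations P p M'"
      using xy unfolding I_def by blast
    hence "x + y \<in> combinations P p (max M M')"
      using cl(5)[of M "max M M'" p] cl(5)[of M' "max M M'" p] by (intro cl(2)) auto
    thus ?thesis unfolding I_def by auto
  qed
  define good where "good q N r \<longleftrightarrow> r \<in> I \<and> r \<notin> combinations P q N \<and>
      (\<forall>r'\<in>I. r' \<notin> combinations P q N \<longrightarrow> degree r \<le> degree r')" for q N r
  have "\<exists>q. \<forall>N. good q N (q N)"
  proof (rule dependent_wellorder_choice)
    fix r :: "'a poly" and q q' :: "nat \<Rightarrow> 'a poly" and N :: nat
    assume "\<And>y. y < N \<Longrightarrow> q y = q' y"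
    hence "combinations P q N = combinations P q' N"
      unfolding combinations_def by auto
    thus "good q N r = good q' N r" unfolding good_def by simp
  next
    fix N :: nat and q :: "nat \<Rightarrow> 'a poly"
    assume "\<And>y. y < N \<Longrightarrow> good q y (q y)"
    hence "\<forall>y\<in>{..<N}. \<exists>M. q y \<in> combinations P p M" unfolding good_def I_def by auto
    then obtain M where M: "\<And>y. y < N \<Longrightarrow> q y \<in> combinations P p (M y)"
      unfolding Ball_def by (metis lessThan_iff)
    \<comment> \<open>a common index for the finitely many \<open>q y\<close>; any upper bound of the \<open>M y\<close> will do\<close>
    define M' where "M' = (\<Sum>y<N. M y)"
    have "M y \<le> M'" if "y < N" for y
      unfolding M'_def using that member_le_sum[of y "{..<N}" M] by auto
    hence "q y \<in> combinations P p M'" if "y < N" for y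
      using M[OF that] cl(5) that by blast
    hence "combinations P q N \<subseteq> combinations P p M'" by (rule combinations_trans[OF P])
    hence "p M' \<in> I \<and> p M' \<notin> combinations P q N"
      using no cl(4)[of M' "Suc M'" p] unfolding I_def by blast
    then obtain r where "r \<in> I \<and> r \<notin> combinations P q N"
      "\<And>r'. r' \<in> I \<and> r' \<notin> combinations P q N \<Longrightarrow> degree r \<le> degree r'"
      using ex_has_least_nat[of "\<lambda>r. r \<in> I \<and> r \<notin> combinations P q N" "p M'" degree] by blast
    thus "\<exists>r. good q N r" unfolding good_def by blast
  qed
  then obtain q where q: "\<And>N. good q N (q N)" by blast
  have PI: "x \<in> P" if "x \<in> I" for x
  proof -
    have pP: "p k \<in> P" for k using p unfolding P_def by simp
    have "(\<Sum>k<M. c k * p k) \<in> P" if "range c \<subseteq> P" for M c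
    proof (rule subring_sum[OF P])
      fix k have "c k \<in> P" using that by auto
      thus "c k * p k \<in> P" using pP P unfolding is_subring_def by simp
    qed
    hence "combinations P p M \<subseteq> P" for M unfolding combinations_def by auto
    thus ?thesis using that unfolding I_def by auto
  qed
  have qP: "q N \<in> P" for N using q PI unfolding good_def by blast
  have deg: "degree (q k) \<le> degree (q N)" if "k < N" for k N
  proof -
    have "q N \<notin> combinations P q k"
      using q[of N] cl(5)[of k N q] that unfolding good_def by auto
    thus ?thesis using q[of k] q[of N] unfolding good_def by blast
  qed
  have "\<forall>N. lead_coeff (q N) \<in> A" using qP unfolding P_def by auto
  hence "range (\<lambda>N. lead_coeff (q N)) \<subseteq> A" by auto
  then obtain N where "lead_coeff (q N) \<in> combinations A (\<lambda>N. lead_coeff (q N)) N"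
    using noeth unfolding noetherian_on_def by blast
  then obtain c where c: "lead_coeff (q N) = (\<Sum>k<N. c k * lead_coeff (q k))" "range c \<subseteq> A"
    unfolding combinations_def by auto
  \<comment> \<open>the combination of the predecessors with the same leading term as \<open>q N\<close>\<close>
  define s where "s = (\<Sum>k<N. monom (c k) (degree (q N) - degree (q k)) * q k)"
  have mP: "monom (c k) j \<in> P" for k j
    unfolding P_def using c(2) A by (auto simp: is_subring_def)
  have s: "s \<in> combinations P q N"
    unfolding s_def combinations_def using mP by auto
  have sI: "s \<in> I"
  proof -
    have "sum (\<lambda>k. monom (c k) (degree (q N) - degree (q k)) * q k) {..<n} \<in> I" for n
    proof (induction n)
      case 0
      thus ?case using cl(1) unfolding I_def by auto
    next
      case (Suc n)
      have "q n \<in> I" using q[of n] unfolding good_def by simp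
      thus ?case using Suc I_add I_mult[OF mP] by simp
    qed
    thus ?thesis unfolding s_def by simp
  qed
  have mone: "- 1 \<in> P" using P unfolding is_subring_def by auto
  define r where "r = q N - s"
  have "r = q N + (-1) * s" unfolding r_def by simp
  hence rI: "r \<in> I" using q[of N] sI I_add I_mult[OF mone] unfolding good_def by metis
  have rn: "r \<notin> combinations P q N"
  proof
    assume "r \<in> combinations P q N"
    hence "r + s \<in> combinations P q N" using s cl(2) by blast
    thus False using q[of N] unfolding r_def good_def by simp
  qed
  have le: "degree s \<le> degree (q N)"
    unfolding s_def
  proof (rule degree_sum_le)
    fix k assume "k \<in> {..<N}"
    hence "degree (q k) \<le> degree (q N)" using deg by auto
    thus "degree (monom (c k) (degree (q N) - degree (q k)) * q k) \<le> degree (q N)"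
      using degree_mult_le[of "monom (c k) (degree (q N) - degree (q k))" "q k"]
        degree_monom_le[of "c k" "degree (q N) - degree (q k)"] by linarith
  qed simp
  have "coeff s (degree (q N)) = (\<Sum>k<N. c k * lead_coeff (q k))"
    unfolding s_def coeff_sum
  proof (rule sum.cong)
    fix k assume "k \<in> {..<N}"
    hence "degree (q k) \<le> degree (q N)" using deg by auto
    thus "coeff (monom (c k) (degree (q N) - degree (q k)) * q k) (degree (q N)) = c k * lead_coeff (q k)"
      by (simp add: coeff_monom_mult)
  qed simp
  hence c0: "coeff r (degree (q N)) = 0" unfolding r_def using c(1) by simp
  have "degree r \<le> degree (q N)" unfolding r_def using le by (simp add: degree_diff_le)
  moreover have "r \<noteq> 0" using rn cl(1) by auto
  ultimately have "degree r < degree (q N)"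
    using c0 by (metis le_neq_implies_less leading_coeff_0_iff)
  thus False using q[of N] rI rn unfolding good_def by auto
qed

lemma subring_adjoin:
  assumes A: "is_subring A"
  shows "is_subring (adjoin A t)"
proof -
  define P where "P = {p. range (coeff p) \<subseteq> A}"
  have P: "is_subring P" unfolding P_def by (rule subring_poly[OF A])
  have ad: "adjoin A t = (\<lambda>p. poly p t) ` P" unfolding adjoin_def P_def by auto
  have "poly 0 t \<in> adjoin A t" "poly 1 t \<in> adjoin A t"
    using P unfolding ad is_subring_def by (intro imageI; simp)+
  moreover have "x + y \<in> adjoin A t \<and> x * y \<in> adjoin A t \<and> - x \<in> adjoin A t"
    if xy: "x \<in> adjoin A t" "y \<in> adjoin A t" for x y
  proof -
    obtain p q where pq: "x = poly p t" "p \<in> P" "y = poly q t" "q \<in> P"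
      using xy unfolding ad by blast
    hence "p + q \<in> P" "p * q \<in> P" "- p \<in> P" using P unfolding is_subring_def by simp_all
    moreover have "x + y = poly (p + q) t" "x * y = poly (p * q) t" "- x = poly (- p) t"
      using pq by simp_all
    ultimately show ?thesis unfolding ad by blast
  qed
  ultimately show ?thesis unfolding is_subring_def by simp
qed

text \<open>The ring \<open>A[t]\<close> is the image of \<open>A[X]\<close> under evaluation at \<open>t\<close>, and linear
  relations survive evaluation.\<close>

theorem noetherian_adjoin:
  assumes "noetherian_on A"
  shows "noetherian_on (adjoin A t)"
  unfolding noetherian_on_def
proof (intro conjI allI impI)
  show "is_subring (adjoin A t)" using assms subring_adjoin unfolding noetherian_on_def by blast
  fix h :: "nat \<Rightarrow> 'a" assume "range h \<subseteq> adjoin A t"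
  hence "\<forall>k. \<exists>p. h k = poly p t \<and> range (coeff p) \<subseteq> A" unfolding adjoin_def by auto
  then obtain p where p: "\<And>k. h k = poly (p k) t" "\<And>k. range (coeff (p k)) \<subseteq> A" by metis
  obtain M where "p M \<in> combinations {p. range (coeff p) \<subseteq> A} p M"
    using noetherian_poly[OF assms, of p] p(2) by blast
  then obtain c where c: "p M = (\<Sum>k<M. c k * p k)" "range c \<subseteq> {p. range (coeff p) \<subseteq> A}"
    unfolding combinations_def by auto
  have "h M = (\<Sum>k<M. poly (c k) t * h k)" unfolding p(1) c(1) by (simp add: poly_sum)
  moreover have "range (\<lambda>k. poly (c k) t) \<subseteq> adjoin A t" using c(2) unfolding adjoin_def by blast
  ultimately have "h M \<in> combinations (adjoin A t) h M"
    unfolding combinations_def by (intro CollectI exI[of _ "\<lambda>k. poly (c k) t"]) auto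
  thus "\<exists>N. h N \<in> combinations (adjoin A t) h N" ..
qed

section \<open>The gradings of R and S\<close>

definition kc :: "'k::field \<Rightarrow> 'k bipoly" where "kc c = [:[:c:]:]"
definition x0 :: "'k::field bipoly" where "x0 = [:[:0, 1:]:]"
definition x1 :: "'k::field bipoly" where "x1 = [:0, 1:]"

abbreviation cf :: "'k::field bipoly \<Rightarrow> nat \<Rightarrow> nat \<Rightarrow> 'k" where
  "cf p i j \<equiv> coeff (coeff p j) i"

lemma cf_x1: "cf (x1 * p) i j = (case j of 0 \<Rightarrow> 0 | Suc j' \<Rightarrow> cf p i j')"
  by (simp add: x1_def coeff_pCons split: nat.split)

lemma cf_x0: "cf (x0 * p) i j = (case i of 0 \<Rightarrow> 0 | Suc i' \<Rightarrow> cf p i' j)"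
  by (simp add: x0_def coeff_pCons split: nat.split)

lemma cf_kc: "cf (kc c * p) i j = c * cf p i j"
  by (simp add: kc_def)

lemma bipoly_eqI: "(\<And>i j. cf p i j = cf q i j) \<Longrightarrow> p = q"
  by (intro poly_eqI) auto

lemma kc_simps [simp]: "kc 0 = 0" "kc 1 = 1" "kc (a + b) = kc a + kc b" "kc (a * b) = kc a * kc b"
  "kc a = 0 \<longleftrightarrow> a = 0"
  by (simp_all add: kc_def one_pCons)

lemma x0_nz [simp]: "x0 \<noteq> 0" and x1_nz [simp]: "x1 \<noteq> 0"
  by (simp_all add: x0_def x1_def)

lemma homogD: "p \<in> homog k \<Longrightarrow> cf p i j \<noteq> 0 \<Longrightarrow> int i + int j = k"
  unfolding homog_def by blast

lemma homog_0 [simp]: "0 \<in> homog k"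
  by (simp add: homog_def)

lemma homog_add: "p \<in> homog k \<Longrightarrow> q \<in> homog k \<Longrightarrow> p + q \<in> homog k"
  unfolding homog_def
proof (intro CollectI allI impI)
  fix i j assume "p \<in> {p. \<forall>i j. cf p i j \<noteq> 0 \<longrightarrow> int i + int j = k}"
    "q \<in> {p. \<forall>i j. cf p i j \<noteq> 0 \<longrightarrow> int i + int j = k}" "cf (p + q) i j \<noteq> 0"
  moreover from this have "cf p i j \<noteq> 0 \<or> cf q i j \<noteq> 0" by auto
  ultimately show "int i + int j = k" by blast
qed

lemma homog_uminus: "p \<in> homog k \<Longrightarrow> - p \<in> homog k"
  unfolding homog_def by auto

lemma homog_diff: "p \<in> homog k \<Longrightarrow> q \<in> homog k \<Longrightarrow> p - q \<in> homog k"
  using homog_add[of p k "- q"] homog_uminus[of q k] by simp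

lemma homog_sum: "(\<And>i. i \<in> A \<Longrightarrow> f i \<in> homog k) \<Longrightarrow> sum f A \<in> homog k"
  by (induction A rule: infinite_finite_induct) (auto intro: homog_add)

lemma homog_mult:
  assumes "p \<in> homog k" "q \<in> homog l"
  shows "p * q \<in> homog (k + l)"
  unfolding homog_def
proof (intro CollectI allI impI)
  fix i j assume "cf (p * q) i j \<noteq> 0"
  hence "(\<Sum>b\<le>j. \<Sum>a\<le>i. cf p a b * cf q (i - a) (j - b)) \<noteq> 0"
    by (simp add: coeff_mult coeff_sum)
  then obtain b where b: "b \<le> j" "(\<Sum>a\<le>i. cf p a b * cf q (i - a) (j - b)) \<noteq> 0"
    by (meson atMost_iff sum.not_neutral_contains_not_neutral)
  then obtain a where a: "a \<le> i" "cf p a b * cf q (i - a) (j - b) \<noteq> 0"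
    by (meson atMost_iff sum.not_neutral_contains_not_neutral)
  have "int a + int b = k" "int (i - a) + int (j - b) = l"
    using a(2) assms by (auto dest: homogD)
  thus "int i + int j = k + l" using a(1) b(1) by linarith
qed

lemma homog_mult': "p \<in> homog k \<Longrightarrow> q \<in> homog l \<Longrightarrow> m = k + l \<Longrightarrow> p * q \<in> homog m"
  using homog_mult by blast

lemma homog_kc [simp]: "kc c \<in> homog 0"
  unfolding homog_def kc_def by (auto simp: coeff_pCons split: nat.splits)

lemma homog_x0 [simp]: "x0 \<in> homog 1" and homog_x1 [simp]: "x1 \<in> homog 1"
  unfolding homog_def x0_def x1_def by (auto simp: coeff_pCons split: nat.splits)

lemma homog_1 [simp]: "1 \<in> homog 0"
  using homog_kc[of 1] by simp

lemma homog_kc_mult: "p \<in> homog k \<Longrightarrow> kc c * p \<in> homog k"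
  using homog_mult[of "kc c" 0 p k] by simp

lemma homog_negative: "p \<in> homog k \<Longrightarrow> k < 0 \<Longrightarrow> p = 0"
  by (rule bipoly_eqI, rule ccontr) (auto dest: homogD)

lemma homog_unique: "p \<in> homog k \<Longrightarrow> p \<in> homog l \<Longrightarrow> k \<noteq> l \<Longrightarrow> p = 0"
  by (rule bipoly_eqI, rule ccontr) (auto dest: homogD)

lemma homog_zero_const:
  assumes "p \<in> homog 0" shows "p = kc (cf p 0 0)"
proof (rule bipoly_eqI, rule ccontr)
  fix i j assume *: "cf p i j \<noteq> cf (kc (cf p 0 0)) i j"
  hence "(i, j) \<noteq> (0, 0)" by (cases "i = 0 \<and> j = 0") (auto simp: kc_def)
  hence "cf (kc (cf p 0 0)) i j = 0" by (auto simp: kc_def coeff_pCons split: nat.splits)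
  thus False using * homogD[OF assms, of j i] \<open>(i, j) \<noteq> (0, 0)\<close> by auto
qed

lemma homog_x0_cancel:
  assumes "x0 * p \<in> homog k" shows "p \<in> homog (k - 1)"
  unfolding homog_def
proof (intro CollectI allI impI)
  fix i j assume "cf p i j \<noteq> 0"
  thus "int i + int j = k - 1" using homogD[OF assms, of j "Suc i"] by (simp add: cf_x0)
qed

lemma homog_x1_cancel:
  assumes "x1 * p \<in> homog k" shows "p \<in> homog (k - 1)"
  unfolding homog_def
proof (intro CollectI allI impI)
  fix i j assume "cf p i j \<noteq> 0"
  thus "int i + int j = k - 1" using homogD[OF assms, of "Suc j" i] by (simp add: cf_x1)
qed

text \<open>The projection onto the component of degree \<open>k\<close>: in the coefficient of \<open>x\<^sub>1\<^sup>j\<close>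
  only the monomial \<open>x\<^sub>0\<^sup>k\<^sup>-\<^sup>j\<close> is kept.\<close>

definition hcomp :: "int \<Rightarrow> 'k::field bipoly \<Rightarrow> 'k bipoly" where
  "hcomp k p = (\<Sum>j\<le>degree p. monom
     (if int j \<le> k then monom (cf p (nat (k - int j)) j) (nat (k - int j)) else 0) j)"

lemma cf_hcomp: "cf (hcomp k p) i j = (if int i + int j = k then cf p i j else 0)"
proof -
  have "cf (hcomp k p) i j = (\<Sum>l\<le>degree p. if l = j then
      (if int j \<le> k \<and> i = nat (k - int j) then cf p i j else 0) else 0)"
    unfolding hcomp_def coeff_sum by (intro sum.cong) auto
  also have "\<dots> = (if int i + int j = k then cf p i j else 0)"
    by (auto simp: coeff_eq_0)
  finally show ?thesis .
qed

lemma hcomp_homog [simp]: "hcomp k p \<in> homog k"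
  unfolding homog_def by (auto simp: cf_hcomp split: if_splits)

lemma hcomp_add: "hcomp k (p + q) = hcomp k p + hcomp k q"
  by (rule bipoly_eqI) (simp add: cf_hcomp)

lemma hcomp_0 [simp]: "hcomp k 0 = 0"
  by (rule bipoly_eqI) (simp add: cf_hcomp)

lemma hcomp_sum: "hcomp k (sum f A) = (\<Sum>i\<in>A. hcomp k (f i))"
  by (induction A rule: infinite_finite_induct) (auto simp: hcomp_add)

lemma hcomp_id: "p \<in> homog k \<Longrightarrow> hcomp k p = p"
  by (rule bipoly_eqI) (auto simp: cf_hcomp dest: homogD)

lemma hcomp_other: "p \<in> homog l \<Longrightarrow> k \<noteq> l \<Longrightarrow> hcomp k p = 0"
  by (rule bipoly_eqI) (auto simp: cf_hcomp dest: homogD)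

lemma sum_hcomp: "\<exists>F. finite F \<and> p = (\<Sum>k\<in>F. hcomp k p)"
proof -
  define n where "n = Max ((\<lambda>j. degree (coeff p j)) ` {..degree p})"
  have n: "degree (coeff p j) \<le> n" for j
  proof (cases "j \<le> degree p")
    case True thus ?thesis unfolding n_def by (intro Max_ge) auto
  next
    case False thus ?thesis by (simp add: coeff_eq_0)
  qed
  define F where "F = {0..int n + int (degree p)}"
  have "p = (\<Sum>k\<in>F. hcomp k p)"
  proof (rule bipoly_eqI)
    fix i j
    have "cf (\<Sum>k\<in>F. hcomp k p) i j = (\<Sum>k\<in>F. if int i + int j = k then cf p i j else 0)"
      by (simp add: coeff_sum cf_hcomp)
    also have "\<dots> = (if int i + int j \<in> F then cf p i j else 0)"
      unfolding F_def by simp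
    also have "\<dots> = cf p i j"
    proof (cases "cf p i j = 0")
      case False
      hence "i \<le> degree (coeff p j)" "j \<le> degree p"
        by (auto intro: le_degree)
      thus ?thesis using n[of j] unfolding F_def by auto
    qed auto
    finally show "cf p i j = cf (\<Sum>k\<in>F. hcomp k p) i j" by simp
  qed
  thus ?thesis unfolding F_def by blast
qed

lemma bipoly_homog_induct:
  assumes "\<And>k p. p \<in> homog k \<Longrightarrow> P p" "\<And>p q. P p \<Longrightarrow> P q \<Longrightarrow> P (p + q)"
  shows "P p"
proof -
  obtain F where F: "finite F" "p = (\<Sum>k\<in>F. hcomp k p)" using sum_hcomp by blast
  have "P (\<Sum>k\<in>F. hcomp k p)"
    using F(1) by (induction rule: finite_induct) (auto intro: assms(2) assms(1)[OF hcomp_homog] assms(1)[OF homog_0])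
  thus ?thesis using F(2) by simp
qed

lemma hcomp_mult: "p \<in> homog l \<Longrightarrow> hcomp k (p * q) = p * hcomp (k - l) q"
proof (induction q rule: bipoly_homog_induct)
  case (1 m q)
  hence pq: "p * q \<in> homog (l + m)" by (simp add: homog_mult)
  show ?case
  proof (cases "k = l + m")
    case True thus ?thesis using pq 1 by (simp add: hcomp_id)
  next
    case False
    hence "k - l \<noteq> m" by auto
    thus ?thesis using pq 1 False by (simp add: hcomp_other)
  qed
next
  case (2 q r)
  thus ?case by (simp add: hcomp_add distrib_left)
qed

text \<open>A form of nonzero degree has no constant term, so it lies in the ideal of the two variables.\<close>

lemma homog_split:
  assumes "p \<in> homog k" "k \<noteq> 0"
  shows "\<exists>a b. a \<in> homog (k - 1) \<and> b \<in> homog (k - 1) \<and> p = x0 * a + x1 * b"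
proof -
  obtain c q where pq: "p = pCons c q" by (cases p)
  obtain e r where c: "c = pCons e r" by (cases c)
  have "e = 0"
  proof (rule ccontr)
    assume "e \<noteq> 0"
    hence "cf p 0 0 \<noteq> 0" by (simp add: pq c)
    thus False using homogD[OF assms(1)] assms(2) by fastforce
  qed
  hence p: "p = x0 * [:r:] + x1 * q"
    by (simp add: pq c x0_def x1_def)
  have "x1 * q \<in> homog k" unfolding homog_def
  proof (intro CollectI allI impI)
    fix i j assume "cf (x1 * q) i j \<noteq> 0"
    hence "cf p i j \<noteq> 0" by (auto simp: cf_x1 pq coeff_pCons split: nat.splits)
    thus "int i + int j = k" using assms(1) homogD by blast
  qed
  hence q: "x1 * q \<in> homog k" .
  have "x0 * [:r:] = p - x1 * q" using p by simp
  hence "x0 * [:r:] \<in> homog k" using q assms homog_diff by metis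
  thus ?thesis using p q homog_x0_cancel homog_x1_cancel by blast
qed

text \<open>The products of forms of degrees \<open>a\<close> and \<open>b\<close> span the forms of degree \<open>a + b\<close>;
  additive properties therefore need to be checked on products only.\<close>

lemma homog_product_induct:
  fixes c :: "'k::field bipoly"
  assumes "c \<in> homog (int a + b)"
    and "\<And>p q. p \<in> homog (int a) \<Longrightarrow> q \<in> homog b \<Longrightarrow> Q (p * q)"
    and "\<And>p q. Q p \<Longrightarrow> Q q \<Longrightarrow> Q (p + q)"
    and "b \<ge> 0"
  shows "Q c"
  using assms(1,2,3)
proof (induction a arbitrary: c Q)
  case 0
  show ?case using 0(2)[of 1 c] 0(1) by simp
next
  case (Suc a)
  obtain c' c'' where c: "c' \<in> homog (int a + b)" "c'' \<in> homog (int a + b)" "c = x0 * c' + x1 * c''"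
    using homog_split[OF Suc.prems(1)] assms(4) by (auto simp: algebra_simps)
  have "Q (x0 * c')"
  proof (rule Suc.IH[OF c(1)])
    fix p q :: "'k bipoly" assume "p \<in> homog (int a)" "q \<in> homog b"
    thus "Q (x0 * (p * q))"
      using Suc.prems(2)[of "x0 * p" q] by (simp add: mult.assoc homog_mult)
  qed (use Suc.prems(3) in \<open>simp add: distrib_left\<close>)
  moreover have "Q (x1 * c'')"
  proof (rule Suc.IH[OF c(2)])
    fix p q :: "'k bipoly" assume "p \<in> homog (int a)" "q \<in> homog b"
    thus "Q (x1 * (p * q))"
      using Suc.prems(2)[of "x1 * p" q] by (simp add: mult.assoc homog_mult)
  qed (use Suc.prems(3) in \<open>simp add: distrib_left\<close>)
  ultimately show ?case using Suc.prems(3) c(3) by blast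
qed

text \<open>Exactness of the Koszul complex of \<open>x\<^sub>0, x\<^sub>1\<close> in the middle.\<close>

lemma koszul:
  assumes "x1 * a = x0 * b"
  shows "\<exists>c. a = x0 * c \<and> b = x1 * c"
proof -
  obtain e c where b: "b = pCons e c" by (cases b)
  have "cf (x0 * b) i 0 = 0" for i unfolding assms[symmetric] by (simp add: cf_x1)
  from this[of "Suc i" for i] have "cf b i 0 = 0" for i by (simp add: cf_x0)
  hence "e = 0" by (simp add: b poly_eq_iff)
  hence bc: "b = x1 * c" by (simp add: b x1_def)
  have "x1 * a = x1 * (x0 * c)" using assms bc by (simp add: mult.left_commute)
  hence "a = x0 * c" by simp
  thus ?thesis using bc by blast
qed

text \<open>Multiplication by \<open>x\<^sub>1\<close> is injective modulo every power of \<open>x\<^sub>0\<close>.\<close>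

lemma x0_power_dvd:
  assumes "x0 ^ m dvd x1 ^ l * r"
  shows "x0 ^ m dvd (r :: 'k::field bipoly)"
  using assms
proof (induction l)
  case (Suc l)
  have *: "x0 ^ m dvd r" if "x0 ^ m dvd x1 * r" for r :: "'k bipoly"
    using that
  proof (induction m arbitrary: r)
    case (Suc m)
    from Suc.prems obtain b where "x1 * r = x0 * (x0 ^ m * b)" by (auto simp: dvd_def mult.assoc)
    then obtain c where c: "r = x0 * c" "x0 ^ m * b = x1 * c" using koszul by blast
    hence "x0 ^ m dvd c" using Suc.IH[of c] by (metis dvd_triv_left)
    thus ?case using c(1) by (simp add: mult_dvd_mono)
  qed simp
  have "x0 ^ m dvd x1 * (x1 ^ l * r)" using Suc.prems by (simp only: power_Suc mult.assoc)
  hence "x0 ^ m dvd x1 ^ l * r" by (rule *)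
  thus ?case by (rule Suc.IH)
qed simp

abbreviation lk where "lk \<equiv> Poly_Mapping.lookup"
abbreviation ks where "ks \<equiv> Poly_Mapping.keys"
abbreviation sg where "sg \<equiv> Poly_Mapping.single"

definition tdeg :: "('v \<Rightarrow>\<^sub>0 nat) \<Rightarrow> nat" where
  "tdeg \<mu> = (\<Sum>v\<in>ks \<mu>. lk \<mu> v)"

lemma tdeg_superset: "finite F \<Longrightarrow> ks \<mu> \<subseteq> F \<Longrightarrow> tdeg \<mu> = (\<Sum>v\<in>F. lk \<mu> v)"
  unfolding tdeg_def by (rule sum.mono_neutral_left) (auto simp: in_keys_iff)

lemma tdeg_add: "tdeg (\<mu> + \<nu>) = tdeg \<mu> + tdeg \<nu>"
proof -
  have F: "ks (\<mu> + \<nu>) \<subseteq> ks \<mu> \<union> ks \<nu>" by (rule keys_add)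
  show ?thesis
    using tdeg_superset[OF _ F] tdeg_superset[of "ks \<mu> \<union> ks \<nu>" \<mu>] tdeg_superset[of "ks \<mu> \<union> ks \<nu>" \<nu>]
    by (simp add: lookup_add sum.distrib)
qed

lemma tdeg_single [simp]: "tdeg (sg v n) = n"
  by (simp add: tdeg_def)

lemma tdeg_0 [simp]: "tdeg 0 = 0"
  by (simp add: tdeg_def)

lemma tpoly_sum_single: "h = (\<Sum>\<mu>\<in>ks h. sg \<mu> (lk h \<mu>))"
  by (rule poly_mapping_eqI)
     (simp add: lookup_sum lookup_single when_def in_keys_iff)

lemma tpoly_single_induct:
  assumes "\<And>\<mu> r. P (sg \<mu> r)" "\<And>h h'. P h \<Longrightarrow> P h' \<Longrightarrow> P (h + h')"
  shows "P (h :: 'a \<Rightarrow>\<^sub>0 'b::comm_monoid_add)"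
proof -
  have z: "P 0" using assms(1)[of undefined 0] by simp
  have "P (\<Sum>\<mu>\<in>F. sg \<mu> (lk h \<mu>))" for F
    by (induction F rule: infinite_finite_induct) (auto intro: assms z)
  thus ?thesis using tpoly_sum_single[of h] by metis
qed

definition mon_eval :: "('v \<Rightarrow> 's::comm_ring_1) \<Rightarrow> ('v \<Rightarrow>\<^sub>0 nat) \<Rightarrow> 's" where
  "mon_eval \<theta> \<mu> = (\<Prod>v\<in>ks \<mu>. \<theta> v ^ lk \<mu> v)"

text \<open>Evaluation along a coefficient map into an arbitrary ring; substitution in polynomials is the case \<open>c =
  tconst\<close>.\<close>

definition tp_eval :: "('r::comm_ring_1 \<Rightarrow> 's::comm_ring_1) \<Rightarrow> ('v \<Rightarrow> 's) \<Rightarrow> (('v \<Rightarrow>\<^sub>0 nat) \<Rightarrow>\<^sub>0 'r) \<Rightarrow> 's" where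
  "tp_eval c \<theta> h = (\<Sum>\<mu>\<in>ks h. c (lk h \<mu>) * mon_eval \<theta> \<mu>)"

lemma mon_eval_superset: "finite F \<Longrightarrow> ks \<mu> \<subseteq> F \<Longrightarrow> mon_eval \<theta> \<mu> = (\<Prod>v\<in>F. \<theta> v ^ lk \<mu> v)"
  unfolding mon_eval_def by (rule prod.mono_neutral_left) (auto simp: in_keys_iff)

lemma mon_eval_add: "mon_eval \<theta> (\<mu> + \<nu>) = mon_eval \<theta> \<mu> * mon_eval \<theta> \<nu>"
proof -
  have F: "ks (\<mu> + \<nu>) \<subseteq> ks \<mu> \<union> ks \<nu>" by (rule keys_add)
  show ?thesis
    using mon_eval_superset[OF _ F, of \<theta>] mon_eval_superset[of "ks \<mu> \<union> ks \<nu>" \<mu> \<theta>]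
      mon_eval_superset[of "ks \<mu> \<union> ks \<nu>" \<nu> \<theta>]
    by (simp add: lookup_add power_add prod.distrib)
qed

lemma mon_eval_0 [simp]: "mon_eval \<theta> 0 = 1"
  by (simp add: mon_eval_def)

lemma mon_eval_single [simp]: "mon_eval \<theta> (sg v n) = \<theta> v ^ n"
  by (simp add: mon_eval_def)

lemma mon_eval_linear: "mon_eval (\<lambda>v. [:0, f v:]) \<mu> = monom (mon_eval f \<mu>) (tdeg \<mu>)"
proof (induction \<mu> rule: tpoly_single_induct)
  case (1 v n)
  have "[:0, f v:] ^ n = monom (f v ^ n) n"
    by (induction n) (auto simp: monom_0 one_pCons monom_Suc smult_monom)
  thus ?case by simp
next
  case (2 \<mu> \<nu>) thus ?case by (simp add: mon_eval_add tdeg_add mult_monom)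
qed

locale coeff_hom =
  fixes c :: "'r::comm_ring_1 \<Rightarrow> 's::comm_ring_1"
  assumes c_add: "c (a + b) = c a + c b" and c_mult: "c (a * b) = c a * c b" and c_1: "c 1 = 1"
begin

lemma c_0: "c 0 = 0" using c_add[of 0 0] by simp

lemma eval_superset: "finite F \<Longrightarrow> ks h \<subseteq> F \<Longrightarrow> tp_eval c \<theta> h = (\<Sum>\<mu>\<in>F. c (lk h \<mu>) * mon_eval \<theta> \<mu>)"
  unfolding tp_eval_def by (rule sum.mono_neutral_left) (auto simp: in_keys_iff c_0)

lemma eval_add: "tp_eval c \<theta> (g + h) = tp_eval c \<theta> g + tp_eval c \<theta> h"
proof -
  have F: "ks (g + h) \<subseteq> ks g \<union> ks h" by (rule keys_add)
  show ?thesis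
    using eval_superset[OF _ F, of \<theta>] eval_superset[of "ks g \<union> ks h" g \<theta>]
      eval_superset[of "ks g \<union> ks h" h \<theta>]
    by (simp add: lookup_add distrib_right c_add sum.distrib)
qed

lemma eval_0 [simp]: "tp_eval c \<theta> 0 = 0"
  by (simp add: tp_eval_def)

lemma eval_single: "tp_eval c \<theta> (sg \<mu> r) = c r * mon_eval \<theta> \<mu>"
  by (simp add: tp_eval_def c_0)

lemma eval_mult: "tp_eval c \<theta> (g * h) = tp_eval c \<theta> g * tp_eval c \<theta> h"
proof (induction g rule: tpoly_single_induct)
  case (1 \<mu> r)
  show ?case
    by (induction h rule: tpoly_single_induct)
       (auto simp: mult_single eval_single mon_eval_add c_mult distrib_left eval_add algebra_simps)
qed (auto simp: distrib_right eval_add)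

lemma eval_1 [simp]: "tp_eval c \<theta> 1 = 1"
  using eval_single[of \<theta> 0 1] by (simp add: c_1)

lemma eval_uminus: "tp_eval c \<theta> (- h) = - tp_eval c \<theta> h"
  using eval_add[of \<theta> h "- h"] by (simp add: eq_neg_iff_add_eq_0 add.commute)

lemma eval_diff: "tp_eval c \<theta> (g - h) = tp_eval c \<theta> g - tp_eval c \<theta> h"
  using eval_add[of \<theta> g "- h"] by (simp add: eval_uminus)

lemma eval_sum: "tp_eval c \<theta> (sum f A) = (\<Sum>i\<in>A. tp_eval c \<theta> (f i))"
  by (induction A rule: infinite_finite_induct) (auto simp: eval_add)

end

lemma tconst_simps [simp]: "tconst 0 = 0" "tconst 1 = 1"
  and tconst_add: "tconst (a + b) = tconst a + tconst b"
  and tconst_mult: "tconst (a * b) = tconst a * tconst b"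
  by (simp_all add: tconst_def single_add mult_single)

lemma tconst_uminus: "tconst (- a) = - tconst a"
  by (simp add: tconst_def single_uminus)

lemma tconst_sum: "tconst (sum f A) = (\<Sum>i\<in>A. tconst (f i))"
  by (induction A rule: infinite_finite_induct) (auto simp: tconst_add)

lemma tconst_power: "tconst (a ^ n) = tconst a ^ n"
  by (induction n) (auto simp: tconst_mult)

interpretation tconst: coeff_hom tconst
  by unfold_locales (auto simp: tconst_add tconst_mult)

lemma tsubst_eval: "tsubst = tp_eval tconst"
  by (intro ext) (simp add: tsubst_def tp_eval_def mon_eval_def)

lemma tconst_times_single: "tconst r * sg \<mu> s = sg \<mu> (r * s)"
  by (simp add: tconst_def mult_single)

lemma bihomog_iff: "h \<in> bihomog a b \<longleftrightarrow> (\<forall>\<mu>. lk h \<mu> \<noteq> 0 \<longrightarrow> lk h \<mu> \<in> homog a \<and> tdeg \<mu> = b)"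
  unfolding bihomog_def tdeg_def by (auto simp: in_keys_iff)

lemma bihomog_0 [simp]: "0 \<in> bihomog a b"
  by (simp add: bihomog_iff)

lemma bihomog_single: "r \<in> homog a \<Longrightarrow> tdeg \<mu> = b \<Longrightarrow> sg \<mu> r \<in> bihomog a b"
  by (auto simp: bihomog_iff lookup_single when_def)

lemma bihomog_add: "g \<in> bihomog a b \<Longrightarrow> h \<in> bihomog a b \<Longrightarrow> g + h \<in> bihomog a b"
  unfolding bihomog_iff lookup_add by (metis add.right_neutral add.left_neutral homog_add)

lemma bihomog_uminus: "g \<in> bihomog a b \<Longrightarrow> - g \<in> bihomog a b"
  unfolding bihomog_iff by (auto intro: homog_uminus)

lemma bihomog_diff: "g \<in> bihomog a b \<Longrightarrow> h \<in> bihomog a b \<Longrightarrow> g - h \<in> bihomog a b"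
  using bihomog_add[of g a b "- h"] bihomog_uminus[of h a b] by simp

lemma bihomog_sum: "(\<And>i. i \<in> A \<Longrightarrow> f i \<in> bihomog a b) \<Longrightarrow> sum f A \<in> bihomog a b"
  by (induction A rule: infinite_finite_induct) (auto intro: bihomog_add)

lemma bihomog_mult:
  assumes "g \<in> bihomog a b" "h \<in> bihomog a' b'"
  shows "g * h \<in> bihomog (a + a') (b + b')"
proof -
  have "g * h = (\<Sum>\<mu>\<in>ks g. \<Sum>\<nu>\<in>ks h. sg \<mu> (lk g \<mu>) * sg \<nu> (lk h \<nu>))"
    using tpoly_sum_single[of g] tpoly_sum_single[of h] by (simp flip: sum_product)
  also have "\<dots> \<in> bihomog (a + a') (b + b')"
    using assms by (intro bihomog_sum)
      (auto simp: mult_single bihomog_def tdeg_add simp flip: tdeg_def intro!: bihomog_single homog_mult)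
  finally show ?thesis .
qed

lemma bihomog_mult': "g \<in> bihomog a b \<Longrightarrow> h \<in> bihomog a' b' \<Longrightarrow> k = a + a' \<Longrightarrow> l = b + b' \<Longrightarrow> g * h \<in> bihomog k l"
  using bihomog_mult by blast

lemma bihomog_tconst: "r \<in> homog a \<Longrightarrow> tconst r \<in> bihomog a 0"
  unfolding tconst_def by (simp add: bihomog_single)

lemma bihomog_tvar: "tvar v \<in> bihomog 0 1"
  unfolding tvar_def by (simp add: bihomog_single)

lemma bihomog_negative: "h \<in> bihomog a b \<Longrightarrow> a < 0 \<Longrightarrow> h = 0"
  unfolding bihomog_iff by (intro poly_mapping_eqI) (metis homog_negative lookup_zero)

lemma bihomog_unique: "h \<in> bihomog a b \<Longrightarrow> h \<in> bihomog a' b' \<Longrightarrow> (a, b) \<noteq> (a', b') \<Longrightarrow> h = 0"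
  unfolding bihomog_iff by (intro poly_mapping_eqI) (metis homog_unique lookup_zero)

definition tcomp :: "int \<Rightarrow> nat \<Rightarrow> ('k::field, 'v) tpoly \<Rightarrow> ('k, 'v) tpoly" where
  "tcomp a b h = (\<Sum>\<mu>\<in>ks h. if tdeg \<mu> = b then sg \<mu> (hcomp a (lk h \<mu>)) else 0)"

lemma lookup_tcomp: "lk (tcomp a b h) \<mu> = (if tdeg \<mu> = b then hcomp a (lk h \<mu>) else 0)"
proof -
  have "lk (tcomp a b h) \<mu> = (\<Sum>\<nu>\<in>ks h. if \<nu> = \<mu> then (if tdeg \<mu> = b then hcomp a (lk h \<mu>) else 0) else 0)"
    unfolding tcomp_def lookup_sum by (intro sum.cong) (auto simp: lookup_single when_def)
  also have "\<dots> = (if tdeg \<mu> = b then hcomp a (lk h \<mu>) else 0)"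
    by (auto simp: in_keys_iff)
  finally show ?thesis .
qed

lemma tcomp_bihomog [simp]: "tcomp a b h \<in> bihomog a b"
  unfolding bihomog_iff by (auto simp: lookup_tcomp split: if_splits)

lemma tcomp_add: "tcomp a b (g + h) = tcomp a b g + tcomp a b h"
  by (rule poly_mapping_eqI) (simp add: lookup_tcomp lookup_add hcomp_add)

lemma tcomp_0 [simp]: "tcomp a b 0 = 0"
  by (rule poly_mapping_eqI) (simp add: lookup_tcomp)

lemma tcomp_id: "h \<in> bihomog a b \<Longrightarrow> tcomp a b h = h"
  unfolding bihomog_iff
  by (rule poly_mapping_eqI) (metis lookup_tcomp hcomp_id hcomp_0)

lemma tcomp_other: "h \<in> bihomog a b \<Longrightarrow> (a, b) \<noteq> (a', b') \<Longrightarrow> tcomp a' b' h = 0"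
  unfolding bihomog_iff
  by (rule poly_mapping_eqI) (metis lookup_tcomp hcomp_other hcomp_0 lookup_zero)

lemma tpoly_bihomog_induct:
  assumes "\<And>a b h. h \<in> bihomog a b \<Longrightarrow> P h" "\<And>g h. P g \<Longrightarrow> P h \<Longrightarrow> P (g + h)"
  shows "P (h :: ('k::field, 'v) tpoly)"
proof (induction h rule: tpoly_single_induct)
  case (1 \<mu> r)
  show ?case
    by (induction r rule: bipoly_homog_induct) (auto intro: assms bihomog_single simp: single_add)
qed (use assms in blast)

lemma tcomp_mult:
  assumes "g \<in> bihomog a' b'"
  shows "tcomp a b (h * g) = (if b' \<le> b then tcomp (a - a') (b - b') h * g else 0)"
proof (induction h rule: tpoly_bihomog_induct)
  case (1 a'' b'' h)
  have hg: "h * g \<in> bihomog (a'' + a') (b'' + b')" using 1 assms by (rule bihomog_mult)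
  show ?case
  proof (cases "a = a'' + a' \<and> b = b'' + b'")
    case True thus ?thesis using hg 1 by (simp add: tcomp_id)
  next
    case False
    hence "(a'' + a', b'' + b') \<noteq> (a, b)" by auto
    moreover have "(a'', b'') \<noteq> (a - a', b - b')" if "b' \<le> b" using False that by auto
    ultimately show ?thesis using tcomp_other[OF hg] tcomp_other[OF 1] by auto
  qed
qed (auto simp: tcomp_add distrib_right)

section \<open>Minimal generators of a bihomogeneous ideal\<close>

definition ksc :: "'k::field \<Rightarrow> ('k, 'v) tpoly \<Rightarrow> ('k, 'v) tpoly" where
  "ksc c h = tconst (kc c) * h"

interpretation kS: vector_space "ksc :: 'k::field \<Rightarrow> ('k, 'v) tpoly \<Rightarrow> ('k, 'v) tpoly"
  by unfold_locales (simp_all add: ksc_def tconst_add tconst_mult algebra_simps)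

interpretation ideal: module "times :: 'a::comm_ring_1 \<Rightarrow> 'a \<Rightarrow> 'a"
  by unfold_locales (simp_all add: algebra_simps)

lemma subspace_bihomog: "kS.subspace (bihomog a b)"
  by (rule kS.subspaceI) (auto simp: ksc_def intro: bihomog_add bihomog_mult'[OF bihomog_tconst[OF homog_kc]])

lemma ideal_subspace: "ideal.subspace J \<Longrightarrow> kS.subspace J"
  by (rule kS.subspaceI) (auto simp: ksc_def ideal.subspace_def)

lemma tdeg_eq_0: "tdeg \<mu> = 0 \<Longrightarrow> \<mu> = 0"
  by (rule poly_mapping_eqI) (auto simp: tdeg_def in_keys_iff)

lemma bihomog_0_0:
  fixes c :: "('k::field, 'v) tpoly"
  assumes c: "c \<in> bihomog 0 0"
  shows "\<exists>l. c = tconst (kc l)"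
proof (intro exI poly_mapping_eqI)
  fix \<mu>
  show "lk c \<mu> = lk (tconst (kc (cf (lk c 0) 0 0))) \<mu>"
  proof (cases "\<mu> = 0")
    case True
    have "lk c 0 \<in> homog 0" using c homog_0[of 0] unfolding bihomog_iff by (cases "lk c 0 = 0") auto
    thus ?thesis unfolding True tconst_def lookup_single_eq by (rule homog_zero_const)
  next
    case False
    hence "tdeg \<mu> \<noteq> 0" using tdeg_eq_0 by auto
    hence "lk c \<mu> = 0" using c unfolding bihomog_iff by auto
    moreover have "lk (tconst r) \<mu> = 0" for r :: "'k bipoly"
      using False unfolding tconst_def by (simp only: lookup_single when_def) auto
    ultimately show ?thesis by (simp only:)
  qed
qed

text \<open>In the induction it matters that the finite set of bidegrees may be enlarged: two elements can then be expanded over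
  the same set.\<close>

lemma sum_tcomp: "\<exists>F. finite F \<and> h = (\<Sum>(a,b)\<in>F. tcomp a b h)"
proof -
  have "\<exists>F. finite F \<and> (\<forall>F'. finite F' \<longrightarrow> F \<subseteq> F' \<longrightarrow> h = (\<Sum>(a,b)\<in>F'. tcomp a b h))"
  proof (induction h rule: tpoly_bihomog_induct)
    case (1 a b h)
    have "h = (\<Sum>(a',b')\<in>F'. tcomp a' b' h)" if "finite F'" "{(a,b)} \<subseteq> F'" for F'
    proof -
      have "(\<Sum>(a',b')\<in>F'. tcomp a' b' h) = (\<Sum>(a',b')\<in>{(a,b)}. tcomp a' b' h)"
        using that by (intro sum.mono_neutral_right) (auto split: prod.splits intro!: tcomp_other[OF 1])
      thus ?thesis using tcomp_id[OF 1] by simp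
    qed
    thus ?case by (intro exI[of _ "{(a,b)}"]) blast
  next
    case (2 g h)
    then obtain F G where
      F: "finite F" "\<And>F'. finite F' \<Longrightarrow> F \<subseteq> F' \<Longrightarrow> g = (\<Sum>(a,b)\<in>F'. tcomp a b g)" and
      G: "finite G" "\<And>F'. finite F' \<Longrightarrow> G \<subseteq> F' \<Longrightarrow> h = (\<Sum>(a,b)\<in>F'. tcomp a b h)" by blast
    have "g + h = (\<Sum>(a,b)\<in>F'. tcomp a b (g + h))" if "finite F'" "F \<union> G \<subseteq> F'" for F'
      using F(2)[of F'] G(2)[of F'] that by (simp add: tcomp_add sum.distrib case_prod_unfold)
    thus ?case using F(1) G(1) by (intro exI[of _ "F \<union> G"]) blast
  qed
  thus ?thesis by blast
qed

lemma mon_split: "v \<in> ks \<mu> \<Longrightarrow> (\<mu> :: 'v \<Rightarrow>\<^sub>0 nat) = sg v 1 + (\<mu> - sg v 1)"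
  by (rule poly_mapping_eqI) (auto simp: lookup_add lookup_minus lookup_single when_def in_keys_iff)

locale graded_ideal =
  fixes K :: "('k::field, 'v) tpoly set"
  assumes ideal_K: "ideal.subspace K"
    and comp_K: "h \<in> K \<Longrightarrow> tcomp a b h \<in> K"
begin

definition comp :: "int \<Rightarrow> nat \<Rightarrow> ('k, 'v) tpoly set" where
  "comp a b = K \<inter> bihomog a b"

text \<open>The components of bidegree \<open>(a, b)\<close> of \<open>K\<close> and of its product with the ideal of all
  variables are called \<open>comp a b\<close> and \<open>low a b\<close>; their quotient counts the minimal generators of bidegree
  \<open>(a, b)\<close>.\<close>

definition lower_multiples :: "int \<Rightarrow> nat \<Rightarrow> ('k, 'v) tpoly set" where
  "lower_multiples a b = (\<lambda>h. tconst x0 * h) ` comp (a - 1) b \<union> (\<lambda>h. tconst x1 * h) ` comp (a - 1) b \<union>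
     {tvar v * h | v h b'. b = Suc b' \<and> h \<in> comp a b'}"

definition low :: "int \<Rightarrow> nat \<Rightarrow> ('k, 'v) tpoly set" where
  "low a b = kS.span (lower_multiples a b)"

lemma K_mult: "h \<in> K \<Longrightarrow> c * h \<in> K"
  using ideal_K unfolding ideal.subspace_def by blast

lemma K_sub: "kS.subspace K"
  using ideal_K by (rule ideal_subspace)

lemma comp_sub: "kS.subspace (comp a b)"
  unfolding comp_def using K_sub subspace_bihomog by (rule kS.subspace_inter)

lemma low_sub: "kS.subspace (low a b)"
  unfolding low_def by (rule kS.subspace_span)

lemma low_comp: "low a b \<subseteq> comp a b"
  unfolding low_def
proof (rule kS.span_minimal[OF _ comp_sub])
  show "lower_multiples a b \<subseteq> comp a b"
    unfolding lower_multiples_def comp_def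
    by (auto intro!: K_mult bihomog_mult'[OF bihomog_tconst[OF homog_x0]] 
        bihomog_mult'[OF bihomog_tconst[OF homog_x1]] bihomog_mult'[OF bihomog_tvar])
qed

lemma x0_low: "h \<in> comp (a - 1) b \<Longrightarrow> tconst x0 * h \<in> low a b"
  and x1_low: "h \<in> comp (a - 1) b \<Longrightarrow> tconst x1 * h \<in> low a b"
  and tvar_low: "h \<in> comp a b \<Longrightarrow> tvar v * h \<in> low a (Suc b)"
  unfolding low_def lower_multiples_def by (auto intro!: kS.span_base)

text \<open>A coefficient of positive bidegree lies in the ideal of all variables, because each of its terms contains some
  \<open>T\<^sub>v\<close> or has positive degree in \<open>x\<^sub>0, x\<^sub>1\<close>.\<close>

lemma mult_low:
  assumes g: "g \<in> comp a' b'" and c: "c \<in> bihomog (a - a') (b - b')"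
    and le: "b' \<le> b" and ne: "(a, b) \<noteq> (a', b')"
  shows "c * g \<in> low a b"
proof -
  have "sg \<mu> r * g \<in> low a b" if r: "r \<in> homog (a - a')" and \<mu>: "tdeg \<mu> = b - b'" for \<mu> r
  proof (cases "b' < b")
    case True
    hence "ks \<mu> \<noteq> {}" using \<mu> by (auto simp: tdeg_def)
    then obtain v where v: "v \<in> ks \<mu>" by blast
    define \<nu> where "\<nu> = \<mu> - sg v 1"
    have eq: "\<mu> = sg v 1 + \<nu>" unfolding \<nu>_def using v by (rule mon_split)
    have "tdeg \<mu> = 1 + tdeg \<nu>" by (subst eq) (simp add: tdeg_add)
    hence d: "tdeg \<nu> + b' = b - 1" using \<mu> True by simp
    have "sg \<nu> r * g \<in> bihomog a (b - 1)"
      using bihomog_mult[OF bihomog_single[OF r refl, of \<nu>], of g a' b'] g d unfolding comp_def by simp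
    hence "sg \<nu> r * g \<in> comp a (b - 1)" using K_mult g unfolding comp_def by blast
    hence "tvar v * (sg \<nu> r * g) \<in> low a (Suc (b - 1))" by (rule tvar_low)
    moreover have "sg \<mu> r = tvar v * sg \<nu> r"
      unfolding tvar_def mult_single eq[symmetric] by (simp only: mult_1_left)
    ultimately show ?thesis using True by (simp only: mult.assoc) simp
  next
    case False
    hence "a - a' \<noteq> 0" using le ne by auto
    then obtain p q where pq: "p \<in> homog (a - a' - 1)" "q \<in> homog (a - a' - 1)" "r = x0 * p + x1 * q"
      using homog_split[OF r] by blast
    have "sg \<mu> p * g \<in> bihomog (a - 1) b" "sg \<mu> q * g \<in> bihomog (a - 1) b"
      using bihomog_mult[OF bihomog_single[OF pq(1) \<mu>], of g a' b']
        bihomog_mult[OF bihomog_single[OF pq(2) \<mu>], of g a' b'] g le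
      unfolding comp_def by simp_all
    hence "sg \<mu> p * g \<in> comp (a - 1) b" "sg \<mu> q * g \<in> comp (a - 1) b"
      using K_mult g unfolding comp_def by auto
    hence "tconst x0 * (sg \<mu> p * g) + tconst x1 * (sg \<mu> q * g) \<in> low a b"
      by (intro kS.subspace_add[OF low_sub] x0_low x1_low)
    moreover have "sg \<mu> r = tconst x0 * sg \<mu> p + tconst x1 * sg \<mu> q"
      unfolding pq(3) tconst_times_single single_add ..
    ultimately show ?thesis by (simp only: distrib_right mult.assoc)
  qed
  moreover have "c * g = (\<Sum>\<mu>\<in>ks c. sg \<mu> (lk c \<mu>) * g)"
    by (subst tpoly_sum_single[of c]) (rule sum_distrib_right)
  ultimately show ?thesis
    using c unfolding bihomog_def by (auto intro!: kS.subspace_sum[OF low_sub] simp flip: tdeg_def)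
qed

text \<open>In the component of bidegree \<open>(a, b)\<close> of a combination of generators, those generators that have this
  bidegree themselves occur with scalar coefficients, and all others with coefficients of positive bidegree.\<close>

lemma tcomp_ideal_gen:
  assumes G: "G \<subseteq> K" "\<forall>g\<in>G. \<exists>a b. g \<in> bihomog a b" and h: "h \<in> ideal_gen G"
  shows "tcomp a b h \<in> kS.span (low a b \<union> (G \<inter> bihomog a b))"
  using h
proof (induction rule: ideal.span_induct_alt)
  case base
  show ?case by (simp add: kS.span_zero)
next
  case (step c g h)
  obtain a' b' where g: "g \<in> bihomog a' b'" using step(1) G(2) by blast
  have "tcomp a b (c * g) \<in> kS.span (low a b \<union> (G \<inter> bihomog a b))"
  proof (cases "b' \<le> b")
    case True
    hence t: "tcomp a b (c * g) = tcomp (a - a') (b - b') c * g"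
      using tcomp_mult[OF g] by simp
    show ?thesis
    proof (cases "(a, b) = (a', b')")
      case eq: True
      then obtain l where "tcomp (a - a') (b - b') c = tconst (kc l)"
        using bihomog_0_0[OF tcomp_bihomog[of 0 0 c]] by auto
      hence "tcomp a b (c * g) = ksc l g" using t by (simp add: ksc_def)
      moreover have "g \<in> G \<inter> bihomog a b" using g eq step(1) by simp
      ultimately show ?thesis by (simp add: kS.span_scale kS.span_base)
    next
      case False
      have "g \<in> comp a' b'" using g step(1) G(1) unfolding comp_def by blast
      hence "tcomp a b (c * g) \<in> low a b"
        using t mult_low[OF _ tcomp_bihomog True False] by simp
      thus ?thesis by (simp add: kS.span_base)
    qed
  qed (use tcomp_mult[OF g] kS.span_zero in auto)
  thus ?case using step(2) by (simp add: tcomp_add kS.span_add)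
qed

text \<open>A multiple of \<open>g\<close> has no nonzero components in which the first or the second degree is smaller than that
  of \<open>g\<close>.\<close>

lemma tcomp_ideal_gen_remove:
  assumes g: "g \<in> bihomog a b" and G: "\<forall>g\<in>G. \<exists>a b. g \<in> bihomog a b" and h: "h \<in> ideal_gen G"
    and lt: "a' < a \<or> b' < b"
  shows "tcomp a' b' h \<in> ideal_gen (G - {g})"
  using h
proof (induction rule: ideal.span_induct_alt)
  case base
  show ?case by (simp add: ideal.span_zero)
next
  case (step c f h)
  obtain a'' b'' where f: "f \<in> bihomog a'' b''" using step(1) G by blast
  have "tcomp a' b' (c * f) \<in> ideal_gen (G - {g})"
  proof (cases "f = g")
    case True
    have "tcomp a' b' (c * g) = 0"
    proof (cases "a' < a")
      case True
      hence "tcomp (a' - a) (b' - b) c = 0" by (intro bihomog_negative[OF tcomp_bihomog]) simp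
      thus ?thesis by (simp add: tcomp_mult[OF g])
    qed (use lt in \<open>simp add: tcomp_mult[OF g]\<close>)
    thus ?thesis using True by (simp add: ideal.span_zero)
  next
    case False
    hence "f \<in> G - {g}" using step(1) by blast
    hence "x * f \<in> ideal_gen (G - {g})" for x
      by (intro ideal.span_scale ideal.span_base)
    thus ?thesis unfolding tcomp_mult[OF f] by (simp add: ideal.span_zero)
  qed
  thus ?case using step(2) by (simp add: tcomp_add ideal.span_add)
qed

text \<open>Graded Nakayama lemma. Generators of bidegree \<open>(a, b)\<close> that satisfied a linear relation modulo \<open>low
  a b\<close> would be redundant: \<open>low a b\<close> comes from components of lower bidegree, which only involve generators of
  lower bidegree, so the relation expresses one generator by the others.\<close>

lemma minimal_generators_basis_mod:
  assumes "minimal_bihomog_generators K G"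
  shows "basis_mod ksc (low a b) (comp a b) (G \<inter> bihomog a b)"
proof -
  have hom: "\<forall>g\<in>G. \<exists>a b. g \<in> bihomog a b" and gen: "ideal_gen G = K"
    and irr: "\<And>g. g \<in> G \<Longrightarrow> ideal_gen (G - {g}) \<noteq> K"
    using assms unfolding minimal_bihomog_generators_def by auto
  have GK: "G \<subseteq> K" using gen ideal.span_superset by blast
  have "comp a b \<subseteq> kS.span (low a b \<union> (G \<inter> bihomog a b))"
  proof
    fix h assume "h \<in> comp a b"
    hence "h \<in> ideal_gen G" "tcomp a b h = h" using gen tcomp_id unfolding comp_def by auto
    thus "h \<in> kS.span (low a b \<union> (G \<inter> bihomog a b))"
      using tcomp_ideal_gen[OF GK hom] by metis
  qed
  moreover have "g \<notin> kS.span (low a b \<union> (G \<inter> bihomog a b - {g}))" if g: "g \<in> G \<inter> bihomog a b" for g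
  proof
    assume *: "g \<in> kS.span (low a b \<union> (G \<inter> bihomog a b - {g}))"
    let ?J = "ideal_gen (G - {g})"
    have J: "kS.subspace ?J" by (rule ideal_subspace) (rule ideal.subspace_span)
    have small: "h \<in> ?J" if "h \<in> comp a' b'" "a' < a \<or> b' < b" for h a' b'
      using tcomp_ideal_gen_remove[of g a b G h a' b'] that g hom gen tcomp_id[of h a' b']
      unfolding comp_def by auto
    \<comment> \<open>\<open>low a b\<close> is built from components in which \<open>g\<close> cannot occur\<close>
    have "low a b \<subseteq> ?J"
      unfolding low_def lower_multiples_def
      by (intro kS.span_minimal[OF _ J]) (auto intro!: ideal.span_scale small)
    moreover have "G \<inter> bihomog a b - {g} \<subseteq> ?J" using ideal.span_superset[of "G - {g}"] by blast
    ultimately have "g \<in> ?J" using * kS.span_minimal[OF _ J, of "low a b \<union> (G \<inter> bihomog a b - {g})"] by blast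
    hence "G \<subseteq> ?J" using ideal.span_superset[of "G - {g}"] by blast
    hence "ideal_gen G \<subseteq> ?J" using ideal.span_minimal ideal.subspace_span by blast
    moreover have "?J \<subseteq> ideal_gen G" by (rule ideal.span_mono) blast
    ultimately show False using irr g gen by blast
  qed
  moreover have "G \<inter> bihomog a b \<subseteq> comp a b" using GK unfolding comp_def by blast
  ultimately show ?thesis unfolding basis_mod_def by blast
qed

text \<open>The converse of the previous lemma. That the union generates is an induction on the total degree; components of
  negative \<open>x\<close>-degree vanish, which starts the induction.\<close>

lemma basis_mod_minimal_generators:
  assumes X: "\<And>a b. basis_mod ksc (low a b) (comp a b) (X a b)"
  shows "minimal_bihomog_generators K (\<Union>a b. X a b)"
proof -
  define G where "G = (\<Union>a b. X a b)"
  have Xc: "X a b \<subseteq> comp a b" for a b using X unfolding basis_mod_def by blast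
  have nz: "0 \<notin> X a b" for a b using X[of a b] kS.span_zero unfolding basis_mod_def by blast
  have GX: "G \<inter> bihomog a b = X a b" for a b
  proof (rule equalityI; rule subsetI)
    fix h assume h: "h \<in> G \<inter> bihomog a b"
    then obtain a' b' where h': "h \<in> X a' b'" unfolding G_def by blast
    have "(a', b') = (a, b)"
      using bihomog_unique[of h a' b' a b] h h' Xc nz unfolding comp_def by blast
    thus "h \<in> X a b" using h' by simp
  next
    fix h assume "h \<in> X a b"
    thus "h \<in> G \<inter> bihomog a b" using Xc unfolding G_def comp_def by blast
  qed
  have GK: "G \<subseteq> K" using Xc unfolding G_def comp_def by blast
  have hom: "\<forall>g\<in>G. \<exists>a b. g \<in> bihomog a b" using Xc unfolding G_def comp_def by blast
  have J: "kS.subspace (ideal_gen G)" by (rule ideal_subspace) (rule ideal.subspace_span)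
  have cg: "comp a b \<subseteq> ideal_gen G" for a b
  proof (induction "nat a + b" arbitrary: a b rule: less_induct)
    case less
    have "lower_multiples a b \<subseteq> ideal_gen G"
    proof -
      have 1: "comp (a - 1) b \<subseteq> ideal_gen G"
      proof (cases "a \<ge> 1")
        case True thus ?thesis using less[of "a - 1" b] by auto
      next
        case False
        thus ?thesis using bihomog_negative[of _ "a - 1" b] ideal.span_zero unfolding comp_def by fastforce
      qed
      have 2: "comp a b' \<subseteq> ideal_gen G" if "b = Suc b'" for b' using less[of a b'] that by auto
      show ?thesis unfolding lower_multiples_def using 1 2 by (auto intro!: ideal.span_scale)
    qed
    hence "low a b \<subseteq> ideal_gen G" unfolding low_def by (rule kS.span_minimal[OF _ J])
    moreover have "X a b \<subseteq> ideal_gen G" using ideal.span_superset[of G] unfolding G_def by blast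
    ultimately have "kS.span (low a b \<union> X a b) \<subseteq> ideal_gen G" by (intro kS.span_minimal[OF _ J]) auto
    thus ?case using X[of a b] unfolding basis_mod_def by blast
  qed
  have "K \<subseteq> ideal_gen G"
  proof
    fix h assume h: "h \<in> K"
    obtain F where F: "h = (\<Sum>(a,b)\<in>F. tcomp a b h)" using sum_tcomp by blast
    have "tcomp a b h \<in> comp a b" for a b using comp_K[OF h] unfolding comp_def by simp
    hence "tcomp a b h \<in> ideal_gen G" for a b using cg by blast
    hence "(\<Sum>(a,b)\<in>F. tcomp a b h) \<in> ideal_gen G" by (intro ideal.span_sum) auto
    thus "h \<in> ideal_gen G" using F by simp
  qed
  moreover have "ideal_gen G \<subseteq> K" using GK ideal_K by (rule ideal.span_minimal)
  ultimately have gen: "ideal_gen G = K" by blast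
  have "ideal_gen (G - {g}) \<noteq> K" if g: "g \<in> G" for g
  proof
    assume eq: "ideal_gen (G - {g}) = K"
    obtain a b where ab: "g \<in> X a b" using g unfolding G_def by blast
    have gK: "g \<in> ideal_gen (G - {g})" and gb: "g \<in> bihomog a b"
      using eq GK g Xc ab unfolding comp_def by blast+
    have "tcomp a b g \<in> kS.span (low a b \<union> ((G - {g}) \<inter> bihomog a b))"
      using GK hom by (intro tcomp_ideal_gen[OF _ _ gK]) auto
    moreover have "(G - {g}) \<inter> bihomog a b = X a b - {g}" using GX by blast
    ultimately show False using tcomp_id[OF gb] X[of a b] ab unfolding basis_mod_def by simp
  qed
  thus ?thesis using gen hom unfolding minimal_bihomog_generators_def G_def by blast
qed

end

section \<open>Finiteness of minimal generating sets\<close>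

lemma mon_eval_tvar: "mon_eval tvar \<mu> = (sg \<mu> 1 :: ('k::field, 'v) tpoly)"
proof -
  have p: "tvar v ^ n = (sg (sg v n) 1 :: ('k, 'v) tpoly)" for v :: 'v and n
    by (induction n) (auto simp: tvar_def mult_single simp flip: single_add)
  have "(\<Prod>v\<in>F. tvar v ^ lk \<mu> v) = (sg (\<Sum>v\<in>F. sg v (lk \<mu> v)) 1 :: ('k, 'v) tpoly)" for F
    by (induction F rule: infinite_finite_induct) (auto simp: p mult_single)
  thus ?thesis unfolding mon_eval_def using tpoly_sum_single[of \<mu>] by simp
qed

lemma adjoin_superset: "is_subring A \<Longrightarrow> A \<subseteq> adjoin A t"
proof
  fix a assume "is_subring A" "a \<in> A"
  hence "range (coeff [:a:]) \<subseteq> A" by (auto simp: is_subring_def coeff_pCons split: nat.split)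
  hence "poly [:a:] t \<in> adjoin A t" unfolding adjoin_def by blast
  thus "a \<in> adjoin A t" by simp
qed

lemma adjoin_self: "is_subring A \<Longrightarrow> t \<in> adjoin A t"
proof -
  assume "is_subring A"
  hence "range (coeff [:0, 1:]) \<subseteq> A" by (auto simp: is_subring_def coeff_pCons split: nat.split)
  hence "poly [:0, 1:] t \<in> adjoin A t" unfolding adjoin_def by blast
  thus "t \<in> adjoin A t" by simp
qed

lemma subring_power: "is_subring A \<Longrightarrow> x \<in> A \<Longrightarrow> x ^ n \<in> A"
  by (induction n) (auto simp: is_subring_def)

lemma subring_prod: "is_subring A \<Longrightarrow> (\<And>i. i \<in> X \<Longrightarrow> g i \<in> A) \<Longrightarrow> prod g X \<in> A"
  by (induction X rule: infinite_finite_induct) (auto simp: is_subring_def)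

lemma noetherian_scalars: "noetherian_on (range (\<lambda>c. tconst (kc c)) :: ('k::field, 'v) tpoly set)"
  (is "noetherian_on ?A")
proof -
  have A: "is_subring ?A" unfolding is_subring_def
  proof (intro conjI ballI)
    show "0 \<in> ?A" using rangeI[of "\<lambda>c. tconst (kc c)" 0] by simp
    show "1 \<in> ?A" using rangeI[of "\<lambda>c. tconst (kc c)" 1] by simp
    fix x assume "x \<in> ?A"
    then obtain c where c: "x = tconst (kc c)" by auto
    have "- x = tconst (kc (- c))" by (simp add: c kc_def flip: tconst_uminus)
    thus "- x \<in> ?A" by (rule range_eqI)
    fix y assume "y \<in> ?A"
    then obtain d where d: "y = tconst (kc d)" by auto
    have "x + y = tconst (kc (c + d))" by (simp add: c d tconst_add)
    thus "x + y \<in> ?A" by (rule range_eqI)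
    have "x * y = tconst (kc (c * d))" by (simp add: c d tconst_mult)
    thus "x * y \<in> ?A" by (rule range_eqI)
  qed
  moreover have "\<exists>N. h N \<in> combinations ?A h N" if h: "range h \<subseteq> ?A" for h
  proof (cases "h 0 = 0")
    case True
    thus ?thesis using combinations_closed(1)[OF A] by metis
  next
    case False
    obtain c d where cd: "h 0 = tconst (kc c)" "h 1 = tconst (kc d)" using h by (meson imageE range_subsetD)
    have "c \<noteq> 0" using False cd by auto
    hence "tconst (kc d) = tconst (kc (d / c)) * tconst (kc c)" by (simp flip: tconst_mult kc_simps(4))
    hence "h 1 = tconst (kc (d / c)) * h 0" using cd by metis
    hence "h 1 \<in> combinations ?A h 1"
      using combinations_closed(3)[OF A _ combinations_closed(4)[OF A, of 0 1 h]] by auto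
    thus ?thesis by blast
  qed
  ultimately show ?thesis unfolding noetherian_on_def by blast
qed

text \<open>The variables \<open>x\<^sub>0, x\<^sub>1\<close> and the finitely many \<open>T\<^sub>v\<close> are adjoined to the
  field of scalars one by one.\<close>

lemma noetherian_tpoly: "noetherian_on (UNIV :: ('k::field, 'v::finite) tpoly set)"
proof -
  let ?A0 = "range (\<lambda>c. tconst (kc c)) :: ('k, 'v) tpoly set"
  have step: "noetherian_on (adjoin A t) \<and> A \<subseteq> adjoin A t \<and> t \<in> adjoin A t" if "noetherian_on A"
    for A and t :: "('k, 'v) tpoly"
    using that noetherian_adjoin[OF that, of t] adjoin_superset adjoin_self
    unfolding noetherian_on_def by blast
  have "\<exists>A. noetherian_on A \<and> ?A0 \<subseteq> A \<and> tconst x0 \<in> A \<and> tconst x1 \<in> A \<and> tvar ` F \<subseteq> A" for F :: "'v set"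
    using finite[of F]
  proof (induction F rule: finite_induct)
    case empty
    let ?A1 = "adjoin ?A0 (tconst x0)"
    have "noetherian_on ?A1 \<and> ?A0 \<subseteq> ?A1 \<and> tconst x0 \<in> ?A1" using step noetherian_scalars by blast
    moreover from this have "noetherian_on (adjoin ?A1 (tconst x1)) \<and> ?A1 \<subseteq> adjoin ?A1 (tconst x1) \<and>
       tconst x1 \<in> adjoin ?A1 (tconst x1)" using step by blast
    ultimately show ?case by (intro exI[of _ "adjoin ?A1 (tconst x1)"]) blast
  next
    case (insert v F)
    then obtain A where A: "noetherian_on A \<and> ?A0 \<subseteq> A \<and> tconst x0 \<in> A \<and> tconst x1 \<in> A \<and> tvar ` F \<subseteq> A" by blast
    have "noetherian_on (adjoin A (tvar v)) \<and> A \<subseteq> adjoin A (tvar v) \<and> tvar v \<in> adjoin A (tvar v)"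
      using step A by blast
    thus ?case using A by (intro exI[of _ "adjoin A (tvar v)"]) blast
  qed
  from this[of UNIV] obtain A where A: "noetherian_on A" "?A0 \<subseteq> A" "tconst x0 \<in> A" "tconst x1 \<in> A"
    "range tvar \<subseteq> A" by blast
  have sub: "is_subring A" using A(1) unfolding noetherian_on_def by blast
  have add: "x + y \<in> A" and mult: "x * y \<in> A" if "x \<in> A" "y \<in> A" for x y
    using sub that unfolding is_subring_def by blast+
  have c0: "tconst [:c:] \<in> A" for c :: "'k poly"
  proof (induction c)
    case 0 thus ?case using sub unfolding is_subring_def by simp
  next
    case (pCons e c)
    have eq: "[:pCons e c:] = kc e + x0 * [:c:]" by (simp add: kc_def x0_def)
    have "tconst (kc e) \<in> A" using A(2) by auto
    thus ?case using pCons A(3) unfolding eq tconst_add tconst_mult by (intro add mult) auto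
  qed
  have c1: "tconst r \<in> A" for r
  proof (induction r)
    case 0 thus ?case using sub unfolding is_subring_def by simp
  next
    case (pCons c r)
    have eq: "pCons c r = [:c:] + x1 * r" by (simp add: x1_def)
    show ?case using pCons A(4) c0 unfolding eq tconst_add tconst_mult by (intro add mult) auto
  qed
  have "h \<in> A" for h
  proof (induction h rule: tpoly_single_induct)
    case (1 \<mu> r)
    have "mon_eval tvar \<mu> \<in> A" unfolding mon_eval_def
      using A(5) by (intro subring_prod[OF sub] subring_power[OF sub]) auto
    moreover have "sg \<mu> r = tconst r * mon_eval tvar \<mu>"
      by (simp add: mon_eval_tvar tconst_times_single)
    ultimately show ?case using c1 mult by metis
  qed (rule add)
  hence "A = UNIV" by blast
  thus ?thesis using A(1) by simp
qed

text \<open>An infinite irredundant set would contain an injective sequence, and by the chain condition one of its terms is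
  redundant.\<close>

lemma minimal_generators_finite:
  fixes G :: "('k::field, 'v::finite) tpoly set"
  assumes "minimal_bihomog_generators K G"
  shows "finite G"
proof (rule ccontr)
  assume "infinite G"
  then obtain h :: "nat \<Rightarrow> _" where h: "inj h" "range h \<subseteq> G" using infinite_countable_subset by blast
  obtain N where "h N \<in> combinations UNIV h N"
    using noetherian_tpoly unfolding noetherian_on_def by blast
  then obtain c where c: "h N = (\<Sum>k<N. c k * h k)" unfolding combinations_def by blast
  have "h k \<in> G - {h N}" if "k < N" for k
    using h that injD[OF h(1), of k N] by auto
  hence "(\<Sum>k<N. c k * h k) \<in> ideal_gen (G - {h N})"
    by (intro ideal.span_sum ideal.span_scale ideal.span_base) auto
  hence "G \<subseteq> ideal_gen (G - {h N})" using c ideal.span_superset[of "G - {h N}"] by auto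
  hence "ideal_gen G \<subseteq> ideal_gen (G - {h N})" using ideal.span_minimal ideal.subspace_span by blast
  moreover have "ideal_gen (G - {h N}) \<subseteq> ideal_gen G" by (rule ideal.span_mono) blast
  ultimately have "ideal_gen (G - {h N}) = ideal_gen G" by blast
  moreover have "h N \<in> G" using h(2) by blast
  ultimately show False using assms unfolding minimal_bihomog_generators_def by blast
qed

text \<open>The numbers of generators are the dimensions of \<open>comp a b\<close> modulo \<open>low a b\<close>, hence the same
  for all minimal generating sets. Below \<open>x\<close>-degree \<open>e\<close> any bases serve to complete the given ones to a
  generating set.\<close>

lemma (in graded_ideal) high_generatorsI:
  assumes X: "\<And>a b. e \<le> a \<Longrightarrow> basis_mod ksc (low a b) (comp a b) (X a b)"
    and Xf: "\<And>a b. e \<le> a \<Longrightarrow> finite (X a b)"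
    and Xc: "\<And>a b. e \<le> a \<Longrightarrow> card (X a b) = card (B \<inter> bihomog a b) + card {x \<in> J. \<beta> x = (a, b)}"
    and B: "B \<subseteq> (\<Union>a\<in>{e..}. \<Union>b. X a b)" and J: "finite J"
    and fin: "\<And>G. minimal_bihomog_generators K G \<Longrightarrow> finite G"
  shows "high_generators K e B J \<beta>"
proof -
  have "\<exists>Y. basis_mod ksc (low a b) (comp a b) Y" for a b
    using kS.basis_mod_exists[OF low_sub low_comp] .
  then obtain Y where Y: "\<And>a b. basis_mod ksc (low a b) (comp a b) (Y a b)" by metis
  define Z where "Z a b = (if e \<le> a then X a b else Y a b)" for a b
  have Z: "basis_mod ksc (low a b) (comp a b) (Z a b)" for a b unfolding Z_def using X Y by simp
  have "B \<subseteq> (\<Union>a b. Z a b)" using B unfolding Z_def by fastforce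
  hence "\<exists>G. minimal_bihomog_generators K G \<and> B \<subseteq> G"
    using basis_mod_minimal_generators[of Z, OF Z] by blast
  moreover have "card (G \<inter> bihomog a b) = card (B \<inter> bihomog a b) + card {x \<in> J. \<beta> x = (a, b)}"
    if "minimal_bihomog_generators K G" "e \<le> a" for G a b
    using kS.basis_mod_card_eq[OF low_sub X[OF that(2)] minimal_generators_basis_mod[OF that(1)] Xf[OF that(2)]]
      Xc[OF that(2)] by simp
  ultimately show ?thesis unfolding high_generators_def using J fin by blast
qed

section \<open>Rank two modules and their free biduals\<close>

lemma coeff_hom_const: "coeff_hom (\<lambda>r :: 'a::comm_ring_1. [:r:])"
  by unfold_locales (simp_all add: one_pCons)

text \<open>The form \<open>\<Sum> c\<^sub>i z\<^sub>1\<^sup>i z\<^sub>2\<^sup>n\<^sup>-\<^sup>i\<close>, evaluated at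
  \<open>(u\<^sub>1, u\<^sub>2)\<close>. Throughout, forms in \<open>z\<^sub>1, z\<^sub>2\<close> are stored as polynomials
  \<open>\<Sum> c\<^sub>i Z\<^sup>i\<close> in one variable, which is why \<open>n\<close> has to be given.\<close>

definition hev :: "'a::comm_ring_1 \<Rightarrow> 'a \<Rightarrow> nat \<Rightarrow> 'a poly \<Rightarrow> 'a" where
  "hev u1 u2 n P = (\<Sum>i\<le>n. coeff P i * u1 ^ i * u2 ^ (n - i))"

lemma hev_add: "hev u1 u2 n (P + Q) = hev u1 u2 n P + hev u1 u2 n Q"
  by (simp add: hev_def distrib_right sum.distrib)

lemma hev_smult: "hev u1 u2 n (smult c P) = c * hev u1 u2 n P"
  unfolding hev_def coeff_smult sum_distrib_left by (simp only: mult.assoc)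

lemma hev_0 [simp]: "hev u1 u2 n 0 = 0"
  by (simp add: hev_def)

lemma hev_monom: "i \<le> n \<Longrightarrow> hev u1 u2 n (monom c i) = c * u1 ^ i * u2 ^ (n - i)"
  unfolding hev_def by (subst sum.remove[of _ i]) (auto intro!: sum.neutral)

lemma hev_const: "hev u1 u2 n [:c:] = c * u2 ^ n"
  using hev_monom[of 0 n u1 u2 c] by (simp add: monom_0)

lemma degree_bounded_induct:
  assumes "degree P \<le> n" "\<And>i. i \<le> n \<Longrightarrow> Q (monom (coeff P i) i)" "\<And>p q. Q p \<Longrightarrow> Q q \<Longrightarrow> Q (p + q)"
  shows "Q P"
proof -
  have "Q (\<Sum>i\<le>k. monom (coeff P i) i)" if "k \<le> n" for k
    using that by (induction k) (auto intro: assms(2,3))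
  from this[of n] show ?thesis using poly_as_sum_of_monoms'[OF assms(1)] by simp
qed

lemma hev_mult:
  assumes "degree P \<le> m" "degree Q \<le> n"
  shows "hev u1 u2 (m + n) (P * Q) = hev u1 u2 m P * hev u1 u2 n Q"
  using assms(1)
proof (rule degree_bounded_induct)
  fix i assume i: "i \<le> m"
  show "hev u1 u2 (m + n) (monom (coeff P i) i * Q) = hev u1 u2 m (monom (coeff P i) i) * hev u1 u2 n Q"
    using assms(2)
  proof (rule degree_bounded_induct)
    fix j assume j: "j \<le> n"
    have e: "m + n - (i + j) = (m - i) + (n - j)" using i j by simp
    have "hev u1 u2 (m + n) (monom (coeff P i) i * monom (coeff Q j) j) =
        coeff P i * coeff Q j * u1 ^ (i + j) * u2 ^ (m + n - (i + j))"
      unfolding mult_monom by (rule hev_monom) (use i j in simp)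
    also have "\<dots> = coeff P i * coeff Q j * (u1 ^ i * u1 ^ j) * (u2 ^ (m - i) * u2 ^ (n - j))"
      by (simp only: e power_add)
    also have "\<dots> = (coeff P i * u1 ^ i * u2 ^ (m - i)) * (coeff Q j * u1 ^ j * u2 ^ (n - j))"
      by (simp only: mult_ac)
    finally show "hev u1 u2 (m + n) (monom (coeff P i) i * monom (coeff Q j) j) =
        hev u1 u2 m (monom (coeff P i) i) * hev u1 u2 n (monom (coeff Q j) j)"
      using i j by (simp only: hev_monom)
  qed (simp add: distrib_left hev_add)
qed (simp add: distrib_right hev_add)

lemma bihomog_split:
  assumes "h \<in> bihomog a b" "a \<noteq> 0"
  shows "\<exists>s t. s \<in> bihomog (a - 1) b \<and> t \<in> bihomog (a - 1) b \<and> h = tconst x0 * s + tconst x1 * t"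
proof -
  have "\<forall>\<mu>\<in>ks h. \<exists>p q. p \<in> homog (a - 1) \<and> q \<in> homog (a - 1) \<and> lk h \<mu> = x0 * p + x1 * q"
    using homog_split assms unfolding bihomog_def by blast
  then obtain p q where pq: "\<And>\<mu>. \<mu> \<in> ks h \<Longrightarrow> p \<mu> \<in> homog (a - 1) \<and> q \<mu> \<in> homog (a - 1) \<and>
     lk h \<mu> = x0 * p \<mu> + x1 * q \<mu>" by metis
  define s where "s = (\<Sum>\<mu>\<in>ks h. sg \<mu> (p \<mu>))"
  define t where "t = (\<Sum>\<mu>\<in>ks h. sg \<mu> (q \<mu>))"
  have "s \<in> bihomog (a - 1) b" "t \<in> bihomog (a - 1) b"
    unfolding s_def t_def using pq assms(1) unfolding bihomog_def[of a b]
    by (auto intro!: bihomog_sum bihomog_single simp: tdeg_def)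
  moreover have "h = (\<Sum>\<mu>\<in>ks h. sg \<mu> (lk h \<mu>))" by (rule tpoly_sum_single)
  moreover have "\<dots> = (\<Sum>\<mu>\<in>ks h. tconst x0 * sg \<mu> (p \<mu>) + tconst x1 * sg \<mu> (q \<mu>))"
    using pq by (intro sum.cong) (auto simp: tconst_times_single simp flip: single_add)
  moreover have "\<dots> = tconst x0 * s + tconst x1 * t"
    unfolding s_def t_def sum.distrib sum_distrib_left ..
  ultimately have "s \<in> bihomog (a - 1) b \<and> t \<in> bihomog (a - 1) b \<and> h = tconst x0 * s + tconst x1 * t"
    by simp
  thus ?thesis by blast
qed

text \<open>The rows \<open>(\<Psi>1 v, \<Psi>2 v)\<close> are the images in \<open>F = R(\<sigma>1) \<oplus> R(\<sigma>2)\<close>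
  of the generators of the cokernel \<open>E\<close> of the first \<open>m\<close> columns. The assumptions \<open>psi_phi\<close>
  and \<open>psi_kernel\<close> say that \<open>E\<close> is well defined as a submodule of \<open>F\<close>, and
  \<open>psi_surj\<close> that it contains all elements of degree at least \<open>d m - 1\<close>. The pair \<open>(u1, u2)\<close>
  is the linear form on \<open>F\<close> that restricts to the map onto \<open>I\<close>.\<close>

locale rank_two =
  fixes f :: "'v::finite \<Rightarrow> 'k::field bipoly" and \<phi> :: "'v \<Rightarrow> nat \<Rightarrow> 'k bipoly"
    and m :: nat and d :: "nat \<Rightarrow> nat" and \<delta> :: int
    and \<Psi>1 \<Psi>2 :: "'v \<Rightarrow> 'k bipoly" and \<sigma>1 \<sigma>2 :: int and u1 u2 :: "'k bipoly"
  assumes m_pos: "1 \<le> m"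
    and d_pos: "\<And>j. j \<in> {1..Suc m} \<Longrightarrow> 1 \<le> d j"
    and d_mono: "\<And>i j. i \<in> {1..Suc m} \<Longrightarrow> j \<in> {1..Suc m} \<Longrightarrow> i \<le> j \<Longrightarrow> d i \<le> d j"
    and f_homog: "\<And>v. f v \<in> homog \<delta>"
    and f_nonzero: "\<exists>v. f v \<noteq> 0"
    and phi_homog: "\<And>v j. j \<in> {1..Suc m} \<Longrightarrow> \<phi> v j \<in> homog (int (d j))"
    and phi_inj: "\<And>c j. (\<And>v. (\<Sum>j=1..Suc m. \<phi> v j * c j) = 0) \<Longrightarrow> j \<in> {1..Suc m} \<Longrightarrow> c j = 0"
    and syzygies: "{a. (\<Sum>v\<in>UNIV. a v * f v) = 0} = column_span \<phi> (Suc m)"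
    and psi1_homog: "\<And>v. \<Psi>1 v \<in> homog \<sigma>1" and psi2_homog: "\<And>v. \<Psi>2 v \<in> homog \<sigma>2"
    and psi_phi: "\<And>j. j \<in> {1..m} \<Longrightarrow> (\<Sum>v\<in>UNIV. \<Psi>1 v * \<phi> v j) = 0 \<and> (\<Sum>v\<in>UNIV. \<Psi>2 v * \<phi> v j) = 0"
    and psi_kernel: "\<And>r. (\<Sum>v\<in>UNIV. r v * \<Psi>1 v) = 0 \<Longrightarrow> (\<Sum>v\<in>UNIV. r v * \<Psi>2 v) = 0 \<Longrightarrow> r \<in> column_span \<phi> m"
    and psi_surj: "\<And>p w1 w2. p \<ge> int (d m) - 1 \<Longrightarrow> w1 \<in> homog (p + \<sigma>1) \<Longrightarrow> w2 \<in> homog (p + \<sigma>2) \<Longrightarrow>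
      \<exists>r. (\<forall>v. r v \<in> homog p) \<and> (\<Sum>v\<in>UNIV. r v * \<Psi>1 v) = w1 \<and> (\<Sum>v\<in>UNIV. r v * \<Psi>2 v) = w2"
    and f_psi: "\<And>v. f v = \<Psi>1 v * u1 + \<Psi>2 v * u2"
    and sigma: "\<sigma>2 \<ge> 0" "\<sigma>1 \<ge> \<sigma>2" "\<sigma>1 > 0"
begin

abbreviation "D \<equiv> int (d m)"
abbreviation "N \<equiv> int (d (Suc m))"

lemma D_pos: "D \<ge> 1" using d_pos[of m] m_pos by simp

text \<open>The pair \<open>(aa, bb)\<close> consists of the coordinates of the last column in \<open>F\<close>, and
  \<open>H\<close> is the corresponding linear form \<open>aa z\<^sub>1 + bb z\<^sub>2\<close>.\<close>

definition aa :: "'k bipoly" where "aa = (\<Sum>v\<in>UNIV. \<Psi>1 v * \<phi> v (Suc m))"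
definition bb :: "'k bipoly" where "bb = (\<Sum>v\<in>UNIV. \<Psi>2 v * \<phi> v (Suc m))"
definition H :: "'k bipoly poly" where "H = [:bb, aa:]"

lemma aa_homog: "aa \<in> homog (N + \<sigma>1)" and bb_homog: "bb \<in> homog (N + \<sigma>2)"
  unfolding aa_def bb_def
  by (auto intro!: homog_sum homog_mult'[OF psi1_homog] homog_mult'[OF psi2_homog] phi_homog)

lemma ab_nonzero: "aa \<noteq> 0 \<or> bb \<noteq> 0"
proof (rule ccontr)
  assume "\<not> (aa \<noteq> 0 \<or> bb \<noteq> 0)"
  hence "(\<lambda>v. \<phi> v (Suc m)) \<in> column_span \<phi> m"
    by (intro psi_kernel) (auto simp: aa_def bb_def mult.commute)
  then obtain c where c: "\<And>v. \<phi> v (Suc m) = (\<Sum>j=1..m. \<phi> v j * c j)"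
    unfolding column_span_def by (auto dest: fun_cong)
  have "(\<Sum>j=1..Suc m. \<phi> v j * (c(Suc m := -1)) j) = 0" for v
  proof -
    have "(\<Sum>j=1..m. \<phi> v j * (c(Suc m := -1)) j) = (\<Sum>j=1..m. \<phi> v j * c j)"
      by (intro sum.cong) auto
    thus ?thesis using c[of v] by simp
  qed
  hence "(c(Suc m := -1)) (Suc m) = 0" by (rule phi_inj) simp
  thus False by simp
qed

lemma H_nonzero: "H \<noteq> 0"
  using ab_nonzero unfolding H_def by auto

text \<open>The quotient \<open>F/E\<close> vanishes in high degrees, so powers of a linear form \<open>y\<close> annihilate each
  of its elements.\<close>

lemma power_multiple_in_image:
  assumes y: "y \<in> homog 1"
  shows "\<exists>L r. (\<Sum>v\<in>UNIV. r v * \<Psi>1 v) = y ^ L * c1 \<and> (\<Sum>v\<in>UNIV. r v * \<Psi>2 v) = y ^ L * c2"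
proof -
  have yp: "y ^ L \<in> homog (int L)" for L
    by (induction L) (auto intro!: homog_mult'[OF y])
  define P where "P c1 c2 \<longleftrightarrow> (\<exists>L r. (\<Sum>v\<in>UNIV. r v * \<Psi>1 v) = y ^ L * c1 \<and>
     (\<Sum>v\<in>UNIV. r v * \<Psi>2 v) = y ^ L * c2)" for c1 c2
  have add: "P (c1 + c1') (c2 + c2')" if "P c1 c2" "P c1' c2'" for c1 c2 c1' c2'
  proof -
    from that obtain L r L' r' where rr:
      "(\<Sum>v\<in>UNIV. r v * \<Psi>1 v) = y ^ L * c1" "(\<Sum>v\<in>UNIV. r v * \<Psi>2 v) = y ^ L * c2"
      "(\<Sum>v\<in>UNIV. r' v * \<Psi>1 v) = y ^ L' * c1'" "(\<Sum>v\<in>UNIV. r' v * \<Psi>2 v) = y ^ L' * c2'"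
      unfolding P_def by blast
    have *: "(\<Sum>v\<in>UNIV. (y ^ L' * r v + y ^ L * r' v) * \<Psi> v) =
        y ^ L' * (\<Sum>v\<in>UNIV. r v * \<Psi> v) + y ^ L * (\<Sum>v\<in>UNIV. r' v * \<Psi> v)" for \<Psi>
      unfolding distrib_right sum.distrib sum_distrib_left by (simp only: mult.assoc)
    have "(\<Sum>v\<in>UNIV. (y ^ L' * r v + y ^ L * r' v) * \<Psi>1 v) = y ^ (L + L') * (c1 + c1')"
      "(\<Sum>v\<in>UNIV. (y ^ L' * r v + y ^ L * r' v) * \<Psi>2 v) = y ^ (L + L') * (c2 + c2')"
      unfolding * rr power_add distrib_left by (simp_all only: mult_ac)
    thus ?thesis unfolding P_def
      by (intro exI[of _ "L + L'"] exI[of _ "\<lambda>v. y ^ L' * r v + y ^ L * r' v"] conjI)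
  qed
  have hom: "P c1 c2" if "c1 \<in> homog (p + \<sigma>1)" "c2 \<in> homog (p + \<sigma>2)" for c1 c2 p
  proof -
    define L where "L = nat (D - p)"
    have "y ^ L * c1 \<in> homog (int L + p + \<sigma>1)" "y ^ L * c2 \<in> homog (int L + p + \<sigma>2)"
      using that by (auto intro!: homog_mult'[OF yp])
    moreover have "int L + p \<ge> D - 1" unfolding L_def by simp
    ultimately obtain r where "(\<Sum>v\<in>UNIV. r v * \<Psi>1 v) = y ^ L * c1" "(\<Sum>v\<in>UNIV. r v * \<Psi>2 v) = y ^ L * c2"
      using psi_surj[of "int L + p" "y ^ L * c1" "y ^ L * c2"] by blast
    thus ?thesis unfolding P_def by blast
  qed
  have "P c1 0"
  proof (induction c1 rule: bipoly_homog_induct)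
    case (1 k p) thus ?case using hom[of p "k - \<sigma>1" 0] by simp
  next
    case (2 p q) thus ?case using add[of p 0 q 0] by simp
  qed
  moreover have "P 0 c2"
  proof (induction c2 rule: bipoly_homog_induct)
    case (1 k p) thus ?case using hom[of 0 "k - \<sigma>2" p] by simp
  next
    case (2 p q) thus ?case using add[of 0 p 0 q] by simp
  qed
  ultimately have "P c1 c2" using add[of c1 0 0 c2] by simp
  thus ?thesis unfolding P_def .
qed

lemma image_syzygy:
  assumes "(\<Sum>v\<in>UNIV. r v * f v) = 0"
  shows "\<exists>s. (\<Sum>v\<in>UNIV. r v * \<Psi>1 v) = s * aa \<and> (\<Sum>v\<in>UNIV. r v * \<Psi>2 v) = s * bb"
proof -
  have "r \<in> column_span \<phi> (Suc m)" using assms syzygies by blast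
  then obtain c where c: "\<And>v. r v = (\<Sum>j=1..Suc m. \<phi> v j * c j)"
    unfolding column_span_def by (auto dest: fun_cong)
  have *: "(\<Sum>v\<in>UNIV. r v * \<Psi> v) = c (Suc m) * (\<Sum>v\<in>UNIV. \<Psi> v * \<phi> v (Suc m))"
    if "\<And>j. j \<in> {1..m} \<Longrightarrow> (\<Sum>v\<in>UNIV. \<Psi> v * \<phi> v j) = 0" for \<Psi>
  proof -
    have "(\<Sum>v\<in>UNIV. r v * \<Psi> v) = (\<Sum>v\<in>UNIV. \<Sum>j=1..Suc m. c j * (\<Psi> v * \<phi> v j))"
      unfolding c sum_distrib_right by (simp only: mult_ac)
    also have "\<dots> = (\<Sum>j=1..Suc m. c j * (\<Sum>v\<in>UNIV. \<Psi> v * \<phi> v j))"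
      by (subst sum.swap) (simp only: sum_distrib_left)
    also have "\<dots> = c (Suc m) * (\<Sum>v\<in>UNIV. \<Psi> v * \<phi> v (Suc m))" using that by simp
    finally show ?thesis .
  qed
  show ?thesis using *[of \<Psi>1] *[of \<Psi>2] psi_phi unfolding aa_def bb_def by blast
qed

text \<open>An element \<open>c\<close> of the kernel of \<open>(u1, u2)\<close> is moved into \<open>E\<close> by powers of
  \<open>x\<^sub>0\<close> and of \<open>x\<^sub>1\<close>. There it is a syzygy of \<open>f\<close> modulo the first
  \<open>m\<close> columns, so a multiple of the last column. As \<open>x\<^sub>0, x\<^sub>1\<close> is a regular sequence, the two
  multiples can be divided by the powers.\<close>

lemma koszul_syzygy:
  assumes c: "c1 * u1 + c2 * u2 = 0"
  shows "\<exists>s. c1 = s * aa \<and> c2 = s * bb"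
proof -
  have *: "\<exists>L s. y ^ L * c1 = s * aa \<and> y ^ L * c2 = s * bb" if y: "y \<in> homog 1" for y
  proof -
    obtain L r where r: "(\<Sum>v\<in>UNIV. r v * \<Psi>1 v) = y ^ L * c1" "(\<Sum>v\<in>UNIV. r v * \<Psi>2 v) = y ^ L * c2"
      using power_multiple_in_image[OF y] by blast
    have "(\<Sum>v\<in>UNIV. r v * f v) = (\<Sum>v\<in>UNIV. r v * \<Psi>1 v) * u1 + (\<Sum>v\<in>UNIV. r v * \<Psi>2 v) * u2"
      unfolding f_psi distrib_left sum.distrib sum_distrib_right by (simp only: mult.assoc)
    also have "\<dots> = y ^ L * (c1 * u1 + c2 * u2)" unfolding r distrib_left by (simp only: mult.assoc)
    finally have "(\<Sum>v\<in>UNIV. r v * f v) = 0" using c by simp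
    thus ?thesis using image_syzygy r by metis
  qed
  obtain L s0 where 0: "x0 ^ L * c1 = s0 * aa" "x0 ^ L * c2 = s0 * bb" using *[of x0] by auto
  obtain M s1 where 1: "x1 ^ M * c1 = s1 * aa" "x1 ^ M * c2 = s1 * bb" using *[of x1] by auto
  have "x1 ^ M * s0 * aa = x0 ^ L * s1 * aa" "x1 ^ M * s0 * bb = x0 ^ L * s1 * bb"
  proof -
    have "x1 ^ M * (x0 ^ L * c1) = x0 ^ L * (x1 ^ M * c1)" "x1 ^ M * (x0 ^ L * c2) = x0 ^ L * (x1 ^ M * c2)"
      by (simp_all only: mult_ac)
    thus "x1 ^ M * s0 * aa = x0 ^ L * s1 * aa" "x1 ^ M * s0 * bb = x0 ^ L * s1 * bb"
      unfolding 0 1 by (simp_all only: mult.assoc)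
  qed
  hence "x1 ^ M * s0 = x0 ^ L * s1" using ab_nonzero by auto
  hence "x0 ^ L dvd x1 ^ M * s0" by simp
  hence "x0 ^ L dvd s0" by (rule x0_power_dvd)
  then obtain s where s: "s0 = x0 ^ L * s" by blast
  have "x0 ^ L * c1 = x0 ^ L * (s * aa)" "x0 ^ L * c2 = x0 ^ L * (s * bb)"
    unfolding 0 s by (simp_all only: mult.assoc)
  hence "c1 = s * aa \<and> c2 = s * bb" by simp
  thus ?thesis ..
qed

text \<open>The pair \<open>(u2, -u1)\<close> is itself a syzygy of \<open>(u1, u2)\<close>.\<close>

lemma u_multiple: "\<exists>r. r \<noteq> 0 \<and> u1 = - r * bb \<and> u2 = r * aa"
proof -
  obtain r where r: "u2 = r * aa" "- u1 = r * bb"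
    using koszul_syzygy[of u2 "- u1"] by (auto simp: algebra_simps)
  have "r \<noteq> 0"
  proof
    assume "r = 0"
    hence "f v = 0" for v using r by (simp add: f_psi)
    thus False using f_nonzero by blast
  qed
  moreover have "u1 = - r * bb" using r(2) by (metis minus_mult_left minus_minus)
  ultimately show ?thesis using r(1) by blast
qed

lemma b_dvd_cancel: "bb dvd c * aa ^ n \<Longrightarrow> bb dvd c"
proof (induction n)
  case (Suc n)
  obtain r where r: "u1 = - r * bb" "u2 = r * aa" using u_multiple by blast
  have "bb dvd c * aa ^ n * aa" using Suc.prems by (simp only: power_Suc2 mult.assoc)
  then obtain x where "c * aa ^ n * aa = bb * x" by (rule dvdE)
  moreover have "c * aa ^ n * u2 = r * (c * aa ^ n * aa)" unfolding r by (simp only: mult_ac)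
  moreover have "x * u1 = - (r * (bb * x))"
    unfolding r mult_minus_left mult_minus_right by (simp only: mult_ac)
  ultimately have "x * u1 + c * aa ^ n * u2 = 0" by simp
  then obtain s where "c * aa ^ n = s * bb" using koszul_syzygy by blast
  thus ?case using Suc.IH by simp
qed simp

lemma hev_pCons: "hev v1 v2 (Suc n) (pCons c P) = c * v2 ^ Suc n + v1 * hev v1 v2 n P"
proof -
  have "hev v1 v2 (Suc n) (pCons c P) = c * v2 ^ Suc n + (\<Sum>i\<le>n. coeff P i * v1 ^ Suc i * v2 ^ (n - i))"
    unfolding hev_def by (subst sum.atMost_Suc_shift) simp
  also have "(\<Sum>i\<le>n. coeff P i * v1 ^ Suc i * v2 ^ (n - i)) = v1 * hev v1 v2 n P"
    unfolding hev_def sum_distrib_left power_Suc by (simp only: mult_ac)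
  finally show ?thesis .
qed

text \<open>The kernel of the map \<open>R[z\<^sub>1, z\<^sub>2] \<rightarrow> R[t]\<close> with \<open>z\<^sub>1 \<mapsto> -bb
  t\<close> and \<open>z\<^sub>2 \<mapsto> aa t\<close> is generated by \<open>H\<close>. If a form is in the kernel, its
  coefficient of \<open>z\<^sub>2\<^sup>n\<close> is divisible by \<open>bb\<close>; subtracting a multiple of \<open>H\<close>
  removes this coefficient, and \<open>z\<^sub>1\<close> can be split off.\<close>

lemma divides_if_vanishing:
  assumes "degree P \<le> n" "hev (- bb) aa n P = 0"
  shows "\<exists>Q. P = H * Q \<and> degree Q \<le> n - 1 \<and> (n = 0 \<longrightarrow> Q = 0)"
  using assms
proof (induction n arbitrary: P)
  case 0
  then obtain c where "P = [:c:]" by (metis degree_eq_zeroE le_zero_eq)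
  moreover from this have "c = 0" using 0(2) by (simp add: hev_def)
  ultimately have "P = 0" by simp
  thus ?case by (intro exI[of _ 0]) simp
next
  case (Suc n)
  obtain c P0 where P: "P = pCons c P0" by (cases P)
  have dP0: "degree P0 \<le> n" using Suc.prems(1) P by (cases "P0 = 0") auto
  have h: "c * aa ^ Suc n = bb * hev (- bb) aa n P0" using Suc.prems(2) unfolding P hev_pCons by simp
  have "bb dvd c * aa ^ Suc n" unfolding h by simp
  hence "bb dvd c" by (rule b_dvd_cancel)
  then obtain s where s: "c = bb * s" by blast
  show ?case
  proof (cases "bb = 0")
    case True
    obtain r where "u1 = 0" using u_multiple True by auto
    hence "1 * u1 + 0 * u2 = 0" by simp
    then obtain t where t: "1 = t * aa" using koszul_syzygy by blast
    have c: "c = 0" using s True by simp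
    have "P = H * smult t P0" using t unfolding P H_def True c by (simp add: mult.commute)
    thus ?thesis using dP0 by (intro exI[of _ "smult t P0"]) simp
  next
    case False
    define P1 where "P1 = P0 - [:s * aa:]"
    have P1: "P = smult s H + pCons 0 P1" unfolding P P1_def H_def s by (simp add: mult.commute)
    have "hev (- bb) aa (Suc n) (smult s H) = 0"
      unfolding hev_smult H_def hev_pCons hev_const by simp
    hence "hev (- bb) aa (Suc n) (pCons 0 P1) = 0" using Suc.prems(2) unfolding P1 hev_add by simp
    hence "hev (- bb) aa n P1 = 0" unfolding hev_pCons using False by simp
    moreover have "degree P1 \<le> n" unfolding P1_def using dP0 by (simp add: degree_diff_le)
    ultimately obtain Q where Q: "P1 = H * Q" "degree Q \<le> n - 1" "n = 0 \<longrightarrow> Q = 0" using Suc.IH by blast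
    have "P = H * pCons s Q" unfolding P1 Q(1) by (simp add: mult_pCons_right)
    moreover have "degree (pCons s Q) \<le> n" using Q(2,3) by (cases "Q = 0") auto
    ultimately show ?thesis by (intro exI[of _ "pCons s Q"]) simp
  qed
qed

text \<open>The component of bidegree \<open>(p, q)\<close> of \<open>R[z\<^sub>1, z\<^sub>2]\<close>, where
  \<open>z\<^sub>k\<close> has bidegree \<open>(-\<sigma>k, 1)\<close>.\<close>

definition C :: "int \<Rightarrow> nat \<Rightarrow> 'k bipoly poly set" where
  "C p q = {P. degree P \<le> q \<and> (\<forall>i\<le>q. coeff P i \<in> homog (p + int i * \<sigma>1 + (int q - int i) * \<sigma>2))}"

lemma C_0 [simp]: "0 \<in> C p q" by (simp add: C_def)

lemma C_add: "P \<in> C p q \<Longrightarrow> Q \<in> C p q \<Longrightarrow> P + Q \<in> C p q"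
  unfolding C_def by (auto intro: homog_add degree_add_le)

lemma C_sum: "(\<And>i. i \<in> A \<Longrightarrow> g i \<in> C p q) \<Longrightarrow> sum g A \<in> C p q"
  by (induction A rule: infinite_finite_induct) (auto intro: C_add)

lemma C_monom: "c \<in> homog (p + int i * \<sigma>1 + (int q - int i) * \<sigma>2) \<Longrightarrow> i \<le> q \<Longrightarrow> monom c i \<in> C p q"
  unfolding C_def by (auto intro: order.trans[OF degree_monom_le])

lemma C_const: "c \<in> homog p \<Longrightarrow> [:c:] \<in> C p 0"
  using C_monom[of c p 0 0] by (simp add: monom_0)

lemma C_induct:
  assumes "P \<in> C p q"
    and "\<And>i c. i \<le> q \<Longrightarrow> c \<in> homog (p + int i * \<sigma>1 + (int q - int i) * \<sigma>2) \<Longrightarrow> Q (monom c i)"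
    and "\<And>P P'. Q P \<Longrightarrow> Q P' \<Longrightarrow> Q (P + P')"
  shows "Q P"
  using assms unfolding C_def by (auto intro: degree_bounded_induct)

lemma C_mult:
  assumes "P \<in> C p q" "P' \<in> C p' q'"
  shows "P * P' \<in> C (p + p') (q + q')"
  using assms(1)
proof (rule C_induct)
  fix i and c :: "'k bipoly" assume i: "i \<le> q" "c \<in> homog (p + int i * \<sigma>1 + (int q - int i) * \<sigma>2)"
  show "monom c i * P' \<in> C (p + p') (q + q')" using assms(2)
  proof (rule C_induct)
    fix j and e :: "'k bipoly" assume j: "j \<le> q'" "e \<in> homog (p' + int j * \<sigma>1 + (int q' - int j) * \<sigma>2)"
    have "c * e \<in> homog (p + p' + int (i + j) * \<sigma>1 + (int (q + q') - int (i + j)) * \<sigma>2)"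
      using i j by (auto intro!: homog_mult'[of c _ e] simp: algebra_simps)
    thus "monom c i * monom e j \<in> C (p + p') (q + q')" using i j by (simp add: mult_monom C_monom)
  qed (simp add: distrib_left C_add)
qed (simp add: distrib_right C_add)

lemma C_mult': "P \<in> C p q \<Longrightarrow> P' \<in> C p' q' \<Longrightarrow> a = p + p' \<Longrightarrow> b = q + q' \<Longrightarrow> P * P' \<in> C a b"
  using C_mult by blast

lemma C_smult: "P \<in> C p q \<Longrightarrow> c \<in> homog k \<Longrightarrow> smult c P \<in> C (p + k) q"
  using C_mult[OF C_const, of c k P p q] by (simp add: add.commute)

definition ET :: "'v \<Rightarrow> 'k bipoly poly" where "ET v = [:\<Psi>2 v, \<Psi>1 v:]"

lemma ET_C: "ET v \<in> C 0 1"
proof -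
  have "ET v = monom (\<Psi>2 v) 0 + monom (\<Psi>1 v) 1" by (simp add: ET_def monom_0 monom_Suc)
  thus ?thesis using psi1_homog psi2_homog by (auto intro!: C_add C_monom)
qed

lemma H_C: "H \<in> C N 1"
proof -
  have "H = monom bb 0 + monom aa 1" by (simp add: H_def monom_0 monom_Suc)
  thus ?thesis using aa_homog bb_homog by (auto intro!: C_add C_monom)
qed

text \<open>The part of \<open>C p (q + 1)\<close> that is obtained from \<open>C p q\<close> by multiplication with the images of
  the \<open>T\<^sub>v\<close>.\<close>

definition EC :: "int \<Rightarrow> nat \<Rightarrow> 'k bipoly poly set" where
  "EC p q = {\<Sum>v\<in>UNIV. ET v * Q v | Q. \<forall>v. Q v \<in> C p q}"

lemma EC_add: "P \<in> EC p q \<Longrightarrow> P' \<in> EC p q \<Longrightarrow> P + P' \<in> EC p q"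
proof -
  assume "P \<in> EC p q" "P' \<in> EC p q"
  then obtain Q Q' where "P = (\<Sum>v\<in>UNIV. ET v * Q v)" "P' = (\<Sum>v\<in>UNIV. ET v * Q' v)"
    "\<forall>v. Q v \<in> C p q" "\<forall>v. Q' v \<in> C p q" unfolding EC_def by auto
  thus ?thesis unfolding EC_def
    by (intro CollectI exI[of _ "\<lambda>v. Q v + Q' v"]) (auto simp: distrib_left sum.distrib C_add)
qed

lemma EC_single: "Q \<in> C p q \<Longrightarrow> ET v * Q \<in> EC p q"
proof -
  assume Q: "Q \<in> C p q"
  have "ET v * Q = (\<Sum>w\<in>UNIV. ET w * (if w = v then Q else 0))"
    by (simp add: if_distrib[of "\<lambda>x. _ * x"] cong: if_cong)
  thus ?thesis unfolding EC_def using Q by (intro CollectI exI[of _ "\<lambda>w. if w = v then Q else 0"]) auto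
qed

lemma C_1_expansion:
  assumes p: "p \<ge> D - 1" and P: "P \<in> C p 1"
  shows "\<exists>r. (\<forall>v. r v \<in> homog p) \<and> P = (\<Sum>v\<in>UNIV. smult (r v) (ET v))"
proof -
  have c: "coeff P 1 \<in> homog (p + \<sigma>1)" "coeff P 0 \<in> homog (p + \<sigma>2)"
    using P unfolding C_def by (auto dest: spec[of _ "0::nat"] spec[of _ "1::nat"])
  then obtain r where r: "\<forall>v. r v \<in> homog p" "(\<Sum>v\<in>UNIV. r v * \<Psi>1 v) = coeff P 1"
      "(\<Sum>v\<in>UNIV. r v * \<Psi>2 v) = coeff P 0"
    using psi_surj[OF p c] by blast
  have dP: "degree P \<le> 1" using P unfolding C_def by simp
  have "P = (\<Sum>v\<in>UNIV. smult (r v) (ET v))"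
  proof (rule poly_eqI)
    fix i :: nat
    consider "i = 0" | "i = 1" | "i \<ge> 2" by linarith
    thus "coeff P i = coeff (\<Sum>v\<in>UNIV. smult (r v) (ET v)) i"
    proof cases
      case 3
      hence "i = Suc (Suc (i - 2))" by simp
      then obtain i' where "i = Suc (Suc i')" by blast
      thus ?thesis using 3 dP by (simp add: coeff_sum ET_def coeff_eq_0)
    qed (use r in \<open>simp_all add: coeff_sum ET_def\<close>)
  qed
  thus ?thesis using r(1) by blast
qed

text \<open>The coefficient \<open>c\<close> of the monomial is split into factors of degrees \<open>k\<close> and
  \<open>l\<close> in such a way that the second factor, together with \<open>z\<^sub>1\<close> (for \<open>e = 1\<close>) or
  \<open>z\<^sub>2\<close> (for \<open>e = 0\<close>), is an element of \<open>F\<close> of degree \<open>t\<close>. Since \<open>t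
  \<ge> D - 1\<close>, this element is a combination of images of the \<open>T\<^sub>v\<close> with coefficients of degree
  \<open>t\<close>.\<close>

lemma monom_factor_EC:
  assumes c: "c \<in> homog h" "h = int k + l" and l: "l \<ge> 0" and t: "t \<ge> D - 1"
    and e: "e \<le> 1" "l = t + int e * \<sigma>1 + (1 - int e) * \<sigma>2"
    and j: "j \<le> q" "int k + t = p + int j * \<sigma>1 + (int q - int j) * \<sigma>2"
  shows "monom c (j + e) \<in> EC p q"
  using c(1)[unfolded c(2)]
proof (rule homog_product_induct)
  fix x y :: "'k bipoly" assume x: "x \<in> homog (int k)" and y: "y \<in> homog l"
  have "monom y e \<in> C t 1" using e y by (intro C_monom) auto
  then obtain r where r: "\<forall>v. r v \<in> homog t" "monom y e = (\<Sum>v\<in>UNIV. smult (r v) (ET v))"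
    using C_1_expansion[OF t] by blast
  have "monom (x * y) (j + e) = monom x j * monom y e" by (simp add: mult_monom)
  also have "\<dots> = (\<Sum>v\<in>UNIV. ET v * monom (r v * x) j)"
  proof -
    have "monom x j * smult (r v) (ET v) = ET v * monom (r v * x) j" for v
      unfolding smult_monom[symmetric] mult_smult_right by (simp only: mult.commute)
    thus ?thesis unfolding r(2) sum_distrib_left by simp
  qed
  also have "\<dots> \<in> EC p q"
  proof -
    have "monom (r v * x) j \<in> C p q" for v
      using r(1) x j by (intro C_monom homog_mult'[of "r v" t]) auto
    thus ?thesis unfolding EC_def by (intro CollectI exI[of _ "\<lambda>v. monom (r v * x) j"]) simp
  qed
  finally show "monom (x * y) (j + e) \<in> EC p q" .
next
  fix x y :: "'k bipoly" assume "monom x (j + e) \<in> EC p q" "monom y (j + e) \<in> EC p q"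
  thus "monom (x + y) (j + e) \<in> EC p q" using EC_add by (simp flip: add_monom)
qed (rule l)

lemma C_subset_EC:
  assumes p: "p \<ge> D - 1" and P: "P \<in> C p (Suc q)"
  shows "P \<in> EC p q"
  using P
proof (rule C_induct)
  fix i and c :: "'k bipoly" assume i: "i \<le> Suc q" and c: "c \<in> homog (p + int i * \<sigma>1 + (int (Suc q) - int i) * \<sigma>2)"
  have p0: "p \<ge> 0" using p D_pos by simp
  show "monom c i \<in> EC p q"
  proof (cases i)
    case 0
    define k where "k = nat (int q * \<sigma>2)"
    have k: "int k = int q * \<sigma>2" unfolding k_def using sigma by simp
    have "monom c (0 + 0) \<in> EC p q"
      by (rule monom_factor_EC[OF c, of k "p + \<sigma>2" p])
         (use c 0 k p p0 sigma in \<open>auto simp: algebra_simps\<close>)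
    thus ?thesis using 0 by simp
  next
    case (Suc j)
    define k where "k = nat (int j * \<sigma>1 + (int q - int j) * \<sigma>2)"
    have "int j * \<sigma>1 \<ge> 0" "(int q - int j) * \<sigma>2 \<ge> 0" using sigma i Suc by auto
    hence k: "int k = int j * \<sigma>1 + (int q - int j) * \<sigma>2" unfolding k_def by simp
    have "monom c (j + 1) \<in> EC p q"
      by (rule monom_factor_EC[OF c, of k "p + \<sigma>1" p])
         (use c i Suc k p p0 sigma in \<open>auto simp: algebra_simps\<close>)
    thus ?thesis using Suc by simp
  qed
qed (rule EC_add)

text \<open>Otherwise all elements of \<open>E\<close> would be multiples of \<open>z\<^sub>1\<close>, but in high degrees
  \<open>E\<close> contains multiples of \<open>z\<^sub>2\<close>.\<close>

lemma psi2_unit: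
  assumes "\<sigma>2 = 0"
  shows "\<exists>v l. l \<noteq> 0 \<and> \<Psi>2 v = kc l"
proof (rule ccontr)
  assume no: "\<nexists>v l. l \<noteq> 0 \<and> \<Psi>2 v = kc l"
  have z: "\<Psi>2 v = 0" for v
  proof -
    have "\<Psi>2 v = kc (cf (\<Psi>2 v) 0 0)" using psi2_homog[of v] assms by (intro homog_zero_const) simp
    thus ?thesis using no kc_simps(1) by metis
  qed
  have "x0 ^ L \<in> homog (int L)" for L :: nat
    by (induction L) (auto intro!: homog_mult'[OF homog_x0])
  from this[of "nat (D - 1)"] obtain r where "(\<Sum>v\<in>UNIV. r v * \<Psi>2 v) = x0 ^ nat (D - 1)"
    using psi_surj[of "D - 1" 0 "x0 ^ nat (D - 1)"] assms D_pos by auto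
  thus False using z by simp
qed

text \<open>In degree \<open>D - 2\<close> the module \<open>F\<close> need not be contained in \<open>E\<close>, yet products of
  two or more elements can still be factored: a factor \<open>z\<^sub>k\<close> with \<open>\<sigma>k > 0\<close> may be set aside,
  which raises the degree of the remaining linear factor to at least \<open>D - 1\<close>. The only monomials without such a factor
  are the powers of \<open>z\<^sub>2\<close> for \<open>\<sigma>2 = 0\<close>, and modulo multiples of \<open>z\<^sub>1\<close> the
  form \<open>z\<^sub>2\<close> is then the image of a scalar multiple of some \<open>T\<^sub>v\<close>.\<close>

lemma C_subset_EC_top:
  assumes P: "P \<in> C (D - 2) (Suc (Suc q))"
  shows "P \<in> EC (D - 2) (Suc q)"
proof -
  have pos: "monom c (Suc j) \<in> EC (D - 2) (Suc q)"
    if j: "j \<le> Suc q" and c: "c \<in> homog (D - 2 + int (Suc j) * \<sigma>1 + (int (Suc (Suc q)) - int (Suc j)) * \<sigma>2)" for c j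
  proof (cases j)
    case 0
    define k where "k = nat (int q * \<sigma>2)"
    have k: "int k = int q * \<sigma>2" unfolding k_def using sigma by simp
    have "monom c (1 + 0) \<in> EC (D - 2) (Suc q)"
      by (rule monom_factor_EC[OF c, of k "D - 2 + \<sigma>1 + \<sigma>2" "D - 2 + \<sigma>1"])
         (use c 0 k D_pos sigma in \<open>auto simp: algebra_simps\<close>)
    thus ?thesis using 0 by simp
  next
    case (Suc i)
    define k where "k = nat (int i * \<sigma>1 + (int q - int i) * \<sigma>2)"
    have "int i * \<sigma>1 \<ge> 0" "(int q - int i) * \<sigma>2 \<ge> 0" using sigma j Suc by auto
    hence k: "int k = int i * \<sigma>1 + (int q - int i) * \<sigma>2" unfolding k_def by simp
    have "monom c (Suc i + 1) \<in> EC (D - 2) (Suc q)"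
      by (rule monom_factor_EC[OF c, of k "D - 2 + \<sigma>1 + \<sigma>1" "D - 2 + \<sigma>1"])
         (use c j Suc k D_pos sigma in \<open>auto simp: algebra_simps\<close>)
    thus ?thesis using Suc by simp
  qed
  show ?thesis using P
  proof (rule C_induct)
    fix i and c :: "'k bipoly" assume i: "i \<le> Suc (Suc q)"
      and c: "c \<in> homog (D - 2 + int i * \<sigma>1 + (int (Suc (Suc q)) - int i) * \<sigma>2)"
    show "monom c i \<in> EC (D - 2) (Suc q)"
    proof (cases i)
      case (Suc j)
      thus ?thesis using pos[of j c] i c by simp
    next
      case 0
      show ?thesis
      proof (cases "\<sigma>2 = 0")
        case False
        define k where "k = nat (int q * \<sigma>2)"
        have k: "int k = int q * \<sigma>2" unfolding k_def using sigma by simp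
        have "monom c (0 + 0) \<in> EC (D - 2) (Suc q)"
          by (rule monom_factor_EC[OF c, of k "D - 2 + \<sigma>2 + \<sigma>2" "D - 2 + \<sigma>2"])
             (use c 0 k D_pos sigma False in \<open>auto simp: algebra_simps\<close>)
        thus ?thesis using 0 by simp
      next
        case True
        obtain v l where v: "l \<noteq> 0" "\<Psi>2 v = kc l" using psi2_unit[OF True] by blast
        define e where "e = kc (inverse l) * c"
        have ce: "c = kc l * e" using v(1) by (simp add: e_def mult.assoc[symmetric] flip: kc_simps(4))
        have e: "e \<in> homog (D - 2)" unfolding e_def using c 0 True by (intro homog_kc_mult) simp
        have "monom c 0 = ET v * monom e 0 + monom (- (e * \<Psi>1 v)) (Suc 0)"
          by (simp add: ET_def v(2) ce monom_0 monom_Suc mult.commute)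
        moreover have "ET v * monom e 0 \<in> EC (D - 2) (Suc q)"
          using e True by (intro EC_single C_monom) auto
        moreover have "monom (- (e * \<Psi>1 v)) (Suc 0) \<in> EC (D - 2) (Suc q)"
          by (intro pos homog_uminus homog_mult'[OF e psi1_homog]) (use True in auto)
        ultimately show ?thesis using 0 EC_add by simp
      qed
    qed
  qed (rule EC_add)
qed

end

context rank_two
begin

interpretation cc: coeff_hom "\<lambda>r :: 'k bipoly. [:r:]" by (rule coeff_hom_const)

text \<open>The map to the symmetric algebra of \<open>F\<close> and, below, the map to \<open>R[t]\<close> with \<open>T\<^sub>v
  \<mapsto> f\<^sub>v t\<close>, whose image is the Rees algebra of \<open>I\<close>.\<close>

definition A :: "('k, 'v) tpoly \<Rightarrow> 'k bipoly poly" where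
  "A = tp_eval (\<lambda>r. [:r:]) ET"

definition E :: "('k, 'v) tpoly \<Rightarrow> 'k bipoly poly" where
  "E = tp_eval (\<lambda>r. [:r:]) (\<lambda>v. [:0, f v:])"

definition K :: "('k, 'v) tpoly set" where "K = {h. E h = 0}"

lemma smult_sum_right: "smult c (sum g X) = (\<Sum>i\<in>X. smult c (g i))"
  by (induction X rule: infinite_finite_induct) (auto simp: smult_add_right)

lemma A_simps: "A (g + h) = A g + A h" "A (g - h) = A g - A h" "A (g * h) = A g * A h"
    "A (tconst r) = [:r:]" "A (tvar v) = ET v" "A (sum k X) = (\<Sum>i\<in>X. A (k i))" "A 0 = 0"
  unfolding A_def by (simp_all add: cc.eval_add cc.eval_diff cc.eval_mult cc.eval_sum tconst_def tvar_def cc.eval_single)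

lemma E_simps: "E (g + h) = E g + E h" "E (g * h) = E g * E h" "E (sum k X) = (\<Sum>i\<in>X. E (k i))"
    "E (tconst r) = [:r:]" "E (tvar v) = [:0, f v:]" "E 0 = 0"
  unfolding E_def by (simp_all add: cc.eval_add cc.eval_mult cc.eval_sum tconst_def tvar_def cc.eval_single)

lemma mon_eval_ET_C: "mon_eval ET \<mu> \<in> C 0 (tdeg \<mu>)"
proof (induction \<mu> rule: tpoly_single_induct)
  case (1 v n)
  have "ET v ^ n \<in> C 0 n"
  proof (induction n)
    case 0 show ?case using C_const[OF homog_1] by (simp add: one_pCons)
  next
    case (Suc n) thus ?case using C_mult'[OF ET_C] by simp
  qed
  thus ?case by simp
next
  case (2 \<mu> \<nu>)
  thus ?case unfolding mon_eval_add tdeg_add by (rule C_mult') simp_all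
qed

text \<open>The map to \<open>R[t]\<close> factors through the symmetric algebra of \<open>F\<close>, because \<open>f v\<close>
  is the value of the linear form \<open>(u1, u2)\<close> at the image of \<open>T\<^sub>v\<close>.\<close>

lemma hev_mon_eval: "hev u1 u2 (tdeg \<mu>) (mon_eval ET \<mu>) = mon_eval f \<mu>"
proof (induction \<mu> rule: tpoly_single_induct)
  case (1 v n)
  have dET: "degree (ET v) \<le> 1" using ET_C unfolding C_def by simp
  have "degree (ET v ^ n) \<le> n \<and> hev u1 u2 n (ET v ^ n) = f v ^ n"
  proof (induction n)
    case 0 show ?case by (simp add: hev_def)
  next
    case (Suc n)
    have "hev u1 u2 1 (ET v) = f v" by (simp add: hev_def ET_def f_psi add.commute)
    hence "hev u1 u2 (1 + n) (ET v * ET v ^ n) = f v * f v ^ n"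
      using hev_mult[OF dET, of "ET v ^ n" n u1 u2] Suc by simp
    moreover have "degree (ET v * ET v ^ n) \<le> 1 + n"
      using degree_mult_le[of "ET v" "ET v ^ n"] Suc dET by linarith
    ultimately show ?case by simp
  qed
  thus ?case by simp
next
  case (2 \<mu> \<nu>)
  have "degree (mon_eval ET \<mu>) \<le> tdeg \<mu>" for \<mu> using mon_eval_ET_C[of \<mu>] unfolding C_def by simp
  thus ?case using 2 by (simp add: mon_eval_add tdeg_add hev_mult)
qed

lemma mon_eval_f_homog: "mon_eval f \<mu> \<in> homog (int (tdeg \<mu>) * \<delta>)"
proof (induction \<mu> rule: tpoly_single_induct)
  case (1 v n)
  have "f v ^ n \<in> homog (int n * \<delta>)"
    by (induction n) (auto intro!: homog_mult'[OF f_homog] simp: algebra_simps)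
  thus ?case by simp
next
  case (2 \<mu> \<nu>) thus ?case unfolding mon_eval_add tdeg_add by (rule homog_mult') (simp add: algebra_simps)
qed

lemma A_bihomog:
  assumes h: "h \<in> bihomog a b"
  shows "A h \<in> C a b"
proof -
  have "A h = (\<Sum>\<mu>\<in>ks h. [:lk h \<mu>:] * mon_eval ET \<mu>)" unfolding A_def tp_eval_def ..
  also have "\<dots> \<in> C a b"
  proof (rule C_sum)
    fix \<mu> assume "\<mu> \<in> ks h"
    hence "lk h \<mu> \<in> homog a" "tdeg \<mu> = b" using h unfolding bihomog_def tdeg_def by auto
    thus "[:lk h \<mu>:] * mon_eval ET \<mu> \<in> C a b" using mon_eval_ET_C[of \<mu>] by (intro C_mult'[OF C_const]) auto
  qed
  finally show ?thesis .
qed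

lemma E_bihomog:
  assumes h: "h \<in> bihomog a b"
  shows "E h = monom (hev u1 u2 b (A h)) b" and "hev u1 u2 b (A h) \<in> homog (a + int b * \<delta>)"
proof -
  have \<mu>: "lk h \<mu> \<in> homog a" "tdeg \<mu> = b" if "\<mu> \<in> ks h" for \<mu>
    using h that unfolding bihomog_def tdeg_def by auto
  have hs: "hev u1 u2 b (sum P X) = (\<Sum>i\<in>X. hev u1 u2 b (P i))" for P and X :: "('v \<Rightarrow>\<^sub>0 nat) set"
    by (induction X rule: infinite_finite_induct) (auto simp: hev_add)
  have "hev u1 u2 b (A h) = (\<Sum>\<mu>\<in>ks h. hev u1 u2 b (smult (lk h \<mu>) (mon_eval ET \<mu>)))"
    unfolding A_def tp_eval_def hs by simp
  also have "\<dots> = (\<Sum>\<mu>\<in>ks h. lk h \<mu> * mon_eval f \<mu>)"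
  proof (rule sum.cong)
    fix \<mu> assume "\<mu> \<in> ks h"
    thus "hev u1 u2 b (smult (lk h \<mu>) (mon_eval ET \<mu>)) = lk h \<mu> * mon_eval f \<mu>"
      using hev_mon_eval[of \<mu>] \<mu>(2)[of \<mu>] by (simp add: hev_smult)
  qed simp
  finally have e: "hev u1 u2 b (A h) = (\<Sum>\<mu>\<in>ks h. lk h \<mu> * mon_eval f \<mu>)" .
  have "E h = (\<Sum>\<mu>\<in>ks h. monom (lk h \<mu> * mon_eval f \<mu>) b)"
    unfolding E_def tp_eval_def
    by (intro sum.cong) (auto simp: mon_eval_linear \<mu> smult_monom)
  also have "\<dots> = monom (hev u1 u2 b (A h)) b"
    unfolding e by (induction rule: infinite_finite_induct) (auto simp: add_monom[symmetric])
  finally show "E h = monom (hev u1 u2 b (A h)) b" .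
  show "hev u1 u2 b (A h) \<in> homog (a + int b * \<delta>)"
    unfolding e
  proof (rule homog_sum)
    fix \<mu> assume "\<mu> \<in> ks h"
    thus "lk h \<mu> * mon_eval f \<mu> \<in> homog (a + int b * \<delta>)"
      using mon_eval_f_homog[of \<mu>] \<mu>[of \<mu>] by (intro homog_mult) auto
  qed
qed

lemma K_iff: "h \<in> bihomog a b \<Longrightarrow> h \<in> K \<longleftrightarrow> hev u1 u2 b (A h) = 0"
  unfolding K_def using E_bihomog(1) by (simp add: monom_eq_0_iff)

lemma E_tcomp: "E (tcomp a b h) = monom (hcomp (a + int b * \<delta>) (coeff (E h) b)) b"
proof (induction h rule: tpoly_bihomog_induct)
  case (1 a' b' h)
  note E = E_bihomog[OF 1]
  show ?case
  proof (cases "(a', b') = (a, b)")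
    case True
    thus ?thesis using E 1 by (simp add: tcomp_id hcomp_id)
  next
    case False
    hence "b' \<noteq> b \<or> a' + int b' * \<delta> \<noteq> a + int b * \<delta>" by auto
    hence "hcomp (a + int b * \<delta>) (coeff (E h) b) = 0"
      using hcomp_other[OF E(2), of "a + int b * \<delta>"] unfolding E(1) by auto
    thus ?thesis using tcomp_other[OF 1 False] by (simp add: E_simps)
  qed
next
  case (2 g h)
  thus ?case by (simp add: tcomp_add E_simps hcomp_add add_monom)
qed

sublocale graded_ideal K
proof
  show "ideal.subspace K" unfolding K_def
    by (rule ideal.subspaceI) (auto simp: E_simps)
  show "tcomp a b h \<in> K" if "h \<in> K" for h a b
    using that unfolding K_def by (simp add: E_tcomp)
qed

lemma A_surj:
  assumes a: "a \<ge> D - 1"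
  shows "P \<in> C a b \<Longrightarrow> \<exists>h. h \<in> bihomog a b \<and> A h = P"
proof (induction b arbitrary: P)
  case 0
  hence "degree P = 0" "coeff P 0 \<in> homog a" unfolding C_def by auto
  moreover from this have "P = [:coeff P 0:]" by (metis degree_eq_zeroE coeff_pCons_0)
  ultimately have "tconst (coeff P 0) \<in> bihomog a 0 \<and> A (tconst (coeff P 0)) = P"
    by (simp add: bihomog_tconst A_simps)
  thus ?case ..
next
  case (Suc b)
  obtain Q where Q: "P = (\<Sum>v\<in>UNIV. ET v * Q v)" "\<And>v. Q v \<in> C a b"
    using C_subset_EC[OF a Suc.prems] unfolding EC_def by blast
  have "\<forall>v. \<exists>h. h \<in> bihomog a b \<and> A h = Q v" using Suc.IH Q(2) by blast
  then obtain h where h: "\<And>v. h v \<in> bihomog a b" "\<And>v. A (h v) = Q v" by metis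
  have "(\<Sum>v\<in>UNIV. tvar v * h v) \<in> bihomog a (Suc b)"
    using h(1) by (intro bihomog_sum bihomog_mult'[OF bihomog_tvar]) auto
  moreover have "A (\<Sum>v\<in>UNIV. tvar v * h v) = P" unfolding Q(1) by (simp add: A_simps h(2))
  ultimately show ?case by blast
qed

lemma A_zero_K: "h \<in> bihomog a b \<Longrightarrow> A h = 0 \<Longrightarrow> h \<in> comp a b"
  using K_iff unfolding comp_def by simp

text \<open>This is where the bound on the \<open>x\<close>-degree enters. Writing \<open>h = x\<^sub>1 s0 - x\<^sub>0 t\<close>,
  exactness of the Koszul complex gives \<open>W\<close> with \<open>A s0 = x\<^sub>0 W\<close> and \<open>A t = x\<^sub>1
  W\<close>. The element \<open>W\<close> has \<open>x\<close>-degree \<open>a - 2\<close>, possibly too small for a lift to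
  \<open>S\<close>, but it is a combination \<open>\<Sum> ET v * Q v\<close>, and the \<open>x\<^sub>0 Q v\<close> and
  \<open>x\<^sub>1 Q v\<close> do lift. Their Koszul combinations \<open>k v\<close> lie in the kernel, and subtracting the
  \<open>T\<^sub>v k v\<close> from \<open>h\<close> leaves an element of \<open>(x\<^sub>0, x\<^sub>1)\<close> times the
  kernel.\<close>

lemma kernel_low:
  assumes h: "h \<in> bihomog a (Suc (Suc b))" and A0: "A h = 0" and a: "a \<ge> D"
  shows "h \<in> low a (Suc (Suc b))"
proof -
  let ?b = "Suc (Suc b)"
  have "a \<noteq> 0" using a D_pos by simp
  then obtain s1 s0 where s: "s1 \<in> bihomog (a - 1) ?b" "s0 \<in> bihomog (a - 1) ?b"
    "h = tconst x0 * s1 + tconst x1 * s0" using bihomog_split[OF h] by blast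
  define t where "t = - s1"
  have t: "t \<in> bihomog (a - 1) ?b" unfolding t_def using s(1) by (rule bihomog_uminus)
  have ht: "h = tconst x1 * s0 - tconst x0 * t" unfolding s(3) t_def by simp
  have eq: "smult x1 (A s0) = smult x0 (A t)" using A0 unfolding ht by (simp add: A_simps)
  have s0C: "A s0 \<in> C (a - 1) ?b" and tC: "A t \<in> C (a - 1) ?b" using s(2) t by (auto intro: A_bihomog)
  have "\<exists>c. coeff (A s0) i = x0 * c \<and> coeff (A t) i = x1 * c" for i
    using arg_cong[OF eq, of "\<lambda>p. coeff p i"] by (intro koszul) simp
  then obtain c where c: "\<And>i. coeff (A s0) i = x0 * c i" "\<And>i. coeff (A t) i = x1 * c i" by metis
  define W where "W = (\<Sum>i\<le>?b. monom (c i) i)"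
  have cW: "coeff W i = (if i \<le> ?b then c i else 0)" for i
    unfolding W_def by (simp add: coeff_sum del: sum.atMost_Suc)
  have sW: "A s0 = smult x0 W" and tW: "A t = smult x1 W"
  proof -
    have "coeff (A s0) i = 0" "coeff (A t) i = 0" if "i > ?b" for i
      using s0C tC that unfolding C_def by (auto intro: coeff_eq_0)
    thus "A s0 = smult x0 W" "A t = smult x1 W" using c by (auto intro!: poly_eqI simp: cW)
  qed
  have W: "W \<in> C (a - 2) ?b"
    unfolding W_def
  proof (intro C_sum C_monom)
    fix i assume i: "i \<in> {..?b}"
    have "x0 * c i \<in> homog (a - 1 + int i * \<sigma>1 + (int ?b - int i) * \<sigma>2)"
      using s0C i unfolding C_def by (simp flip: c(1))
    hence "c i \<in> homog (a - 1 + int i * \<sigma>1 + (int ?b - int i) * \<sigma>2 - 1)" by (rule homog_x0_cancel)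
    thus "c i \<in> homog (a - 2 + int i * \<sigma>1 + (int ?b - int i) * \<sigma>2)" by (simp add: algebra_simps)
    show "i \<le> ?b" using i by simp
  qed
  have "W \<in> EC (a - 2) (Suc b)"
  proof (cases "a = D")
    case True thus ?thesis using C_subset_EC_top W by simp
  next
    case False thus ?thesis using C_subset_EC W a by simp
  qed
  then obtain Q where Q: "W = (\<Sum>v\<in>UNIV. ET v * Q v)" "\<And>v. Q v \<in> C (a - 2) (Suc b)"
    unfolding EC_def by blast
  have lift: "\<exists>h. h \<in> bihomog (a - 1) (Suc b) \<and> A h = smult x (Q v)" if "x \<in> homog 1" for x v
    using C_smult[OF Q(2) that] a by (intro A_surj) auto
  obtain p where p: "\<And>v. p v \<in> bihomog (a - 1) (Suc b)" "\<And>v. A (p v) = smult x0 (Q v)"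
    using lift[OF homog_x0] by metis
  obtain q where q: "\<And>v. q v \<in> bihomog (a - 1) (Suc b)" "\<And>v. A (q v) = smult x1 (Q v)"
    using lift[OF homog_x1] by metis
  \<comment> \<open>the Koszul combinations that account for the part of \<open>W\<close> without a lift\<close>
  define k where "k v = tconst x1 * p v - tconst x0 * q v" for v
  have k: "k v \<in> comp a (Suc b)" for v
  proof (rule A_zero_K)
    show "k v \<in> bihomog a (Suc b)" unfolding k_def
      using p(1) q(1) by (intro bihomog_diff bihomog_mult'[OF bihomog_tconst[OF homog_x1]]
          bihomog_mult'[OF bihomog_tconst[OF homog_x0]]) auto
    show "A (k v) = 0" unfolding k_def by (simp add: A_simps p q mult.commute)
  qed
  define s' where "s' = s0 - (\<Sum>v\<in>UNIV. tvar v * p v)"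
  define t' where "t' = t - (\<Sum>v\<in>UNIV. tvar v * q v)"
  have s': "s' \<in> comp (a - 1) ?b"
  proof (rule A_zero_K)
    show "s' \<in> bihomog (a - 1) ?b" unfolding s'_def
      using s(2) p(1) by (intro bihomog_diff bihomog_sum bihomog_mult'[OF bihomog_tvar]) auto
    show "A s' = 0" unfolding s'_def sW A_simps p Q(1) smult_sum_right by simp
  qed
  have t': "t' \<in> comp (a - 1) ?b"
  proof (rule A_zero_K)
    show "t' \<in> bihomog (a - 1) ?b" unfolding t'_def
      using t q(1) by (intro bihomog_diff bihomog_sum bihomog_mult'[OF bihomog_tvar]) auto
    show "A t' = 0" unfolding t'_def tW A_simps q Q(1) smult_sum_right by simp
  qed
  have "h = tconst x1 * s' - tconst x0 * t' + (\<Sum>v\<in>UNIV. tvar v * k v)"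
  proof -
    have "(\<Sum>v\<in>UNIV. tvar v * k v) =
        tconst x1 * (\<Sum>v\<in>UNIV. tvar v * p v) - tconst x0 * (\<Sum>v\<in>UNIV. tvar v * q v)"
      unfolding k_def right_diff_distrib sum_subtractf sum_distrib_left by (simp only: mult.left_commute)
    thus ?thesis unfolding ht s'_def t'_def right_diff_distrib by simp
  qed
  also have "\<dots> \<in> low a ?b"
    by (intro kS.subspace_add[OF low_sub] kS.subspace_diff[OF low_sub] kS.subspace_sum[OF low_sub]
        x0_low x1_low tvar_low s' t' k)
  finally show ?thesis .
qed

text \<open>As \<open>H\<close> is homogeneous, the homogeneous part of \<open>Q\<close> of the expected bidegree is a quotient as
  well, and quotients by \<open>H\<close> are unique.\<close>

lemma quotient_graded:
  assumes P: "P \<in> C a (Suc b)" and Q: "P = H * Q" "degree Q \<le> b"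
  shows "Q \<in> C (a - N) b"
proof -
  define e where "e i = a - N + int i * \<sigma>1 + (int b - int i) * \<sigma>2" for i
  define Q' where "Q' = (\<Sum>i\<le>b. monom (hcomp (e i) (coeff Q i)) i)"
  have cQ': "coeff Q' i = hcomp (e i) (coeff Q i)" for i
    unfolding Q'_def using Q(2) by (auto simp: coeff_sum coeff_eq_0)
  have cH: "coeff (H * R) i = bb * coeff R i + (case i of 0 \<Rightarrow> 0 | Suc j \<Rightarrow> aa * coeff R j)" for R i
    unfolding H_def by (simp add: coeff_pCons split: nat.split)
  have "H * Q' = P"
  proof (rule poly_eqI)
    fix i
    show "coeff (H * Q') i = coeff P i"
    proof (cases "i \<le> Suc b")
      case False
      hence "coeff P i = 0" using P unfolding C_def by (auto intro: coeff_eq_0)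
      moreover from False have "coeff Q i = 0" "\<And>j. i = Suc j \<Longrightarrow> coeff Q j = 0"
        using Q(2) by (auto intro: coeff_eq_0)
      ultimately show ?thesis unfolding cH cQ' by (auto split: nat.split)
    next
      case True
      define n where "n = a + int i * \<sigma>1 + (int (Suc b) - int i) * \<sigma>2"
      have "coeff P i \<in> homog n" using P True unfolding C_def n_def by blast
      hence "coeff P i = hcomp n (coeff P i)" by (simp add: hcomp_id)
      also have "\<dots> = bb * hcomp (n - (N + \<sigma>2)) (coeff Q i) +
          (case i of 0 \<Rightarrow> 0 | Suc j \<Rightarrow> aa * hcomp (n - (N + \<sigma>1)) (coeff Q j))"
        unfolding Q(1) cH hcomp_add hcomp_mult[OF bb_homog]
        by (auto split: nat.split simp: hcomp_mult[OF aa_homog])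
      also have "\<dots> = coeff (H * Q') i"
      proof -
        have "n - (N + \<sigma>2) = e i" unfolding n_def e_def by (simp add: algebra_simps)
        moreover have "n - (N + \<sigma>1) = e j" if "i = Suc j" for j
          unfolding n_def e_def that by (simp add: algebra_simps)
        ultimately show ?thesis unfolding cH cQ' by (auto split: nat.split)
      qed
      finally show ?thesis by simp
    qed
  qed
  hence "Q' = Q" using Q(1) H_nonzero by (metis mult_cancel_left)
  moreover have "Q' \<in> C (a - N) b" unfolding Q'_def by (intro C_sum C_monom) (auto simp: e_def)
  ultimately show ?thesis by simp
qed

text \<open>Because \<open>(u1, u2)\<close> is a multiple of \<open>(-bb, aa)\<close>.\<close>

lemma hev_H: "hev u1 u2 1 H = 0"
proof -
  obtain r where r: "u1 = - r * bb" "u2 = r * aa" using u_multiple by blast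
  show ?thesis unfolding r H_def by (simp add: hev_def)
qed

text \<open>Membership in \<open>K\<close> means that \<open>A h\<close> vanishes at \<open>(u1, u2)\<close>, hence at
  \<open>(-bb, aa)\<close>, and the forms vanishing there are the multiples of \<open>H\<close>.\<close>

lemma comp_Suc_iff:
  "h \<in> comp a (Suc b) \<longleftrightarrow> h \<in> bihomog a (Suc b) \<and> (\<exists>Q \<in> C (a - N) b. A h = H * Q)"
proof (intro iffI conjI)
  assume h: "h \<in> comp a (Suc b)"
  thus hb: "h \<in> bihomog a (Suc b)" unfolding comp_def by simp
  have AC: "A h \<in> C a (Suc b)" using hb by (rule A_bihomog)
  hence dA: "degree (A h) \<le> Suc b" unfolding C_def by simp
  obtain r where r: "r \<noteq> 0" "u1 = - r * bb" "u2 = r * aa" using u_multiple by blast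
  have "hev u1 u2 (Suc b) (A h) = r ^ Suc b * hev (- bb) aa (Suc b) (A h)"
    unfolding hev_def sum_distrib_left
  proof (rule sum.cong)
    fix i assume i: "i \<in> {..Suc b}"
    have "r ^ Suc b = r ^ i * r ^ (Suc b - i)" using i by (simp flip: power_add)
    moreover have "u1 = r * (- bb)" unfolding r by simp
    ultimately show "coeff (A h) i * u1 ^ i * u2 ^ (Suc b - i) =
        r ^ Suc b * (coeff (A h) i * (- bb) ^ i * aa ^ (Suc b - i))"
      unfolding r(3) by (simp only: power_mult_distrib mult_ac)
  qed simp
  hence "hev (- bb) aa (Suc b) (A h) = 0" using h K_iff[OF hb] r(1) unfolding comp_def by simp
  then obtain Q where Q: "A h = H * Q" "degree Q \<le> b" using divides_if_vanishing[OF dA] by auto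
  thus "\<exists>Q \<in> C (a - N) b. A h = H * Q" using quotient_graded[OF AC] by blast
next
  assume *: "h \<in> bihomog a (Suc b) \<and> (\<exists>Q \<in> C (a - N) b. A h = H * Q)"
  then obtain Q where Q: "Q \<in> C (a - N) b" "A h = H * Q" by blast
  have dg: "degree H \<le> 1" "degree Q \<le> b" using H_C Q(1) unfolding C_def by simp_all
  hence "hev u1 u2 (1 + b) (A h) = 0" 
    unfolding Q(2) hev_mult[OF dg] hev_H by simp
  thus "h \<in> comp a (Suc b)" using * K_iff[of h a "Suc b"] unfolding comp_def by simp
qed

lemma lift_multiple:
  assumes "a \<ge> D - 1" "Q \<in> C (a - N) b"
  shows "\<exists>h. h \<in> comp a (Suc b) \<and> A h = H * Q"
proof -
  have "H * Q \<in> C a (Suc b)" using C_mult'[OF H_C assms(2)] by simp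
  then obtain h where "h \<in> bihomog a (Suc b)" "A h = H * Q" using A_surj[OF assms(1)] by blast
  thus ?thesis using comp_Suc_iff assms(2) by blast
qed

end

section \<open>Minimal generators of high x-degree\<close>

context rank_two
begin

text \<open>An index \<open>i\<close> stands for the element \<open>z\<^sub>1\<^sup>i
  z\<^sub>2\<^sup>b\<^sup>-\<^sup>1\<^sup>-\<^sup>i H\<close>, provided that it has bidegree \<open>(a, b)\<close>. For
  \<open>\<sigma>2 = 0\<close> only the powers of \<open>z\<^sub>1\<close> are admitted, because \<open>z\<^sub>2\<close> is then
  the image of a scalar multiple of some \<open>T\<^sub>v\<close> modulo multiples of \<open>z\<^sub>1\<close> by forms of positive
  degree.\<close>

definition indices :: "int \<Rightarrow> nat \<Rightarrow> nat set" where
  "indices a b = {i. i < b \<and> a = N - int i * \<sigma>1 - (int b - 1 - int i) * \<sigma>2 \<and> (\<sigma>2 = 0 \<longrightarrow> Suc i = b)}"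

lemma finite_indices: "finite (indices a b)"
  unfolding indices_def by simp

definition lift :: "int \<Rightarrow> nat \<Rightarrow> nat \<Rightarrow> ('k, 'v) tpoly" where
  "lift a b i = (SOME h. h \<in> comp a b \<and> A h = H * monom 1 i)"

lemma lift:
  assumes a: "a \<ge> D" and i: "i \<in> indices a (Suc b)"
  shows "lift a (Suc b) i \<in> comp a (Suc b) \<and> A (lift a (Suc b) i) = H * monom 1 i"
  unfolding lift_def
proof (rule someI_ex)
  have "a - N + int i * \<sigma>1 + (int b - int i) * \<sigma>2 = 0" "i \<le> b"
    using i unfolding indices_def by (auto simp: algebra_simps)
  hence "monom 1 i \<in> C (a - N) b" by (intro C_monom) simp_all
  thus "\<exists>h. h \<in> comp a (Suc b) \<and> A h = H * monom 1 i" using a by (intro lift_multiple) auto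
qed

text \<open>If \<open>c\<close> has positive degree, the element \<open>H c z\<^sub>1\<^sup>i z\<^sub>2\<^sup>l\<close> comes from
  \<open>x\<close>-degree \<open>a - 1 \<ge> D - 1\<close>, where lifts exist. If \<open>c\<close> is constant, the monomial is one
  of the indexed ones, or \<open>\<sigma>2 = 0\<close> and \<open>z\<^sub>2\<close> can be replaced by the image of some
  \<open>T\<^sub>v\<close> and a multiple of \<open>z\<^sub>1\<close> whose coefficient has degree \<open>\<sigma>1 >
  0\<close>.\<close>

lemma monom_generated:
  assumes a: "a \<ge> D" and i: "i \<le> Suc b"
    and c: "c \<in> homog (a - N + int i * \<sigma>1 + (int (Suc b) - int i) * \<sigma>2)"
  shows "\<exists>h \<in> kS.span (low a (Suc (Suc b)) \<union> lift a (Suc (Suc b)) ` indices a (Suc (Suc b))).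
           A h = H * monom c i"
proof -
  let ?b = "Suc (Suc b)"
  let ?V = "kS.span (low a ?b \<union> lift a ?b ` indices a ?b)"
  have lowV: "low a ?b \<subseteq> ?V" using kS.span_superset[of "low a ?b \<union> lift a ?b ` indices a ?b"] by blast
  have nonconst: "\<exists>h \<in> ?V. A h = H * monom c i"
    if pre: "i \<le> Suc b" "c \<in> homog e" "e = a - N + int i * \<sigma>1 + (int (Suc b) - int i) * \<sigma>2" "e \<noteq> 0" for c i e
  proof -
    obtain c' c'' where cc: "c' \<in> homog (e - 1)" "c'' \<in> homog (e - 1)" "c = x0 * c' + x1 * c''"
      using homog_split[OF pre(2,4)] by blast
    have "monom c' i \<in> C (a - 1 - N) (Suc b)" "monom c'' i \<in> C (a - 1 - N) (Suc b)"
      using cc(1,2) pre(1,3) by (auto intro!: C_monom simp: algebra_simps)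
    then obtain h' h'' where h: "h' \<in> comp (a - 1) ?b" "A h' = H * monom c' i"
      "h'' \<in> comp (a - 1) ?b" "A h'' = H * monom c'' i"
      using lift_multiple[of "a - 1" _ "Suc b"] a by (metis diff_right_mono)
    have "tconst x0 * h' + tconst x1 * h'' \<in> low a ?b"
      using h by (intro kS.subspace_add[OF low_sub] x0_low x1_low)
    moreover have "A (tconst x0 * h' + tconst x1 * h'') = H * monom c i"
    proof -
      have "monom c i = smult x0 (monom c' i) + smult x1 (monom c'' i)"
        unfolding cc(3) smult_monom add_monom ..
      thus ?thesis unfolding A_simps h(2,4) by (simp add: distrib_left)
    qed
    ultimately show ?thesis using lowV by blast
  qed
  define e where "e = a - N + int i * \<sigma>1 + (int (Suc b) - int i) * \<sigma>2"
  show ?thesis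
  proof (cases "e = 0")
    case False
    thus ?thesis using nonconst[OF i _ e_def] c unfolding e_def by blast
  next
    case True
    hence "c \<in> homog 0" using c unfolding e_def by simp
    hence "c = kc (cf c 0 0)" by (rule homog_zero_const)
    then obtain l where l: "c = kc l" by blast
    show ?thesis
    proof (cases "i \<in> indices a ?b")
      case ind: True
      have "lift a ?b i \<in> ?V" using ind by (intro kS.span_base) blast
      hence "ksc l (lift a ?b i) \<in> ?V" by (rule kS.span_scale)
      moreover have "A (ksc l (lift a ?b i)) = H * monom c i"
      proof -
        have "monom c i = smult c (monom 1 i)" by (simp add: smult_monom)
        thus ?thesis using lift[OF a ind] by (simp add: ksc_def A_simps l)
      qed
      ultimately show ?thesis by blast
    next
      case notind: False
      have "a = N - int i * \<sigma>1 - (int ?b - 1 - int i) * \<sigma>2" using True unfolding e_def by (simp add: algebra_simps)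
      hence s2: "\<sigma>2 = 0" and ib: "i \<le> b" using notind i unfolding indices_def by auto
      obtain v t where v: "t \<noteq> 0" "\<Psi>2 v = kc t" using psi2_unit[OF s2] by blast
      define r where "r = l / t"
      have r: "c = kc t * kc r" using v(1) by (simp add: l r_def flip: kc_simps(4))
      have mon: "monom c i = ET v * monom (kc r) i + monom (- (kc r * \<Psi>1 v)) (Suc i)"
      proof -
        have "ET v = monom (kc t) 0 + monom (\<Psi>1 v) 1" by (simp add: ET_def v(2) monom_0 monom_Suc)
        hence "ET v * monom (kc r) i = monom (kc t * kc r) i + monom (\<Psi>1 v * kc r) (Suc i)"
          by (simp only: distrib_right mult_monom add_0 plus_1_eq_Suc)
        thus ?thesis unfolding r by (simp only: add_monom add.assoc) (simp add: mult.commute)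
      qed
      have "monom (kc r) i \<in> C (a - N) b"
        using True s2 ib by (intro C_monom) (simp_all add: e_def)
      then obtain h where h: "h \<in> comp a (Suc b)" "A h = H * monom (kc r) i"
        using lift_multiple[of a _ b] a by auto
      have 1: "tvar v * h \<in> ?V" using tvar_low[OF h(1)] lowV by blast
      have "- (kc r * \<Psi>1 v) \<in> homog \<sigma>1" by (intro homog_uminus homog_kc_mult psi1_homog)
      then obtain h' where h': "h' \<in> ?V" "A h' = H * monom (- (kc r * \<Psi>1 v)) (Suc i)"
        using nonconst[of "Suc i" "- (kc r * \<Psi>1 v)" \<sigma>1] ib sigma(3) True s2
        unfolding e_def by (auto simp: algebra_simps)
      have "A (tvar v * h + h') = H * monom c i"
        unfolding A_simps h(2) h'(2) mon distrib_left by (simp only: mult.left_commute)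
      thus ?thesis using kS.span_add[OF 1 h'(1)] by blast
    qed
  qed
qed

lemma lift_inj: "a \<ge> D \<Longrightarrow> inj_on (lift a (Suc b)) (indices a (Suc b))"
proof (rule inj_onI)
  fix i j assume a: "a \<ge> D" and ij: "i \<in> indices a (Suc b)" "j \<in> indices a (Suc b)"
    "lift a (Suc b) i = lift a (Suc b) j"
  hence "H * monom 1 i = H * monom 1 j" using lift by metis
  hence "(monom 1 i :: 'k bipoly poly) = monom 1 j" using H_nonzero by simp
  thus "i = j" by (metis degree_monom_eq one_neq_zero)
qed

lemma cf_mult_0: "cf (p * q) 0 0 = cf p 0 0 * cf q 0 0"
  by (simp add: coeff_mult)

lemma cf_homog_0: "p \<in> homog k \<Longrightarrow> k > 0 \<Longrightarrow> cf p 0 0 = 0"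
  using homogD[of p k 0 0] by auto

text \<open>Modulo the kernel of \<open>A\<close>, which is contained in \<open>low\<close>, an element is determined by its
  quotient by \<open>H\<close>; this gives the spanning property. For independence consider the constant term of the coefficient of
  \<open>Z\<^sup>i\<close> in that quotient: it vanishes on \<open>low\<close> and on the other lifts, but not on the lift with
  index \<open>i\<close>. On multiples of the \<open>T\<^sub>v\<close> it vanishes because the \<open>\<Psi>1 v\<close> have
  positive degree and, if the \<open>\<Psi>2 v\<close> are constants, the quotient has no term \<open>Z\<^sup>i\<close> by the
  restriction on \<open>i\<close> in \<open>indices\<close>.\<close>

lemma lift_basis_mod:
  assumes a: "a \<ge> D"
  shows "basis_mod ksc (low a (Suc (Suc b))) (comp a (Suc (Suc b))) (lift a (Suc (Suc b)) ` indices a (Suc (Suc b)))"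
proof -
  let ?b = "Suc (Suc b)"
  let ?X = "lift a ?b ` indices a ?b"
  have sub: "?X \<subseteq> comp a ?b" using lift[OF a] by blast
  have "comp a ?b \<subseteq> kS.span (low a ?b \<union> ?X)"
  proof
    fix h assume h: "h \<in> comp a ?b"
    then obtain Q where Q: "Q \<in> C (a - N) (Suc b)" "A h = H * Q" using comp_Suc_iff by blast
    have "\<exists>h' \<in> kS.span (low a ?b \<union> ?X). A h' = H * Q"
      using Q(1)
    proof (rule C_induct)
      fix i and c :: "'k bipoly"
      assume "i \<le> Suc b" "c \<in> homog (a - N + int i * \<sigma>1 + (int (Suc b) - int i) * \<sigma>2)"
      thus "\<exists>h' \<in> kS.span (low a ?b \<union> ?X). A h' = H * monom c i" using monom_generated[OF a] by blast
    next
      fix P P' :: "'k bipoly poly"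
      assume "\<exists>h' \<in> kS.span (low a ?b \<union> ?X). A h' = H * P" "\<exists>h' \<in> kS.span (low a ?b \<union> ?X). A h' = H * P'"
      then obtain h1 h2 where "h1 \<in> kS.span (low a ?b \<union> ?X)" "A h1 = H * P"
        "h2 \<in> kS.span (low a ?b \<union> ?X)" "A h2 = H * P'" by blast
      thus "\<exists>h' \<in> kS.span (low a ?b \<union> ?X). A h' = H * (P + P')"
        by (intro bexI[of _ "h1 + h2"] kS.span_add) (simp_all add: A_simps distrib_left)
    qed
    then obtain h' where h': "h' \<in> kS.span (low a ?b \<union> ?X)" "A h' = H * Q" by blast
    have "h' \<in> comp a ?b"
      using h'(1) kS.span_minimal[of "low a ?b \<union> ?X", OF _ comp_sub] low_comp sub by blast
    hence "h - h' \<in> comp a ?b" using h kS.subspace_diff[OF comp_sub] by blast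
    hence "h - h' \<in> bihomog a ?b" unfolding comp_def by blast
    moreover have "A (h - h') = 0" using Q(2) h'(2) by (simp add: A_simps)
    ultimately have "h - h' \<in> low a ?b" using a by (rule kernel_low)
    hence "(h - h') + h' \<in> kS.span (low a ?b \<union> ?X)" using h'(1) by (intro kS.span_add) (auto intro: kS.span_base)
    thus "h \<in> kS.span (low a ?b \<union> ?X)" by simp
  qed
  moreover have "x \<notin> kS.span (low a ?b \<union> (?X - {x}))" if x: "x \<in> ?X" for x
  proof
    assume mem: "x \<in> kS.span (low a ?b \<union> (?X - {x}))"
    obtain i where i: "i \<in> indices a ?b" "x = lift a ?b i" using x by blast
    \<comment> \<open>the kernel of the functional that separates \<open>x\<close> from the rest\<close>
    define Z where "Z = {h. \<exists>Q. A h = H * Q \<and> cf (coeff Q i) 0 0 = 0}"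
    have Zsub: "kS.subspace Z"
    proof (rule kS.subspaceI)
      show "0 \<in> Z" unfolding Z_def by (auto simp: A_simps intro!: exI[of _ 0])
      show "x + y \<in> Z" if xy: "x \<in> Z" "y \<in> Z" for x y
      proof -
        obtain Q R where "A x = H * Q" "A y = H * R" "cf (coeff Q i) 0 0 = 0" "cf (coeff R i) 0 0 = 0"
          using xy unfolding Z_def by blast
        thus ?thesis unfolding Z_def by (intro CollectI exI[of _ "Q + R"]) (simp add: A_simps distrib_left)
      qed
      show "ksc c x \<in> Z" if "x \<in> Z" for c x
      proof -
        obtain Q where "A x = H * Q" "cf (coeff Q i) 0 0 = 0" using \<open>x \<in> Z\<close> unfolding Z_def by blast
        thus ?thesis unfolding Z_def
          by (intro CollectI exI[of _ "smult (kc c) Q"]) (simp add: A_simps ksc_def cf_mult_0)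
      qed
    qed
    have xZ: "y \<in> Z" if y: "y \<in> ?X - {x}" for y
    proof -
      obtain j where j: "j \<in> indices a ?b" "y = lift a ?b j" using y by blast
      hence "j \<noteq> i" using y i by auto
      thus ?thesis unfolding Z_def using lift[OF a j(1)] j(2) by (intro CollectI exI[of _ "monom 1 j"]) simp
    qed
    have mZ: "tconst z * h \<in> Z" if z: "z \<in> homog 1" and h: "h \<in> comp (a - 1) ?b" for z h
    proof -
      obtain Q where "A h = H * Q" using h comp_Suc_iff by blast
      moreover have "cf z 0 0 = 0" using cf_homog_0[OF z] by simp
      ultimately show ?thesis unfolding Z_def
        by (intro CollectI exI[of _ "smult z Q"]) (simp add: A_simps cf_mult_0)
    qed
    have tZ: "tvar v * h \<in> Z" if h: "h \<in> comp a (Suc b)" for v h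
    proof -
      obtain Q where Q: "Q \<in> C (a - N) b" "A h = H * Q" using h comp_Suc_iff by blast
      have p1: "cf (\<Psi>1 v) 0 0 = 0" using cf_homog_0[OF psi1_homog] sigma(3) by simp
      have p2: "cf (\<Psi>2 v) 0 0 * cf (coeff Q i) 0 0 = 0"
      proof (cases "\<sigma>2 = 0")
        case True
        hence "i = Suc b" using i(1) unfolding indices_def by simp
        hence "coeff Q i = 0" using Q(1) unfolding C_def by (auto intro: coeff_eq_0)
        thus ?thesis by simp
      next
        case False
        thus ?thesis using cf_homog_0[OF psi2_homog] sigma(1) by simp
      qed
      have "coeff (ET v * Q) i = \<Psi>2 v * coeff Q i + (case i of 0 \<Rightarrow> 0 | Suc j \<Rightarrow> \<Psi>1 v * coeff Q j)"
        unfolding ET_def by (simp add: coeff_pCons split: nat.split)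
      moreover have "cf (case i of 0 \<Rightarrow> 0 | Suc j \<Rightarrow> \<Psi>1 v * coeff Q j) 0 0 = 0"
        using p1 by (simp add: cf_mult_0 split: nat.split)
      ultimately have "cf (coeff (ET v * Q) i) 0 0 = 0" using p2 by (simp add: cf_mult_0)
      thus ?thesis unfolding Z_def
        by (intro CollectI exI[of _ "ET v * Q"]) (simp add: A_simps Q(2) mult.left_commute)
    qed
    have "lower_multiples a ?b \<subseteq> Z"
      unfolding lower_multiples_def by (auto intro: mZ tZ)
    hence "low a ?b \<subseteq> Z" unfolding low_def by (rule kS.span_minimal[OF _ Zsub])
    hence "kS.span (low a ?b \<union> (?X - {x})) \<subseteq> Z" using xZ by (intro kS.span_minimal[OF _ Zsub]) blast
    hence "x \<in> Z" using mem by blast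
    then obtain Q where Q: "A x = H * Q" "cf (coeff Q i) 0 0 = 0" unfolding Z_def by blast
    have "H * monom 1 i = H * Q" using lift[OF a i(1)] i(2) Q(1) by metis
    hence "Q = monom 1 i" using H_nonzero by simp
    thus False using Q(2) by simp
  qed
  ultimately show ?thesis using sub unfolding basis_mod_def by blast
qed

abbreviation g where "g \<equiv> syzygy_form \<phi>"

lemma lookup_linear:
  fixes r :: "'v \<Rightarrow> 'k bipoly"
  shows "lk (\<Sum>v\<in>UNIV. tvar v * tconst (r v)) (sg w 1) = r w"
proof -
  have eq: "(sg v (1::nat) = sg w 1) = (v = w)" for v w :: 'v
    by (metis lookup_single_eq lookup_single_not_eq zero_neq_one)
  have "tvar v * tconst (r v) = sg (sg v 1) (r v)" for v
    by (simp add: tvar_def tconst_def mult_single)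
  thus ?thesis by (simp add: lookup_sum lookup_single when_def eq[unfolded One_nat_def])
qed

lemma bihomog_linear:
  fixes h :: "('k, 'v) tpoly"
  assumes "h \<in> bihomog a 1"
  shows "\<exists>r. (\<forall>v. r v \<in> homog a) \<and> h = (\<Sum>v\<in>UNIV. tvar v * tconst (r v))"
proof -
  define r where "r v = lk h (sg v 1)" for v
  have "r v \<in> homog a" for v
    using assms homog_0[of a] unfolding r_def bihomog_iff by (cases "lk h (sg v 1) = 0") auto
  moreover have "h = (\<Sum>v\<in>UNIV. tvar v * tconst (r v))"
  proof (rule poly_mapping_eqI)
    fix \<mu> :: "'v \<Rightarrow>\<^sub>0 nat"
    have R: "(\<Sum>v\<in>UNIV. tvar v * tconst (r v)) \<in> bihomog a 1"
      using calculation by (intro bihomog_sum bihomog_mult'[OF bihomog_tvar bihomog_tconst]) auto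
    show "lk h \<mu> = lk (\<Sum>v\<in>UNIV. tvar v * tconst (r v)) \<mu>"
    proof (cases "tdeg \<mu> = 1")
      case True
      hence "ks \<mu> \<noteq> {}" by (auto simp: tdeg_def)
      then obtain w where w: "w \<in> ks \<mu>" by blast
      have "tdeg \<mu> = 1 + tdeg (\<mu> - sg w 1)" by (subst mon_split[OF w]) (simp add: tdeg_add)
      hence "\<mu> - sg w 1 = 0" using True by (intro tdeg_eq_0) simp
      hence "\<mu> = sg w 1" using mon_split[OF w] by simp
      thus ?thesis by (simp only: lookup_linear r_def)
    next
      case False
      thus ?thesis using assms R unfolding bihomog_iff by metis
    qed
  qed
  ultimately show ?thesis by blast
qed

lemma g_bihomog: "j \<in> {1..Suc m} \<Longrightarrow> g j \<in> bihomog (int (d j)) 1"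
  unfolding syzygy_form_def
  by (intro bihomog_sum bihomog_mult'[OF bihomog_tvar bihomog_tconst[OF phi_homog]]) auto

lemma combination_g: "(\<Sum>j=1..Suc m. tconst (c j) * g j) = (\<Sum>v\<in>UNIV. tvar v * tconst (\<Sum>j=1..Suc m. \<phi> v j * c j))"
proof -
  have "(\<Sum>j=1..Suc m. tconst (c j) * g j) = (\<Sum>j=1..Suc m. \<Sum>v\<in>UNIV. tvar v * tconst (\<phi> v j * c j))"
    unfolding syzygy_form_def sum_distrib_left tconst_mult by (simp only: mult_ac)
  thus ?thesis by (subst (asm) sum.swap) (simp only: tconst_sum sum_distrib_left)
qed

lemma g_independent:
  assumes "(\<Sum>j=1..Suc m. tconst (c j) * g j) = 0" "j \<in> {1..Suc m}"
  shows "c j = 0"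
proof -
  have "(\<Sum>j=1..Suc m. \<phi> v j * c j) = 0" for v
    using arg_cong[OF assms(1), of "\<lambda>h. lk h (sg v 1)"] unfolding combination_g lookup_linear by simp
  thus ?thesis using phi_inj assms(2) by blast
qed

lemma E_linear: "E (\<Sum>v\<in>UNIV. tvar v * tconst (r v)) = [:0, \<Sum>v\<in>UNIV. r v * f v:]"
  unfolding E_simps by (rule poly_eqI) (simp add: coeff_sum coeff_pCons split: nat.split)

lemma comp_iff: "h \<in> comp a b \<longleftrightarrow> E h = 0 \<and> h \<in> bihomog a b"
  unfolding comp_def by (simp add: K_def)

lemma g_comp: "j \<in> {1..Suc m} \<Longrightarrow> g j \<in> comp (int (d j)) 1"
proof -
  assume j: "j \<in> {1..Suc m}"
  have "(\<lambda>v. \<phi> v j) \<in> column_span \<phi> (Suc m)"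
    unfolding column_span_def
    by (intro CollectI exI[of _ "\<lambda>i. if i = j then 1 else 0"])
       (use j in \<open>simp add: if_distrib[of "\<lambda>x. _ * x"] cong: if_cong del: sum.cl_ivl_Suc\<close>)
  hence "(\<Sum>v\<in>UNIV. \<phi> v j * f v) = 0" unfolding syzygies[symmetric] by simp
  hence "E (g j) = 0" unfolding syzygy_form_def E_linear by simp
  thus ?thesis using g_bihomog[OF j] by (simp add: comp_iff)
qed

lemma comp_1:
  assumes "h \<in> comp a 1"
  shows "\<exists>c. (\<forall>j\<in>{1..Suc m}. c j \<in> homog (a - int (d j))) \<and> h = (\<Sum>j=1..Suc m. tconst (c j) * g j)"
proof -
  obtain r where r: "\<And>v. r v \<in> homog a" "h = (\<Sum>v\<in>UNIV. tvar v * tconst (r v))"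
    using bihomog_linear assms unfolding comp_def by blast
  have "E h = 0" using assms comp_iff by blast
  hence "(\<Sum>v\<in>UNIV. r v * f v) = 0" unfolding r(2) E_linear by simp
  hence "r \<in> column_span \<phi> (Suc m)" using syzygies by blast
  then obtain c where c: "\<And>v. r v = (\<Sum>j=1..Suc m. \<phi> v j * c j)"
    unfolding column_span_def by (auto dest: fun_cong)
  define c' where "c' j = hcomp (a - int (d j)) (c j)" for j
  have "r v = (\<Sum>j=1..Suc m. \<phi> v j * c' j)" for v
  proof -
    have "r v = hcomp a (r v)" using r(1) by (simp add: hcomp_id)
    also have "\<dots> = (\<Sum>j=1..Suc m. hcomp a (\<phi> v j * c j))" unfolding c hcomp_sum ..
    also have "\<dots> = (\<Sum>j=1..Suc m. \<phi> v j * c' j)"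
      unfolding c'_def by (intro sum.cong refl hcomp_mult phi_homog)
    finally show ?thesis .
  qed
  hence "h = (\<Sum>j=1..Suc m. tconst (c' j) * g j)" unfolding combination_g r(2) by simp
  thus ?thesis unfolding c'_def by (intro exI[of _ "\<lambda>j. hcomp (a - int (d j)) (c j)"]) simp
qed

text \<open>The map to \<open>R[t]\<close> is injective on \<open>R\<close>.\<close>

lemma comp_0: "comp a 0 = {0}"
proof -
  have "h = 0" if h: "h \<in> comp a 0" for h
  proof -
    have z: "\<mu> = 0" if "lk h \<mu> \<noteq> 0" for \<mu>
    proof -
      have "h \<in> bihomog a 0" using h comp_iff by blast
      hence "tdeg \<mu> = 0" using that unfolding bihomog_iff by auto
      thus "\<mu> = 0" by (rule tdeg_eq_0)
    qed
    have "h = tconst (lk h 0)"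
      by (rule poly_mapping_eqI) (use z in \<open>auto simp: tconst_def lookup_single when_def\<close>)
    moreover from this have "[:lk h 0:] = 0" using h E_simps(4)[of "lk h 0"] unfolding comp_iff by simp
    ultimately show ?thesis by simp
  qed
  thus ?thesis using kS.subspace_0[OF comp_sub] by blast
qed

lemma g_inj: "inj_on g {1..Suc m}"
proof (rule inj_onI)
  fix i j assume ij: "i \<in> {1..Suc m}" "j \<in> {1..Suc m}" "g i = g j"
  show "i = j"
  proof (rule ccontr)
    assume ne: "i \<noteq> j"
    define c :: "nat \<Rightarrow> 'k bipoly" where "c k = (if k = i then 1 else 0) - (if k = j then 1 else 0)" for k
    have "(\<Sum>k=1..Suc m. tconst (c k) * g k) = (\<Sum>k=1..Suc m. (if k = i then g k else 0) - (if k = j then g k else 0))"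
      using ne by (intro sum.cong) (auto simp: c_def tconst_uminus)
    also have "\<dots> = 0" using ij by (simp add: sum_subtractf del: sum.cl_ivl_Suc)
    finally have "c i = 0" using g_independent ij(1) by blast
    thus False using ne by (simp add: c_def)
  qed
qed

lemma tconst_mult_g:
  "tconst z * (\<Sum>j=1..Suc m. tconst (c j) * g j) = (\<Sum>j=1..Suc m. tconst (z * c j) * g j)"
  unfolding tconst_mult sum_distrib_left by (simp only: mult.assoc)

text \<open>The part of \<open>K\<close> of \<open>T\<close>-degree one is the module of syzygies, which is free on the columns of
  the resolution; a basis of a graded free module stays a basis modulo \<open>(x\<^sub>0, x\<^sub>1)\<close>.\<close>

lemma linear_basis_mod:
  "basis_mod ksc (low a 1) (comp a 1) (g ` {j \<in> {1..Suc m}. int (d j) = a})"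
proof -
  let ?X = "g ` {j \<in> {1..Suc m}. int (d j) = a}"
  have sub: "?X \<subseteq> comp a 1" using g_comp by blast
  have "comp a 1 \<subseteq> kS.span (low a 1 \<union> ?X)"
  proof
    fix h assume "h \<in> comp a 1"
    then obtain c where c: "\<forall>j\<in>{1..Suc m}. c j \<in> homog (a - int (d j))" "h = (\<Sum>j=1..Suc m. tconst (c j) * g j)"
      using comp_1 by blast
    have "tconst (c j) * g j \<in> kS.span (low a 1 \<union> ?X)" if j: "j \<in> {1..Suc m}" for j
    proof (cases "int (d j) = a")
      case True
      hence "c j \<in> homog 0" using c(1)[rule_format, OF j] by simp
      hence "c j = kc (cf (c j) 0 0)" by (rule homog_zero_const)
      then obtain l where "c j = kc l" by blast
      hence "tconst (c j) * g j = ksc l (g j)" by (simp add: ksc_def)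
      moreover have "g j \<in> low a 1 \<union> ?X" using True j by blast
      ultimately show ?thesis by (simp add: kS.span_scale kS.span_base)
    next
      case False
      have "tconst (c j) \<in> bihomog (a - int (d j)) (1 - 1)" using c(1) j by (simp add: bihomog_tconst)
      hence "tconst (c j) * g j \<in> low a 1" using False by (intro mult_low[OF g_comp[OF j]]) auto
      thus ?thesis by (intro kS.span_base) simp
    qed
    thus "h \<in> kS.span (low a 1 \<union> ?X)" unfolding c(2) by (rule kS.span_sum)
  qed
  moreover have "x \<notin> kS.span (low a 1 \<union> (?X - {x}))" if x: "x \<in> ?X" for x
  proof
    assume mem: "x \<in> kS.span (low a 1 \<union> (?X - {x}))"
    obtain i where i: "i \<in> {1..Suc m}" "x = g i" using x by blast
    \<comment> \<open>the kernel of the functional \<open>c i\<close> modulo \<open>(x\<^sub>0, x\<^sub>1)\<close>\<close>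
    define Z where "Z = {h. \<exists>c. h = (\<Sum>j=1..Suc m. tconst (c j) * g j) \<and> cf (c i) 0 0 = 0}"
    have Zsub: "kS.subspace Z"
    proof (rule kS.subspaceI)
      show "0 \<in> Z" unfolding Z_def by (intro CollectI exI[of _ "\<lambda>_. 0"]) simp
      show "x + y \<in> Z" if xy: "x \<in> Z" "y \<in> Z" for x y
      proof -
        obtain c e where "x = (\<Sum>j=1..Suc m. tconst (c j) * g j)" "y = (\<Sum>j=1..Suc m. tconst (e j) * g j)"
          "cf (c i) 0 0 = 0" "cf (e i) 0 0 = 0" using xy unfolding Z_def by blast
        thus ?thesis unfolding Z_def
          by (intro CollectI exI[of _ "\<lambda>j. c j + e j"])
             (simp add: tconst_add distrib_right sum.distrib del: sum.cl_ivl_Suc)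
      qed
      show "ksc l x \<in> Z" if x: "x \<in> Z" for l x
      proof -
        obtain c where "x = (\<Sum>j=1..Suc m. tconst (c j) * g j)" "cf (c i) 0 0 = 0" using x unfolding Z_def by blast
        thus ?thesis unfolding Z_def
          by (intro CollectI exI[of _ "\<lambda>j. kc l * c j"])
             (simp add: ksc_def tconst_mult_g[unfolded One_nat_def] cf_mult_0 del: sum.cl_ivl_Suc)
      qed
    qed
    have xZ: "y \<in> Z" if y: "y \<in> ?X - {x}" for y
    proof -
      obtain j where j: "j \<in> {1..Suc m}" "y = g j" using y by blast
      hence "j \<noteq> i" using y i by auto
      moreover have "y = (\<Sum>k=1..Suc m. tconst (if k = j then 1 else 0) * g k)"
        using j by (simp add: if_distrib[of tconst] if_distrib[of "\<lambda>x. x * _"] del: sum.cl_ivl_Suc cong: if_cong)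
      ultimately show ?thesis unfolding Z_def by (intro CollectI exI[of _ "\<lambda>k. if k = j then 1 else 0"]) simp
    qed
    have mZ: "tconst z * h \<in> Z" if z: "z \<in> homog 1" and h: "h \<in> comp (a - 1) 1" for z h
    proof -
      obtain c where "h = (\<Sum>j=1..Suc m. tconst (c j) * g j)" using comp_1[OF h] by blast
      moreover have "cf z 0 0 = 0" using cf_homog_0[OF z] by simp
      ultimately show ?thesis unfolding Z_def
        by (intro CollectI exI[of _ "\<lambda>j. z * c j"])
           (simp add: tconst_mult_g[unfolded One_nat_def] cf_mult_0 del: sum.cl_ivl_Suc)
    qed
    have "0 \<in> Z" using kS.subspace_0[OF Zsub] .
    hence "lower_multiples a 1 \<subseteq> Z"
      unfolding lower_multiples_def using comp_0 by (auto intro: mZ)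
    hence "low a 1 \<subseteq> Z" unfolding low_def by (rule kS.span_minimal[OF _ Zsub])
    hence "kS.span (low a 1 \<union> (?X - {x})) \<subseteq> Z" using xZ by (intro kS.span_minimal[OF _ Zsub]) blast
    hence "x \<in> Z" using mem by blast
    then obtain c where c: "g i = (\<Sum>j=1..Suc m. tconst (c j) * g j)" "cf (c i) 0 0 = 0"
      unfolding Z_def i(2) by blast
    have "g i = (\<Sum>k=1..Suc m. tconst (if k = i then 1 else 0) * g k)"
      using i by (simp add: if_distrib[of tconst] if_distrib[of "\<lambda>x. x * _"] del: sum.cl_ivl_Suc cong: if_cong)
    hence "(\<Sum>j=1..Suc m. tconst (c j) * g j) - (\<Sum>k=1..Suc m. tconst (if k = i then 1 else 0) * g k) = 0"
      using c(1) by simp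
    hence "(\<Sum>j=1..Suc m. tconst (c j + - (if j = i then 1 else 0)) * g j) = 0"
      unfolding tconst_add tconst_uminus sum_subtractf[symmetric] by (simp add: left_diff_distrib del: sum.cl_ivl_Suc)
    hence "c i + - (if i = i then 1 else 0) = 0" using i(1) by (rule g_independent)
    hence "c i = 1" by simp
    thus False using c(2) by simp
  qed
  ultimately show ?thesis using sub unfolding basis_mod_def by blast
qed

definition basis :: "int \<Rightarrow> nat \<Rightarrow> ('k, 'v) tpoly set" where
  "basis a b = (if b = 0 then {} else if b = 1 then g ` {j \<in> {1..Suc m}. int (d j) = a} else lift a b ` indices a b)"

definition B :: "('k, 'v) tpoly set" where "B = g ` {j \<in> {1..m}. d j = d m}"

lemma B_bihomog: "B \<inter> bihomog a b = (if (a, b) = (D, 1) then B else {})"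
proof (cases "(a, b) = (D, 1)")
  case True
  have "B \<subseteq> bihomog D 1" unfolding B_def using g_bihomog by fastforce
  thus ?thesis using True by auto
next
  case False
  have "h \<notin> bihomog a b" if "h \<in> B" for h
  proof
    assume h: "h \<in> bihomog a b"
    obtain j where j: "j \<in> {1..m}" "d j = d m" "h = g j" using \<open>h \<in> B\<close> unfolding B_def by blast
    have j': "j \<in> {1..Suc m}" using j(1) by simp
    have "h = 0" using bihomog_unique[OF h, of D 1] g_bihomog[OF j'] j False by simp
    moreover have "h \<noteq> 0"
    proof
      assume h0: "h = 0"
      have "(\<Sum>k=1..Suc m. tconst (if k = j then 1 else 0) * g k) = g j"
        using j' by (simp add: if_distrib[of tconst] if_distrib[of "\<lambda>x. x * _"] del: sum.cl_ivl_Suc cong: if_cong)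
      hence "(\<Sum>k=1..Suc m. tconst (if k = j then 1 else 0) * g k) = 0" using h0 j(3) by simp
      hence "(if j = j then 1 else 0) = (0 :: 'k bipoly)" using j' by (rule g_independent)
      thus False by simp
    qed
    ultimately show False by blast
  qed
  thus ?thesis using False by auto
qed

lemma basis_basis_mod:
  assumes "a \<ge> D"
  shows "basis_mod ksc (low a b) (comp a b) (basis a b)"
proof -
  consider "b = 0" | "b = 1" | b' where "b = Suc (Suc b')" by (metis One_nat_def not0_implies_Suc)
  thus ?thesis
  proof cases
    case 1
    thus ?thesis using kS.span_zero unfolding basis_def basis_mod_def by (auto simp: comp_0)
  next
    case 2 thus ?thesis using linear_basis_mod unfolding basis_def by simp
  next
    case 3 thus ?thesis using lift_basis_mod[OF assms] unfolding basis_def by simp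
  qed
qed

lemma basis_finite: "finite (basis a b)"
  unfolding basis_def by (simp add: finite_indices)

text \<open>In \<open>T\<close>-degree one the last column corresponds to the index \<open>0\<close> and the columns before it to
  \<open>B\<close>, since their degrees are at most \<open>D\<close>.\<close>

lemma basis_card:
  assumes a: "a \<ge> D"
  shows "card (basis a b) = card (B \<inter> bihomog a b) + card (indices a b)"
proof -
  consider "b = 0" | "b = 1" | b' where "b = Suc (Suc b')" by (metis One_nat_def not0_implies_Suc)
  thus ?thesis
  proof cases
    case 1
    thus ?thesis unfolding B_bihomog basis_def indices_def by simp
  next
    case 3
    thus ?thesis unfolding B_bihomog using card_image[OF lift_inj[OF a, of "Suc b'"]]
      by (simp add: basis_def)
  next
    case 2
    have dle: "d j \<le> d m" if "j \<in> {1..m}" for j using that m_pos by (intro d_mono) auto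
    have split: "{j \<in> {1..Suc m}. int (d j) = a} =
      {j \<in> {1..m}. int (d j) = a} \<union> (if N = a then {Suc m} else {})"
      using m_pos by (auto simp: le_Suc_eq)
    have old: "card {j \<in> {1..m}. int (d j) = a} = card (B \<inter> bihomog a b)"
    proof (cases "a = D")
      case True
      have "inj_on g {j \<in> {1..m}. d j = d m}" by (rule inj_on_subset[OF g_inj]) auto
      hence "card B = card {j \<in> {1..m}. d j = d m}" unfolding B_def by (rule card_image)
      thus ?thesis using True 2 unfolding B_bihomog by simp
    next
      case False
      have "{j \<in> {1..m}. int (d j) = a} = {}" using dle a False by fastforce
      moreover have "B \<inter> bihomog a b = {}" unfolding B_bihomog using False by simp
      ultimately show ?thesis by simp
    qed
    have new: "card (if N = a then {Suc m} else {}) = card (indices a b)"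
    proof -
      have "indices a b = (if N = a then {0} else {})"
        unfolding indices_def using 2 by auto
      thus ?thesis by simp
    qed
    have "card (basis a b) = card {j \<in> {1..Suc m}. int (d j) = a}"
    proof -
      have "inj_on g {j \<in> {1..Suc m}. int (d j) = a}" by (rule inj_on_subset[OF g_inj]) auto
      thus ?thesis unfolding basis_def using 2 by (simp add: card_image)
    qed
    also have "\<dots> = card {j \<in> {1..m}. int (d j) = a} + card (if N = a then {Suc m} else {})"
      unfolding split by (rule card_Un_disjoint) auto
    finally show ?thesis unfolding old new .
  qed
qed

theorem high_generators_K:
  assumes "finite J" and "\<And>a b. a \<ge> D \<Longrightarrow> card {x \<in> J. \<beta> x = (a, b)} = card (indices a b)"
  shows "high_generators K D B J \<beta>"
proof (rule high_generatorsI)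
  show "basis_mod ksc (low a b) (comp a b) (basis a b)" if "D \<le> a" for a b
    using that by (rule basis_basis_mod)
  show "finite (basis a b)" for a b by (rule basis_finite)
  show "card (basis a b) = card (B \<inter> bihomog a b) + card {x \<in> J. \<beta> x = (a, b)}" if "D \<le> a" for a b
    using basis_card[OF that] assms(2)[OF that] by simp
  have "B \<subseteq> basis D 1" unfolding B_def basis_def by auto
  thus "B \<subseteq> (\<Union>a\<in>{D..}. \<Union>b. basis a b)" by fastforce
  show "finite G" if "minimal_bihomog_generators K G" for G using that by (rule minimal_generators_finite)
qed (rule assms(1))

end

section \<open>The equations of the Rees algebra of an ideal\<close>

lemma (in coeff_hom) eval_mon_eval: "tp_eval c \<theta> (mon_eval \<eta> \<mu>) = mon_eval (\<lambda>v. tp_eval c \<theta> (\<eta> v)) \<mu>"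
proof (induction \<mu> rule: tpoly_single_induct)
  case (1 v n)
  have "tp_eval c \<theta> (\<eta> v ^ n) = tp_eval c \<theta> (\<eta> v) ^ n" by (induction n) (auto simp: eval_mult)
  thus ?case by simp
qed (simp add: mon_eval_add eval_mult)

lemma ideal_congruence_mult:
  assumes J: "ideal.subspace J" and "x - y \<in> J" "x' - y' \<in> J"
  shows "x * x' - y * y' \<in> (J :: 'a::comm_ring_1 set)"
proof -
  have "x * x' - y * y' = x * (x' - y') + y' * (x - y)" by (simp add: algebra_simps)
  thus ?thesis using assms by (metis ideal.subspace_add ideal.subspace_scale)
qed

text \<open>The symmetric algebra of \<open>I\<close> maps to \<open>R[t]\<close>, which is torsionfree, so torsion in the
  symmetric algebra is killed by this map. Conversely, choose \<open>f\<^sub>0 \<noteq> 0\<close> among the generators. In the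
  symmetric algebra \<open>f\<^sub>0 T\<^sub>x = x T\<^sub>f\<^sub>0\<close>; thus a power of \<open>f\<^sub>0\<close> turns
  \<open>h(T\<^sub>f)\<close> into a polynomial in the single variable \<open>T\<^sub>f\<^sub>0\<close>, whose coefficients are, up
  to powers of \<open>f\<^sub>0\<close>, those of the image of \<open>h\<close> in \<open>R[t]\<close>.\<close>

lemma rees_equations_ideal:
  fixes f :: "'v \<Rightarrow> 'k::field bipoly"
  assumes I: "I = ideal_gen (range f)" and v0: "f v0 \<noteq> 0"
  shows "rees_equations (ideal_mod I \<delta>) f = {h. tp_eval (\<lambda>r. [:r:]) (\<lambda>v. [:0, f v:]) h = 0}"
proof -
  interpret cc: coeff_hom "\<lambda>r :: 'k bipoly. [:r:]" by (rule coeff_hom_const)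
  let ?M = "ideal_mod I \<delta>"
  let ?J = "sym_ideal ?M"
  let ?E = "tp_eval (\<lambda>r. [:r:]) (\<lambda>v. [:0, f v:])"
  let ?sub = "tsubst (\<lambda>i. tvar (f i)) :: ('k, 'v) tpoly \<Rightarrow> ('k, 'k bipoly) tpoly"
  have Isub: "ideal.subspace I" unfolding I by (rule ideal.subspace_span)
  have fI: "f v \<in> I" for v unfolding I by (intro ideal.span_base) simp
  have J: "ideal.subspace ?J" unfolding sym_ideal_def by (rule ideal.subspace_span)
  define \<theta> where "\<theta> e = (if e \<in> I then [:0, e:] else 0)" for e
  define P where "P = tp_eval (\<lambda>r :: 'k bipoly. [:r:]) \<theta>"
  have Ptv: "P (tvar e) = \<theta> e" and Ptc: "P (tconst r) = [:r:]" for e r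
    unfolding P_def by (simp_all add: tvar_def tconst_def cc.eval_single one_pCons[symmetric])
  have PJ: "P h = 0" if "h \<in> ?J" for h
  proof -
    have "?J \<subseteq> {h. P h = 0}"
      unfolding sym_ideal_def
    proof (rule ideal.span_minimal)
      show "ideal.subspace {h. P h = 0}"
        unfolding P_def by (rule ideal.subspaceI) (auto simp: cc.eval_add cc.eval_mult)
      have "P (tvar (x + y) - tvar x - tvar y) = 0" if "x \<in> I" "y \<in> I" for x y
        using that ideal.subspace_add[OF Isub that] Ptv unfolding P_def cc.eval_diff
        by (simp add: \<theta>_def)
      moreover have "P (tvar (r * x) - tconst r * tvar x) = 0" if "x \<in> I" for r x
        using that ideal.subspace_scale[OF Isub that] Ptv Ptc unfolding P_def cc.eval_diff cc.eval_mult
        by (simp add: \<theta>_def)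
      moreover have "P (tvar x) = 0" if "x \<notin> I" for x using that by (simp add: Ptv \<theta>_def)
      ultimately show "{tvar (gadd ?M x y) - tvar x - tvar y |x y. x \<in> gcarrier ?M \<and> y \<in> gcarrier ?M} \<union>
          {tvar (gscale ?M r x) - tconst r * tvar x |r x. x \<in> gcarrier ?M} \<union>
          {tvar x |x. x \<notin> gcarrier ?M} \<subseteq> {h. P h = 0}"
        unfolding ideal_mod_def by auto
    qed
    thus ?thesis using that by blast
  qed
  have sub: "?sub h = (\<Sum>\<mu>\<in>ks h. tconst (lk h \<mu>) * mon_eval (\<lambda>v. tvar (f v)) \<mu>)" for h
    unfolding tsubst_eval tp_eval_def ..
  have Psub: "P (?sub h) = ?E h" for h
    unfolding sub unfolding P_def cc.eval_sum cc.eval_mult cc.eval_mon_eval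
    unfolding P_def[symmetric] Ptv Ptc tp_eval_def by (simp add: \<theta>_def fI)
  show ?thesis
  proof (intro equalityI subsetI)
    fix h assume "h \<in> rees_equations ?M f"
    then obtain r where r: "r \<noteq> 0" "tconst r * ?sub h \<in> ?J"
      unfolding rees_equations_def rees_ideal_def by blast
    have "P (x * y) = P x * P y" for x y unfolding P_def by (rule cc.eval_mult)
    hence "P (tconst r * ?sub h) = [:r:] * ?E h" by (simp only: Psub Ptc)
    hence "[:r:] * ?E h = 0" using PJ[OF r(2)] by (simp only:)
    moreover have "[:r:] \<noteq> 0" using r(1) by simp
    ultimately have "?E h = 0" by (simp only: mult_eq_0_iff simp_thms)
    thus "h \<in> {h. ?E h = 0}" by blast
  next
    fix h assume "h \<in> {h. ?E h = 0}"
    hence E0: "?E h = 0" by blast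
    define f0 where "f0 = f v0"
    define T0 :: "('k, 'k bipoly) tpoly" where "T0 = tvar f0"
    \<comment> \<open>both sides are congruent to the variable of the product \<open>f0 * f v\<close>\<close>
    have lin: "tconst f0 * tvar (f v) - tconst (f v) * T0 \<in> ?J" for v
    proof -
      have s: "tvar (r * x) - tconst r * tvar x \<in> ?J" if "x \<in> I" for r x
        unfolding sym_ideal_def using that by (intro ideal.span_base) (auto simp: ideal_mod_def)
      have "(tvar (f v * f0) - tconst (f v) * tvar f0) - (tvar (f0 * f v) - tconst f0 * tvar (f v)) \<in> ?J"
        unfolding f0_def by (rule ideal.subspace_diff[OF J s[OF fI] s[OF fI]])
      moreover have "f v * f0 = f0 * f v" by (rule mult.commute)
      moreover have "(t - x) - (t - y) = y - x" for t x y :: "('k, 'k bipoly) tpoly" by simp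
      ultimately show ?thesis unfolding T0_def by (simp only:)
    qed
    have mon: "tconst f0 ^ tdeg \<mu> * mon_eval (\<lambda>v. tvar (f v)) \<mu> - tconst (mon_eval f \<mu>) * T0 ^ tdeg \<mu> \<in> ?J" for \<mu>
    proof (induction \<mu> rule: tpoly_single_induct)
      case (1 v n)
      have "(tconst f0 * tvar (f v)) ^ n - (tconst (f v) * T0) ^ n \<in> ?J"
      proof (induction n)
        case 0 thus ?case using ideal.subspace_0[OF J] by simp
      next
        case (Suc n) thus ?case unfolding power_Suc by (intro ideal_congruence_mult[OF J] lin)
      qed
      thus ?case by (simp add: power_mult_distrib tconst_power)
    next
      case (2 \<mu> \<nu>)
      have "(tconst f0 ^ tdeg \<mu> * mon_eval (\<lambda>v. tvar (f v)) \<mu>) * (tconst f0 ^ tdeg \<nu> * mon_eval (\<lambda>v. tvar (f v)) \<nu>)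
          - (tconst (mon_eval f \<mu>) * T0 ^ tdeg \<mu>) * (tconst (mon_eval f \<nu>) * T0 ^ tdeg \<nu>) \<in> ?J"
        using 2 by (rule ideal_congruence_mult[OF J])
      moreover have "(tconst f0 ^ tdeg \<mu> * mon_eval (\<lambda>v. tvar (f v)) \<mu>) * (tconst f0 ^ tdeg \<nu> * mon_eval (\<lambda>v. tvar (f v)) \<nu>)
        = tconst f0 ^ tdeg (\<mu> + \<nu>) * mon_eval (\<lambda>v. tvar (f v)) (\<mu> + \<nu>)"
        unfolding tdeg_add mon_eval_add power_add by (simp only: mult_ac)
      moreover have "(tconst (mon_eval f \<mu>) * T0 ^ tdeg \<mu>) * (tconst (mon_eval f \<nu>) * T0 ^ tdeg \<nu>)
        = tconst (mon_eval f (\<mu> + \<nu>)) * T0 ^ tdeg (\<mu> + \<nu>)"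
        unfolding tdeg_add mon_eval_add power_add tconst_mult by (simp only: mult_ac)
      ultimately show ?case by simp
    qed
    define n where "n = (\<Sum>\<mu>\<in>ks h. tdeg \<mu>)"
    have n: "tdeg \<mu> \<le> n" if "\<mu> \<in> ks h" for \<mu>
      unfolding n_def using that by (intro member_le_sum) auto
    \<comment> \<open>the polynomial in \<open>T0\<close> that replaces \<open>h(T\<^sub>f)\<close> after multiplication by \<open>f0 ^ n\<close>\<close>
    define W where "W Q = (\<Sum>q\<le>n. tconst (coeff Q q * f0 ^ (n - q)) * T0 ^ q)" for Q
    have W_sum: "W (sum Q X) = (\<Sum>x\<in>X. W (Q x))" for Q and X :: "('v \<Rightarrow>\<^sub>0 nat) set"
      unfolding W_def coeff_sum sum_distrib_right tconst_sum by (rule sum.swap)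
    have W_monom: "W (monom r q) = tconst (r * f0 ^ (n - q)) * T0 ^ q" if "q \<le> n" for r q
    proof -
      have "W (monom r q) = (\<Sum>q'\<le>n. if q' = q then tconst (r * f0 ^ (n - q)) * T0 ^ q else 0)"
        unfolding W_def by (intro sum.cong) auto
      thus ?thesis using that by simp
    qed
    have summand: "tconst (f0 ^ n) * (tconst (lk h \<mu>) * mon_eval (\<lambda>v. tvar (f v)) \<mu>)
        - W (monom (lk h \<mu> * mon_eval f \<mu>) (tdeg \<mu>)) \<in> ?J" if "\<mu> \<in> ks h" for \<mu>
    proof -
      let ?c = "tconst (lk h \<mu>) * tconst (f0 ^ (n - tdeg \<mu>)) :: ('k, 'k bipoly) tpoly"
      have e: "f0 ^ n = f0 ^ tdeg \<mu> * f0 ^ (n - tdeg \<mu>)" using n[OF that] by (simp flip: power_add)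
      have "?c * (tconst f0 ^ tdeg \<mu> * mon_eval (\<lambda>v. tvar (f v)) \<mu> - tconst (mon_eval f \<mu>) * T0 ^ tdeg \<mu>) \<in> ?J"
        by (rule ideal.subspace_scale[OF J mon])
      moreover have "?c * (tconst f0 ^ tdeg \<mu> * mon_eval (\<lambda>v. tvar (f v)) \<mu>)
          = tconst (f0 ^ n) * (tconst (lk h \<mu>) * mon_eval (\<lambda>v. tvar (f v)) \<mu>)"
        unfolding e tconst_mult tconst_power by (simp only: mult_ac)
      moreover have "?c * (tconst (mon_eval f \<mu>) * T0 ^ tdeg \<mu>) = W (monom (lk h \<mu> * mon_eval f \<mu>) (tdeg \<mu>))"
        unfolding W_monom[OF n[OF that]] tconst_mult by (simp only: mult_ac)
      ultimately show ?thesis unfolding right_diff_distrib by simp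
    qed
    have "tconst (f0 ^ n) * ?sub h - W (?E h) \<in> ?J"
    proof -
      have "?E h = (\<Sum>\<mu>\<in>ks h. monom (lk h \<mu> * mon_eval f \<mu>) (tdeg \<mu>))"
        unfolding tp_eval_def by (simp add: mon_eval_linear smult_monom)
      hence "tconst (f0 ^ n) * ?sub h - W (?E h) =
        (\<Sum>\<mu>\<in>ks h. tconst (f0 ^ n) * (tconst (lk h \<mu>) * mon_eval (\<lambda>v. tvar (f v)) \<mu>)
        - W (monom (lk h \<mu> * mon_eval f \<mu>) (tdeg \<mu>)))"
        unfolding sub sum_distrib_left sum_subtractf by (simp only: W_sum)
      also have "\<dots> \<in> ?J" using summand by (intro ideal.subspace_sum[OF J])
      finally show ?thesis .
    qed
    moreover have "W 0 = 0" unfolding W_def by simp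
    ultimately have "tconst (f0 ^ n) * ?sub h \<in> ?J" using E0 by simp
    moreover have "f0 ^ n \<noteq> 0" using v0 unfolding f0_def by simp
    ultimately show "h \<in> rees_equations ?M f" unfolding rees_equations_def rees_ideal_def by blast
  qed
qed

section \<open>Coordinates on the double dual of a cokernel\<close>

definition unit_vec :: "'i \<Rightarrow> 'i \<Rightarrow> 'r::comm_ring_1" where
  "unit_vec i = (\<lambda>j. if j = i then 1 else 0)"

lemma linear_expansion:
  fixes L :: "('v::finite \<Rightarrow> 'r::comm_ring_1) \<Rightarrow> 'r"
  assumes add: "\<And>v w. L (\<lambda>i. v i + w i) = L v + L w" and scale: "\<And>r v. L (\<lambda>i. r * v i) = r * L v"
  shows "L v = (\<Sum>i\<in>UNIV. v i * L (unit_vec i))"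
proof -
  have "L (\<lambda>i. if i \<in> F then v i else 0) = (\<Sum>i\<in>F. v i * L (unit_vec i))" for F
    using finite[of F]
  proof (induction F rule: finite_induct)
    case empty
    have "L (\<lambda>i. 0) = 0" using scale[of 0 v] by simp
    thus ?case by simp
  next
    case (insert k F)
    have "(\<lambda>i. if i \<in> insert k F then v i else 0) =
        (\<lambda>i. (\<lambda>j. v k * unit_vec k j) i + (if i \<in> F then v i else 0))"
      using insert(2) by (auto simp: unit_vec_def)
    hence "L (\<lambda>i. if i \<in> insert k F then v i else 0) =
        L (\<lambda>j. v k * unit_vec k j) + L (\<lambda>i. if i \<in> F then v i else 0)" by (simp only: add)
    thus ?case using insert by (simp add: scale)
  qed
  from this[of UNIV] show ?thesis by simp
qed

lemma column_spanI: "v = (\<lambda>i. \<Sum>j=1..m. \<phi> i j * c j) \<Longrightarrow> v \<in> column_span \<phi> m"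
  unfolding column_span_def by (intro CollectI exI[of _ c] conjI TrueI)

lemma column_cosetI: "w \<in> column_span \<phi> m \<Longrightarrow> z = (\<lambda>i. v i + w i) \<Longrightarrow> z \<in> column_coset \<phi> m v"
  unfolding column_coset_def by (intro CollectI exI[of _ w] conjI)

lemma column_span_0: "(\<lambda>_. 0) \<in> column_span \<phi> m"
  unfolding column_span_def by (intro CollectI exI[of _ "\<lambda>_. 0"]) simp

lemma column_span_add: "v \<in> column_span \<phi> m \<Longrightarrow> w \<in> column_span \<phi> m \<Longrightarrow> (\<lambda>i. v i + w i) \<in> column_span \<phi> m"
proof -
  assume "v \<in> column_span \<phi> m" "w \<in> column_span \<phi> m"
  then obtain c e where "v = (\<lambda>i. \<Sum>j=1..m. \<phi> i j * c j)" "w = (\<lambda>i. \<Sum>j=1..m. \<phi> i j * e j)"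
    unfolding column_span_def by blast
  thus ?thesis unfolding column_span_def
    by (intro CollectI exI[of _ "\<lambda>j. c j + e j"]) (simp add: distrib_left sum.distrib)
qed

lemma column_span_scale: "v \<in> column_span \<phi> m \<Longrightarrow> (\<lambda>i. r * v i) \<in> column_span \<phi> m"
proof -
  assume "v \<in> column_span \<phi> m"
  then obtain c where c: "v = (\<lambda>i. \<Sum>j=1..m. \<phi> i j * c j)" unfolding column_span_def by blast
  have "(\<lambda>i. r * v i) = (\<lambda>i. \<Sum>j=1..m. \<phi> i j * (r * c j))"
    unfolding c sum_distrib_left by (simp only: mult.left_commute)
  thus ?thesis by (rule column_spanI)
qed

lemma column_in_span: "j \<in> {1..m} \<Longrightarrow> (\<lambda>i. \<phi> i j) \<in> column_span \<phi> m"
  unfolding column_span_def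
  by (intro CollectI exI[of _ "\<lambda>k. if k = j then 1 else 0"])
     (simp add: if_distrib[of "\<lambda>x. _ * x"] cong: if_cong)

lemma coset_mem: "v \<in> column_coset \<phi> m v"
  unfolding column_coset_def by (intro CollectI exI[of _ "\<lambda>_. 0"]) (simp add: column_span_0)

lemma coset_add: "{(\<lambda>i. x i + y i) | x y. x \<in> column_coset \<phi> m v \<and> y \<in> column_coset \<phi> m w} =
    column_coset \<phi> m (\<lambda>i. v i + w i)" (is "?L = ?R")
proof
  show "?L \<subseteq> ?R"
  proof
    fix z assume "z \<in> ?L"
    then obtain a b where ab: "z = (\<lambda>i. (v i + a i) + (w i + b i))" "a \<in> column_span \<phi> m" "b \<in> column_span \<phi> m"
      unfolding column_coset_def by auto
    have "z = (\<lambda>i. (v i + w i) + (a i + b i))" unfolding ab(1) by (simp add: add_ac)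
    thus "z \<in> ?R" by (rule column_cosetI[OF column_span_add[OF ab(2,3)]])
  qed
  show "?R \<subseteq> ?L"
  proof
    fix z assume "z \<in> ?R"
    then obtain a where a: "z = (\<lambda>i. (v i + w i) + a i)" "a \<in> column_span \<phi> m"
      unfolding column_coset_def by auto
    have "z = (\<lambda>i. v i + (\<lambda>i. w i + a i) i)" unfolding a(1) by (simp add: add_ac)
    moreover have "(\<lambda>i. w i + a i) \<in> column_coset \<phi> m w" using a(2) refl by (rule column_cosetI)
    ultimately show "z \<in> ?L"
      by (intro CollectI exI[of _ v] exI[of _ "\<lambda>i. w i + a i"] conjI coset_mem)
  qed
qed

lemma coset_scale: "{(\<lambda>i. r * x i + w i) | x w. x \<in> column_coset \<phi> m v \<and> w \<in> column_span \<phi> m} =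
    column_coset \<phi> m (\<lambda>i. r * v i)" (is "?L = ?R")
proof
  show "?L \<subseteq> ?R"
  proof
    fix z assume "z \<in> ?L"
    then obtain a b where ab: "z = (\<lambda>i. r * (v i + a i) + b i)" "a \<in> column_span \<phi> m" "b \<in> column_span \<phi> m"
      unfolding column_coset_def by auto
    have "z = (\<lambda>i. r * v i + ((\<lambda>i. r * a i) i + b i))" unfolding ab(1) by (simp add: distrib_left add.assoc)
    thus "z \<in> ?R" by (rule column_cosetI[OF column_span_add[OF column_span_scale[OF ab(2), of r] ab(3)]])
  qed
  show "?R \<subseteq> ?L"
  proof
    fix z assume "z \<in> ?R"
    then obtain a where a: "z = (\<lambda>i. r * v i + a i)" "a \<in> column_span \<phi> m"
      unfolding column_coset_def by auto
    thus "z \<in> ?L" by (intro CollectI exI[of _ v] exI[of _ a] conjI coset_mem)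
  qed
qed

lemma coset_eq_0:
  assumes "v \<in> column_span \<phi> m"
  shows "column_coset \<phi> m v = column_coset \<phi> m (\<lambda>_. 0)"
proof -
  have "z \<in> column_coset \<phi> m (\<lambda>_. 0)" if "z \<in> column_coset \<phi> m v" for z
  proof -
    obtain w where "w \<in> column_span \<phi> m" "z = (\<lambda>i. v i + w i)"
      using \<open>z \<in> column_coset \<phi> m v\<close> unfolding column_coset_def by blast
    thus ?thesis using column_span_add[OF assms] by (intro column_cosetI[of z]) simp_all
  qed
  moreover have "z \<in> column_coset \<phi> m v" if "z \<in> column_coset \<phi> m (\<lambda>_. 0)" for z
  proof -
    obtain w where "w \<in> column_span \<phi> m" "z = (\<lambda>i. 0 + w i)"
      using \<open>z \<in> column_coset \<phi> m (\<lambda>_. 0)\<close> unfolding column_coset_def by blast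
    thus ?thesis using column_span_add[OF _ column_span_scale[OF assms, of "- 1"]]
      by (intro column_cosetI[of "\<lambda>i. w i + - 1 * v i"]) auto
  qed
  ultimately show ?thesis by blast
qed

text \<open>Let \<open>E\<close> be the cokernel. The matrix \<open>\<Psi>\<close> contains the images of the standard generators
  under \<open>E \<rightarrow> E\<^sup>*\<^sup>*\<close> followed by the given isomorphism. Linear forms on \<open>E\<close> are the
  rows \<open>y\<close> orthogonal to the columns of \<open>\<phi>\<close>. Each of them extends to \<open>E\<^sup>*\<^sup>*\<close>
  by evaluation, and reading this extension in the coordinates of the free module gives \<open>u\<close>. An element of
  \<open>R\<^sup>n\<close> that \<open>\<Psi>\<close> maps to zero is zero in \<open>E\<^sup>*\<^sup>*\<close>, which means that all
  linear forms vanish on it.\<close>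

theorem double_dual_coordinates:
  fixes \<phi> :: "'v::finite \<Rightarrow> nat \<Rightarrow> 'k::field bipoly"
  assumes iso: "graded_iso (dual (dual (coker \<phi> m))) (twisted_free s \<sigma>)"
  shows "\<exists>\<Psi> :: 'v \<Rightarrow> nat \<Rightarrow> 'k bipoly.
    (\<forall>v. \<forall>k\<in>{1..s}. \<Psi> v k \<in> homog (\<sigma> k)) \<and>
    (\<forall>j\<in>{1..m}. \<forall>k\<in>{1..s}. (\<Sum>v\<in>UNIV. \<Psi> v k * \<phi> v j) = 0) \<and>
    (\<forall>y. (\<forall>j\<in>{1..m}. (\<Sum>v\<in>UNIV. y v * \<phi> v j) = 0) \<longrightarrow>
      (\<exists>u. (\<forall>v. y v = (\<Sum>k=1..s. \<Psi> v k * u k)) \<and>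
         (\<forall>l. (\<forall>v. y v \<in> homog l) \<longrightarrow> (\<forall>k\<in>{1..s}. u k \<in> homog (l - \<sigma> k))))) \<and>
    (\<forall>r y. (\<forall>k\<in>{1..s}. (\<Sum>v\<in>UNIV. r v * \<Psi> v k) = 0) \<longrightarrow>
      (\<forall>j\<in>{1..m}. (\<Sum>v\<in>UNIV. y v * \<phi> v j) = 0) \<longrightarrow> (\<Sum>v\<in>UNIV. y v * r v) = 0)"
proof -
  define Mo where "Mo = coker \<phi> m"
  define cos where "cos = column_coset \<phi> m"
  define DD where "DD = dual (dual Mo)"
  have Mo: "gcarrier Mo = range cos" "gadd Mo (cos v) (cos w) = cos (\<lambda>i. v i + w i)"
    "gscale Mo r (cos v) = cos (\<lambda>i. r * v i)" "gcomp Mo k = cos ` {v. \<forall>i. v i \<in> homog k}" for v w r k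
    unfolding Mo_def coker_def cos_def gmod.simps coset_add coset_scale by (rule refl)+
  have cosM: "cos v \<in> gcarrier Mo" for v by (simp add: Mo)
  have h_add: "h (cos (\<lambda>i. v i + w i)) = h (cos v) + h (cos w)"
    and h_scale: "h (cos (\<lambda>i. r * v i)) = r * h (cos v)" if "h \<in> dual_carrier Mo" for h v w r
    using that cosM unfolding dual_carrier_def Mo(2,3)[symmetric] by blast+
  define ev where "ev v = (\<lambda>h. if h \<in> dual_carrier Mo then h (cos v) else 0)" for v
  have dM: "gcarrier (dual Mo) = dual_carrier Mo" "gadd (dual Mo) h h' = (\<lambda>x. h x + h' x)"
    "gscale (dual Mo) r h = (\<lambda>x. r * h x)"
    "gcomp (dual Mo) k = {h \<in> dual_carrier Mo. \<forall>l. \<forall>x\<in>gcomp Mo l. h x \<in> homog (l + k)}" for h h' r k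
    unfolding dual_def by simp_all
  have DDs: "gcarrier DD = dual_carrier (dual Mo)" "gadd DD \<xi> \<xi>' = (\<lambda>x. \<xi> x + \<xi>' x)"
    "gscale DD r \<xi> = (\<lambda>x. r * \<xi> x)"
    "gcomp DD k = {\<xi> \<in> dual_carrier (dual Mo). \<forall>l. \<forall>h\<in>gcomp (dual Mo) l. \<xi> h \<in> homog (l + k)}" for \<xi> \<xi>' r k
    unfolding DD_def by (subst dual_def, simp)+
  have dc_add: "(\<lambda>x. h x + h' x) \<in> dual_carrier Mo" if "h \<in> dual_carrier Mo" "h' \<in> dual_carrier Mo" for h h'
    using that unfolding dual_carrier_def by (auto simp: distrib_left)
  have dc_scale: "(\<lambda>x. r * h x) \<in> dual_carrier Mo" if "h \<in> dual_carrier Mo" for h r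
    using that unfolding dual_carrier_def by (auto simp: distrib_left)
  have ev_DD: "ev v \<in> gcarrier DD" for v
    unfolding DDs(1) dual_carrier_def[of "dual Mo"] dM ev_def using dc_add dc_scale by simp
  have ev_add: "ev (\<lambda>i. v i + w i) = gadd DD (ev v) (ev w)" for v w
    unfolding DDs ev_def using h_add by (intro ext) simp
  have ev_scale: "ev (\<lambda>i. r * v i) = gscale DD r (ev v)" for v r
    unfolding DDs ev_def using h_scale by (intro ext) simp
  have ev_comp: "ev v \<in> gcomp DD k" if "\<And>i. v i \<in> homog k" for v k
  proof -
    have "ev v h \<in> homog (l + k)" if h: "h \<in> gcomp (dual Mo) l" for h l
    proof -
      have "cos v \<in> gcomp Mo k" unfolding Mo using \<open>\<And>i. v i \<in> homog k\<close> by blast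
      hence "h (cos v) \<in> homog (k + l)" "h \<in> dual_carrier Mo" using h unfolding dM by auto
      thus ?thesis unfolding ev_def by (simp add: add.commute)
    qed
    thus ?thesis using ev_DD[of v] unfolding DDs by blast
  qed
  have DD_add: "gadd DD \<xi> \<xi>' \<in> gcarrier DD" if "\<xi> \<in> gcarrier DD" "\<xi>' \<in> gcarrier DD" for \<xi> \<xi>'
    using that unfolding DDs dual_carrier_def[of "dual Mo"] by (auto simp: distrib_left)
  have DD_scale: "gscale DD r \<xi> \<in> gcarrier DD" if "\<xi> \<in> gcarrier DD" for \<xi> r
    using that unfolding DDs dual_carrier_def[of "dual Mo"] by (auto simp: distrib_left)
  define TF where "TF = (twisted_free s \<sigma> :: ('k bipoly, nat \<Rightarrow> 'k bipoly) gmod)"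
  have TF: "gcarrier TF = {v. \<forall>i. i \<notin> {1..s} \<longrightarrow> v i = 0}" "gadd TF v w = (\<lambda>i. v i + w i)"
    "gscale TF r v = (\<lambda>i. r * v i)"
    "gcomp TF k = {v. (\<forall>i. i \<notin> {1..s} \<longrightarrow> v i = 0) \<and> (\<forall>i\<in>{1..s}. v i \<in> homog (\<sigma> i + k))}" for v w r k
    unfolding TF_def twisted_free_def by simp_all
  have "graded_iso DD TF" using iso unfolding DD_def Mo_def TF_def .
  then obtain \<psi> where iso': "bij_betw \<psi> (gcarrier DD) (gcarrier TF) \<and>
     (\<forall>x\<in>gcarrier DD. \<forall>y\<in>gcarrier DD. \<psi> (gadd DD x y) = gadd TF (\<psi> x) (\<psi> y)) \<and>
     (\<forall>r. \<forall>x\<in>gcarrier DD. \<psi> (gscale DD r x) = gscale TF r (\<psi> x)) \<and>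
     (\<forall>k. \<psi> ` gcomp DD k = gcomp TF k)"
    unfolding graded_iso_def by (elim exE)
  have \<psi>: "bij_betw \<psi> (gcarrier DD) (gcarrier TF)"
    "\<And>x y. x \<in> gcarrier DD \<Longrightarrow> y \<in> gcarrier DD \<Longrightarrow> \<psi> (gadd DD x y) = gadd TF (\<psi> x) (\<psi> y)"
    "\<And>r x. x \<in> gcarrier DD \<Longrightarrow> \<psi> (gscale DD r x) = gscale TF r (\<psi> x)"
    "\<And>k. \<psi> ` gcomp DD k = gcomp TF k"
    using iso' by (elim conjE; simp)+
  define \<Psi> where "\<Psi> v k = \<psi> (ev (unit_vec v)) k" for v k
  have \<psi>_ev: "\<psi> (ev w) k = (\<Sum>v\<in>UNIV. w v * \<Psi> v k)" for w k
    unfolding \<Psi>_def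
  proof (rule linear_expansion[where L = "\<lambda>w. \<psi> (ev w) k"])
    show "\<psi> (ev (\<lambda>i. v i + w i)) k = \<psi> (ev v) k + \<psi> (ev w) k" for v w
      unfolding ev_add \<psi>(2)[OF ev_DD ev_DD] TF ..
    show "\<psi> (ev (\<lambda>i. r * v i)) k = r * \<psi> (ev v) k" for r v
      unfolding ev_scale \<psi>(3)[OF ev_DD] TF ..
  qed
  have \<Psi>_homog: "\<Psi> v k \<in> homog (\<sigma> k)" if k: "k \<in> {1..s}" for v k
  proof -
    have "\<psi> (ev (unit_vec v)) \<in> gcomp TF 0"
      unfolding \<psi>(4)[symmetric] by (intro imageI ev_comp) (simp add: unit_vec_def)
    thus ?thesis unfolding \<Psi>_def TF using k by auto
  qed
  have cos_0: "cos v = cos (\<lambda>_. 0)" if "v \<in> column_span \<phi> m" for v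
    unfolding cos_def using coset_eq_0[OF that] .
  have \<Psi>_phi: "(\<Sum>v\<in>UNIV. \<Psi> v k * \<phi> v j) = 0" if j: "j \<in> {1..m}" for j k
  proof -
    have "ev (\<lambda>v. \<phi> v j) = ev (\<lambda>_. 0)" unfolding ev_def cos_0[OF column_in_span[OF j]] ..
    hence "\<psi> (ev (\<lambda>v. \<phi> v j)) k = 0" using \<psi>_ev[of "\<lambda>_. 0" k] by simp
    thus ?thesis unfolding \<psi>_ev by (simp add: mult.commute)
  qed
  \<comment> \<open>the linear form on the cokernel given by a row \<open>y\<close> orthogonal to the columns\<close>
  define hy where "hy y X = (if X \<in> range cos then \<Sum>v\<in>UNIV. y v * (SOME x. X = cos x) v else 0)" for y X
  have hy: "hy y (cos w) = (\<Sum>v\<in>UNIV. y v * w v)" if y: "\<forall>j\<in>{1..m}. (\<Sum>v\<in>UNIV. y v * \<phi> v j) = 0" for y w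
  proof -
    define x where "x = (SOME x. cos w = cos x)"
    have x: "cos w = cos x" unfolding x_def by (rule someI[of "\<lambda>x. cos w = cos x" w]) (rule refl)
    hence "x \<in> cos w" unfolding cos_def using coset_mem by auto
    then obtain c where c: "x = (\<lambda>i. w i + (\<Sum>j=1..m. \<phi> i j * c j))"
      unfolding cos_def column_coset_def column_span_def by blast
    have "(\<Sum>v\<in>UNIV. y v * (\<Sum>j=1..m. \<phi> v j * c j)) = (\<Sum>j=1..m. (\<Sum>v\<in>UNIV. y v * \<phi> v j) * c j)"
      unfolding sum_distrib_left sum_distrib_right by (subst sum.swap) (simp only: mult.assoc)
    also have "\<dots> = 0" using y by simp
    finally have "(\<Sum>v\<in>UNIV. y v * x v) = (\<Sum>v\<in>UNIV. y v * w v)"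
      unfolding c by (simp add: distrib_left sum.distrib)
    thus ?thesis unfolding hy_def x_def by simp
  qed
  have hy_dual: "hy y \<in> dual_carrier Mo" if y: "\<forall>j\<in>{1..m}. (\<Sum>v\<in>UNIV. y v * \<phi> v j) = 0" for y
    unfolding dual_carrier_def Mo(1)
  proof (intro CollectI conjI allI impI ballI)
    show "hy y X = 0" if "X \<notin> range cos" for X using that unfolding hy_def by simp
    show "hy y (gadd Mo X Y) = hy y X + hy y Y" if XY: "X \<in> range cos" "Y \<in> range cos" for X Y
    proof -
      obtain v w where "X = cos v" "Y = cos w" using XY by blast
      thus ?thesis by (simp add: Mo hy[OF y] distrib_left sum.distrib)
    qed
    show "hy y (gscale Mo r X) = r * hy y X" if X: "X \<in> range cos" for r X
    proof -
      obtain v where v: "X = cos v" using X by blast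
      show ?thesis unfolding v Mo(3) hy[OF y] sum_distrib_left by (simp only: mult.left_commute)
    qed
  qed
  have preimage: "\<exists>u. (\<forall>v. y v = (\<Sum>k=1..s. \<Psi> v k * u k)) \<and>
         (\<forall>l. (\<forall>v. y v \<in> homog l) \<longrightarrow> (\<forall>k\<in>{1..s}. u k \<in> homog (l - \<sigma> k)))"
    if y: "\<forall>j\<in>{1..m}. (\<Sum>v\<in>UNIV. y v * \<phi> v j) = 0" for y
  proof -
    define \<chi> where "\<chi> = inv_into (gcarrier DD) \<psi>"
    have \<chi>1: "\<chi> (\<psi> \<xi>) = \<xi>" if "\<xi> \<in> gcarrier DD" for \<xi>
      unfolding \<chi>_def using \<psi>(1) that by (simp add: bij_betw_def)
    have \<chi>2: "\<psi> (\<chi> w) = w" "\<chi> w \<in> gcarrier DD" if "w \<in> gcarrier TF" for w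
      unfolding \<chi>_def
      using bij_betw_inv_into_right[OF \<psi>(1) that] bij_betwE[OF bij_betw_inv_into[OF \<psi>(1)]] that by blast+
    have \<chi>_add: "\<chi> (gadd TF w w') = gadd DD (\<chi> w) (\<chi> w')" if "w \<in> gcarrier TF" "w' \<in> gcarrier TF" for w w'
      using \<chi>1[OF DD_add[OF \<chi>2(2)[OF that(1)] \<chi>2(2)[OF that(2)]]] \<psi>(2)[OF \<chi>2(2)[OF that(1)] \<chi>2(2)[OF that(2)]]
        \<chi>2(1)[OF that(1)] \<chi>2(1)[OF that(2)] by simp
    have \<chi>_scale: "\<chi> (gscale TF r w) = gscale DD r (\<chi> w)" if "w \<in> gcarrier TF" for w r
      using \<chi>1[OF DD_scale[OF \<chi>2(2)[OF that]]] \<psi>(3)[OF \<chi>2(2)[OF that]] \<chi>2(1)[OF that] by simp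
    define u where "u k = \<chi> (unit_vec k) (hy y)" for k
    have uv: "unit_vec k \<in> gcarrier TF" if "k \<in> {1..s}" for k
      using that unfolding TF unit_vec_def by auto
    have expand: "\<chi> (\<lambda>i. if i \<in> F then w i else 0) (hy y) = (\<Sum>k\<in>F. w k * u k)" if F: "F \<subseteq> {1..s}" for F w
      using finite_subset[OF F finite_atLeastAtMost] F
    proof (induction F rule: finite_induct)
      case empty
      have z: "(\<lambda>i. 0) \<in> gcarrier TF" unfolding TF by simp
      have "(\<lambda>i. 0) = gscale TF 0 (\<lambda>i. 0)" unfolding TF by simp
      hence "\<chi> (\<lambda>i. 0) (hy y) = 0" using \<chi>_scale[OF z, of 0] by (simp add: DDs)
      thus ?case by simp
    next
      case (insert k F)
      have 1: "(\<lambda>j. w k * unit_vec k j) \<in> gcarrier TF" "(\<lambda>i. if i \<in> F then w i else 0) \<in> gcarrier TF"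
        using insert(4) unfolding TF unit_vec_def by auto
      have "(\<lambda>i. if i \<in> insert k F then w i else 0) =
          gadd TF (\<lambda>j. w k * unit_vec k j) (\<lambda>i. if i \<in> F then w i else 0)"
        using insert(2) unfolding TF by (auto simp: unit_vec_def)
      hence "\<chi> (\<lambda>i. if i \<in> insert k F then w i else 0) (hy y) =
          \<chi> (\<lambda>j. w k * unit_vec k j) (hy y) + \<chi> (\<lambda>i. if i \<in> F then w i else 0) (hy y)"
        using \<chi>_add[OF 1] by (simp add: DDs)
      moreover have "\<chi> (\<lambda>j. w k * unit_vec k j) (hy y) = w k * u k"
        using \<chi>_scale[OF uv, of k "w k"] insert(4) by (simp add: TF DDs u_def)
      ultimately show ?case using insert by simp
    qed
    have "y v = (\<Sum>k=1..s. \<Psi> v k * u k)" for v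
    proof -
      have "\<psi> (ev (unit_vec v)) \<in> gcarrier TF" using \<psi>(1) ev_DD unfolding bij_betw_def by blast
      hence eq: "(\<lambda>i. if i \<in> {1..s} then \<Psi> v i else 0) = \<psi> (ev (unit_vec v))"
        unfolding TF \<Psi>_def by auto
      have "(\<Sum>k=1..s. \<Psi> v k * u k) = \<chi> (\<psi> (ev (unit_vec v))) (hy y)"
        using expand[of "{1..s}" "\<Psi> v"] unfolding eq by simp
      also have "\<dots> = ev (unit_vec v) (hy y)" using \<chi>1[OF ev_DD] by simp
      also have "\<dots> = y v" using hy_dual[OF y] hy[OF y, of "unit_vec v"]
        unfolding ev_def by (simp add: unit_vec_def if_distrib[of "\<lambda>x. _ * x"] cong: if_cong)
      finally show ?thesis by simp
    qed
    moreover have "u k \<in> homog (l - \<sigma> k)" if l: "\<forall>v. y v \<in> homog l" and k: "k \<in> {1..s}" for l k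
    proof -
      have "unit_vec k \<in> gcomp TF (- \<sigma> k)" using k unfolding TF unit_vec_def by auto
      then obtain \<xi> where \<xi>: "\<xi> \<in> gcomp DD (- \<sigma> k)" "unit_vec k = \<psi> \<xi>" unfolding \<psi>(4)[symmetric] by blast
      have "\<xi> \<in> gcarrier DD" using \<xi>(1) unfolding DDs by blast
      hence u: "u k = \<xi> (hy y)" unfolding u_def \<xi>(2) by (simp add: \<chi>1)
      have "hy y X \<in> homog (l' + l)" if X: "X \<in> gcomp Mo l'" for l' X
      proof -
        obtain w where w: "X = cos w" "\<forall>i. w i \<in> homog l'" using X unfolding Mo by blast
        have "y i * w i \<in> homog (l' + l)" for i using l w(2) by (intro homog_mult'[of "y i" l]) auto
        thus ?thesis unfolding w(1) hy[OF y] by (intro homog_sum)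
      qed
      hence "hy y \<in> gcomp (dual Mo) l" unfolding dM using hy_dual[OF y] by blast
      hence "\<xi> (hy y) \<in> homog (l + - \<sigma> k)" using \<xi>(1) unfolding DDs by blast
      thus ?thesis unfolding u by simp
    qed
    ultimately show ?thesis by blast
  qed
  have kernel: "(\<Sum>v\<in>UNIV. y v * r v) = 0"
    if r: "\<forall>k\<in>{1..s}. (\<Sum>v\<in>UNIV. r v * \<Psi> v k) = 0" and y: "\<forall>j\<in>{1..m}. (\<Sum>v\<in>UNIV. y v * \<phi> v j) = 0" for r y
  proof -
    have "\<psi> (ev w) \<in> gcarrier TF" for w using \<psi>(1) ev_DD unfolding bij_betw_def by blast
    hence "\<psi> (ev w) k = 0" if "k \<notin> {1..s}" for w k using that unfolding TF by blast
    hence "\<psi> (ev r) k = \<psi> (ev (\<lambda>_. 0)) k" for k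
      using r unfolding \<psi>_ev by (cases "k \<in> {1..s}") auto
    hence "\<psi> (ev r) = \<psi> (ev (\<lambda>_. 0))" by blast
    hence "ev r = ev (\<lambda>_. 0)" using \<psi>(1) ev_DD unfolding bij_betw_def inj_on_def by blast
    hence "ev r (hy y) = ev (\<lambda>_. 0) (hy y)" by simp
    thus ?thesis unfolding ev_def using hy_dual[OF y] hy[OF y] by simp
  qed
  have "(\<forall>v. \<forall>k\<in>{1..s}. \<Psi> v k \<in> homog (\<sigma> k)) \<and>
    (\<forall>j\<in>{1..m}. \<forall>k\<in>{1..s}. (\<Sum>v\<in>UNIV. \<Psi> v k * \<phi> v j) = 0)"
    using \<Psi>_homog \<Psi>_phi by blast
  thus ?thesis using preimage kernel by (intro exI[of _ \<Psi>] conjI allI impI) blast+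
qed

lemma common_denominator:
  fixes c :: "'j \<Rightarrow> 'r::idom fract"
  assumes "finite J"
  shows "\<exists>b e. b \<noteq> 0 \<and> (\<forall>j\<in>J. to_fract b * c j = to_fract (e j))"
  using assms
proof (induction J rule: finite_induct)
  case empty
  show ?case by (intro exI[of _ 1]) simp
next
  case (insert k J)
  then obtain b e where be: "b \<noteq> 0" "\<forall>j\<in>J. to_fract b * c j = to_fract (e j)" by blast
  obtain p q where pq: "c k = Fract p q" "q \<noteq> 0" by (cases "c k") auto
  have qk: "to_fract q * c k = to_fract p"
    unfolding pq(1) to_fract_def mult_fract using pq(2) by (simp add: eq_fract)
  define e' where "e' j = (if j = k then b * p else q * e j)" for j
  have "to_fract (q * b) * c j = to_fract (e' j)" if "j \<in> insert k J" for j
  proof (cases "j = k")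
    case True
    have "to_fract (q * b) * c k = to_fract b * (to_fract q * c k)" unfolding to_fract_mult by (simp only: mult_ac)
    thus ?thesis using True by (simp add: qk e'_def)
  next
    case False
    have "to_fract (q * b) * c j = to_fract q * (to_fract b * c j)" unfolding to_fract_mult by (simp only: mult_ac)
    thus ?thesis using False that be(2) by (simp add: e'_def)
  qed
  thus ?case using pq(2) be(1) by (intro exI[of _ "q * b"] exI[of _ e']) simp
qed

text \<open>Over the fraction field, a vector outside the column space is separated from it by a linear form, and clearing
  denominators produces a row \<open>y\<close>. So \<open>r\<close> lies in the column space over the fraction field, and again
  after clearing denominators a nonzero multiple of \<open>r\<close> lies in the column span over \<open>R\<close>.\<close>

theorem torsionless_if_torsionfree:
  fixes \<phi> :: "'v::finite \<Rightarrow> nat \<Rightarrow> 'k::field bipoly"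
  assumes torsionfree: "\<And>c r. c \<noteq> 0 \<Longrightarrow> (\<lambda>v. c * r v) \<in> column_span \<phi> m \<Longrightarrow> r \<in> column_span \<phi> m"
    and orth: "\<And>y. \<forall>j\<in>{1..m}. (\<Sum>v\<in>UNIV. y v * \<phi> v j) = 0 \<Longrightarrow> (\<Sum>v\<in>UNIV. y v * r v) = 0"
  shows "r \<in> column_span \<phi> m"
proof -
  define sc where "sc c w = (\<lambda>v. c * w v)" for c and w :: "'v \<Rightarrow> 'k bipoly fract"
  interpret V: vector_space sc 
    by unfold_locales (simp_all only: sc_def fun_eq_iff plus_fun_apply distrib_left distrib_right mult.assoc mult_1_left simp_thms)
  interpret W: vector_space "times :: 'k bipoly fract \<Rightarrow> _ \<Rightarrow> _"
    by unfold_locales (simp_all only: distrib_left distrib_right mult.assoc mult_1_left simp_thms)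
  interpret VW: vector_space_pair sc "times :: 'k bipoly fract \<Rightarrow> _ \<Rightarrow> _" ..
  define col where "col j = (\<lambda>v. to_fract (\<phi> v j))" for j
  define S where "S = col ` {1..m}"
  define rr where "rr = (\<lambda>v. to_fract (r v))"
  have inspan: "rr \<in> V.span S"
  proof (rule ccontr)
    assume notin: "rr \<notin> V.span S"
    obtain B0 where B0: "B0 \<subseteq> S" "V.independent B0" "S \<subseteq> V.span B0"
      using V.maximal_independent_subset[of S] by auto
    have "rr \<notin> V.span B0" using notin V.span_mono[OF B0(1)] by blast
    hence ind: "V.independent (insert rr B0)" using B0(2) by (rule V.independent_insertI)
    have rrB: "rr \<notin> B0" using \<open>rr \<notin> V.span B0\<close> V.span_base by blast
    obtain L where L: "Vector_Spaces.linear sc times L" "\<forall>x\<in>insert rr B0. L x = (if x = rr then 1 else 0)"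
      using VW.linear_independent_extend[OF ind, of "\<lambda>x. if x = rr then 1 else 0"] by blast
    interpret L: Vector_Spaces.linear sc times L by fact
    have "V.span B0 \<subseteq> {x. L x = 0}"
      using L(2) rrB by (intro V.span_minimal L.subspace_kernel) auto
    hence LS: "L x = 0" if "x \<in> S" for x using that B0(3) by blast
    have exp: "L w = (\<Sum>v\<in>UNIV. w v * L (unit_vec v))" for w
    proof (rule linear_expansion)
      show "L (\<lambda>i. v i + w i) = L v + L w" for v w
        using L.add[of v w] by (simp add: plus_fun_def)
      show "L (\<lambda>i. c * v i) = c * L v" for c v using L.scale[of c v] unfolding sc_def .
    qed
    obtain b y where yb: "b \<noteq> 0" "\<And>v. to_fract b * L (unit_vec v) = to_fract (y v)"
      using common_denominator[of UNIV "\<lambda>v. L (unit_vec v)"] by auto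
    have Ly: "to_fract (\<Sum>v\<in>UNIV. y v * w v) = to_fract b * L (\<lambda>v. to_fract (w v))" for w
    proof -
      have "to_fract b * L (\<lambda>v. to_fract (w v)) = (\<Sum>v\<in>UNIV. to_fract (w v) * (to_fract b * L (unit_vec v)))"
        unfolding exp[of "\<lambda>v. to_fract (w v)"] sum_distrib_left by (simp only: mult.left_commute)
      thus ?thesis unfolding yb(2) to_fract_sum to_fract_mult by (simp only: mult.commute)
    qed
    have "(\<Sum>v\<in>UNIV. y v * \<phi> v j) = 0" if "j \<in> {1..m}" for j
    proof -
      have "L (\<lambda>v. to_fract (\<phi> v j)) = 0" using LS[of "col j"] that unfolding S_def col_def by blast
      hence "to_fract (\<Sum>v\<in>UNIV. y v * \<phi> v j) = 0" unfolding Ly by simp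
      thus ?thesis by (simp only: to_fract_eq_0_iff)
    qed
    hence "(\<Sum>v\<in>UNIV. y v * r v) = 0" using orth by blast
    moreover have "L rr = 1" using L(2) by simp
    ultimately have "to_fract b = 0" using Ly[of r] unfolding rr_def by simp
    thus False using yb(1) by simp
  qed
  have "V.span S \<subseteq> {w. \<exists>c. w = (\<lambda>v. \<Sum>j=1..m. to_fract (\<phi> v j) * c j)}" (is "_ \<subseteq> ?T")
  proof (rule V.span_minimal)
    show "V.subspace ?T"
    proof (rule V.subspaceI)
      show "0 \<in> ?T" by (intro CollectI exI[of _ "\<lambda>_. 0"]) auto
      show "x + y \<in> ?T" if xy: "x \<in> ?T" "y \<in> ?T" for x y
      proof -
        obtain c e where "x = (\<lambda>v. \<Sum>j=1..m. to_fract (\<phi> v j) * c j)" "y = (\<lambda>v. \<Sum>j=1..m. to_fract (\<phi> v j) * e j)"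
          using xy by blast
        thus ?thesis by (intro CollectI exI[of _ "\<lambda>j. c j + e j"]) (auto simp: distrib_left sum.distrib)
      qed
      show "sc a x \<in> ?T" if x: "x \<in> ?T" for a x
      proof -
        obtain c where c: "x = (\<lambda>v. \<Sum>j=1..m. to_fract (\<phi> v j) * c j)" using x by blast
        have "sc a x = (\<lambda>v. \<Sum>j=1..m. to_fract (\<phi> v j) * (a * c j))"
          unfolding c sc_def sum_distrib_left by (simp only: mult.left_commute)
        thus ?thesis by (intro CollectI exI[of _ "\<lambda>j. a * c j"])
      qed
    qed
    show "S \<subseteq> ?T"
    proof
      fix x assume "x \<in> S"
      then obtain j where "j \<in> {1..m}" "x = col j" unfolding S_def by blast
      thus "x \<in> ?T" unfolding col_def
        by (intro CollectI exI[of _ "\<lambda>k. if k = j then 1 else 0"])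
           (simp add: if_distrib[of "\<lambda>x. _ * x"] cong: if_cong)
    qed
  qed
  hence "rr \<in> ?T" using inspan by blast
  then obtain c where "rr = (\<lambda>v. \<Sum>j=1..m. to_fract (\<phi> v j) * c j)" by blast
  hence c: "to_fract (r v) = (\<Sum>j=1..m. to_fract (\<phi> v j) * c j)" for v
    unfolding rr_def by (rule fun_cong)
  obtain b e where be: "b \<noteq> 0" "\<And>j. j \<in> {1..m} \<Longrightarrow> to_fract b * c j = to_fract (e j)"
    using common_denominator[of "{1..m}" c] by blast
  have "b * r v = (\<Sum>j=1..m. \<phi> v j * e j)" for v
  proof -
    have "to_fract (b * r v) = (\<Sum>j=1..m. to_fract (\<phi> v j) * (to_fract b * c j))"
      unfolding to_fract_mult c sum_distrib_left by (simp only: mult.left_commute)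
    also have "\<dots> = (\<Sum>j=1..m. to_fract (\<phi> v j) * to_fract (e j))" using be(2) by (intro sum.cong) auto
    also have "\<dots> = to_fract (\<Sum>j=1..m. \<phi> v j * e j)" by (simp add: to_fract_sum)
    finally show ?thesis by (simp only: to_fract_eq_iff)
  qed
  hence "(\<lambda>v. b * r v) \<in> column_span \<phi> m" by (intro column_spanI[where c = e] ext)
  thus ?thesis using torsionfree be(1) by blast
qed

section \<open>Hilbert functions of maps between graded free modules\<close>

definition fsc :: "'k::field \<Rightarrow> ('i \<Rightarrow> 'k bipoly) \<Rightarrow> 'i \<Rightarrow> 'k bipoly" where
  "fsc c w = (\<lambda>i. kc c * w i)"

interpretation fS: vector_space "fsc :: 'k::field \<Rightarrow> ('i \<Rightarrow> 'k bipoly) \<Rightarrow> 'i \<Rightarrow> 'k bipoly"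
  by unfold_locales
    (simp_all only: fsc_def fun_eq_iff plus_fun_apply distrib_left distrib_right kc_simps mult.assoc mult_1_left simp_thms)

interpretation fP: vector_space_pair "fsc :: 'k::field \<Rightarrow> ('i \<Rightarrow> 'k bipoly) \<Rightarrow> 'i \<Rightarrow> 'k bipoly"
  "fsc :: 'k::field \<Rightarrow> ('j \<Rightarrow> 'k bipoly) \<Rightarrow> 'j \<Rightarrow> 'k bipoly" ..

text \<open>A homogeneous component of the graded free module with basis \<open>S\<close>; coordinates outside \<open>S\<close>
  are zero, so that infinite index types may be used.\<close>

definition graded_piece :: "'i set \<Rightarrow> ('i \<Rightarrow> int) \<Rightarrow> ('i \<Rightarrow> 'k::field bipoly) set" where
  "graded_piece S p = {w. (\<forall>i. i \<notin> S \<longrightarrow> w i = 0) \<and> (\<forall>i\<in>S. w i \<in> homog (p i))}"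

definition monomial_vec :: "'i \<Rightarrow> nat \<Rightarrow> nat \<Rightarrow> 'i \<Rightarrow> 'k::field bipoly" where
  "monomial_vec i a b = (\<lambda>j. if j = i then monom (monom 1 a) b else 0)"

definition monomial_basis :: "'i set \<Rightarrow> ('i \<Rightarrow> int) \<Rightarrow> ('i \<Rightarrow> 'k::field bipoly) set" where
  "monomial_basis S p = (\<lambda>(i, a). monomial_vec i a (nat (p i) - a)) ` (SIGMA i:S. {a. int a \<le> p i})"

lemma cf_monomial_vec: "cf (monomial_vec i a b j) a' b' = (if j = i \<and> a' = a \<and> b' = b then 1 else 0)"
  by (auto simp: monomial_vec_def)

lemma subspace_graded_piece: "fS.subspace (graded_piece S p)"
  unfolding graded_piece_def
  by (rule fS.subspaceI) (auto simp: fsc_def intro: homog_add homog_kc_mult)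

lemma monomial_basis_subset: "(monomial_basis S p :: ('i \<Rightarrow> 'k::field bipoly) set) \<subseteq> graded_piece S p"
proof
  fix w :: "'i \<Rightarrow> 'k bipoly" assume "w \<in> monomial_basis S p"
  then obtain i a where ia: "i \<in> S" "int a \<le> p i" "w = monomial_vec i a (nat (p i) - a)"
    unfolding monomial_basis_def by auto
  have "monom (monom 1 a) (nat (p i) - a) \<in> (homog (p i) :: 'k bipoly set)"
    unfolding homog_def using ia(2) by auto
  thus "w \<in> graded_piece S p" using ia unfolding graded_piece_def monomial_vec_def by auto
qed

lemma finite_monomial_basis: "finite S \<Longrightarrow> finite (monomial_basis S p)"
  unfolding monomial_basis_def
proof (intro finite_imageI finite_SigmaI)
  fix i
  have "{a. int a \<le> p i} \<subseteq> {..nat (p i)}" by auto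
  thus "finite {a. int a \<le> p i}" using finite_subset by blast
qed

lemma card_monomial_basis:
  assumes "finite S"
  shows "card (monomial_basis S p :: ('i \<Rightarrow> 'k::field bipoly) set) = (\<Sum>i\<in>S. nat (p i + 1))"
proof -
  have inj: "inj_on (\<lambda>(i, a). monomial_vec i a (nat (p i) - a) :: 'i \<Rightarrow> 'k bipoly) (SIGMA i:S. {a. int a \<le> p i})"
  proof (rule inj_onI, clarsimp)
    fix i a j b
    assume eq: "monomial_vec i a (nat (p i) - a) = (monomial_vec j b (nat (p j) - b) :: 'i \<Rightarrow> 'k bipoly)"
    have "cf (monomial_vec j b (nat (p j) - b) i :: 'k bipoly) a (nat (p i) - a) = 1"
      unfolding eq[symmetric] by (simp add: cf_monomial_vec)
    thus "i = j \<and> a = b" by (simp add: cf_monomial_vec split: if_splits)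
  qed
  have c: "card {a. int a \<le> p i} = nat (p i + 1)" for i
  proof (cases "p i < 0")
    case True thus ?thesis by simp
  next
    case False
    hence "{a. int a \<le> p i} = {..nat (p i)}" by auto
    thus ?thesis using False by (simp add: nat_add_distrib)
  qed
  have f: "finite {a. int a \<le> p i}" for i
  proof -
    have "{a. int a \<le> p i} \<subseteq> {..nat (p i)}" by auto
    thus ?thesis using finite_subset by blast
  qed
  have "card (monomial_basis S p :: ('i \<Rightarrow> 'k bipoly) set) = card (SIGMA i:S. {a. int a \<le> p i})"
    unfolding monomial_basis_def by (rule card_image[OF inj])
  also have "\<dots> = (\<Sum>i\<in>S. card {a. int a \<le> p i})" using assms f by (intro card_SigmaI) auto
  finally show ?thesis unfolding c .
qed

lemma independent_monomial_basis: "fS.independent (monomial_basis S p :: ('i \<Rightarrow> 'k::field bipoly) set)"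
  unfolding fS.dependent_def
proof (rule notI, clarify)
  fix w :: "'i \<Rightarrow> 'k bipoly"
  assume w: "w \<in> monomial_basis S p" and mem: "w \<in> fS.span (monomial_basis S p - {w})"
  obtain i a where ia: "i \<in> S" "int a \<le> p i" "w = monomial_vec i a (nat (p i) - a)"
    using w unfolding monomial_basis_def by auto
  define Z where "Z = {v :: 'i \<Rightarrow> 'k bipoly. cf (v i) a (nat (p i) - a) = 0}"
  have "fS.subspace Z" unfolding Z_def by (rule fS.subspaceI) (auto simp: fsc_def cf_kc)
  moreover have "monomial_basis S p - {w} \<subseteq> Z"
  proof
    fix v assume v: "v \<in> monomial_basis S p - {w}"
    then obtain j b where jb: "v = monomial_vec j b (nat (p j) - b)" unfolding monomial_basis_def by auto
    have "\<not> (i = j \<and> a = b)" using v ia(3) jb by auto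
    thus "v \<in> Z" unfolding Z_def jb by (auto simp: cf_monomial_vec)
  qed
  ultimately have "w \<in> Z" using mem fS.span_minimal by blast
  thus False unfolding Z_def ia(3) by (simp add: cf_monomial_vec)
qed

lemma sum_fun_apply: "(sum g X) i = (\<Sum>x\<in>X. g x i)" for g :: "'a \<Rightarrow> 'i \<Rightarrow> 'b::comm_monoid_add"
  by (induction X rule: infinite_finite_induct) auto

lemma span_monomial_basis:
  assumes "finite S"
  shows "fS.span (monomial_basis S p :: ('i \<Rightarrow> 'k::field bipoly) set) = graded_piece S p"
proof (rule fS.span_subspace[OF monomial_basis_subset _ subspace_graded_piece])
  show "(graded_piece S p :: ('i \<Rightarrow> 'k bipoly) set) \<subseteq> fS.span (monomial_basis S p)"
  proof
    fix w :: "'i \<Rightarrow> 'k bipoly" assume w: "w \<in> graded_piece S p"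
    have "w = (\<Sum>i\<in>S. \<Sum>a\<le>nat (p i). if int a \<le> p i
        then fsc (cf (w i) a (nat (p i) - a)) (monomial_vec i a (nat (p i) - a)) else 0)" (is "_ = ?R")
    proof
      fix j
      have F: "(if int a \<le> p i then fsc (cf (w i) a (nat (p i) - a)) (monomial_vec i a (nat (p i) - a)) else 0) j
          = (if j = i then (if int a \<le> p i
            then kc (cf (w i) a (nat (p i) - a)) * monom (monom 1 a) (nat (p i) - a) else 0) else 0)" for i a
        by (simp add: fsc_def monomial_vec_def)
      have R: "?R j = (\<Sum>i\<in>S. if j = i then (\<Sum>a\<le>nat (p i). if int a \<le> p i
          then kc (cf (w i) a (nat (p i) - a)) * monom (monom 1 a) (nat (p i) - a) else 0) else 0)"
        unfolding sum_fun_apply F by (intro sum.cong refl) simp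
      show "w j = ?R j"
      proof (cases "j \<in> S")
        case False
        hence "?R j = 0" unfolding R by (intro sum.neutral) auto
        thus ?thesis using w False by (simp add: graded_piece_def)
      next
        case True
        have h: "w j \<in> homog (p j)" using w True unfolding graded_piece_def by blast
        have "?R j = (\<Sum>a\<le>nat (p j). if int a \<le> p j
          then kc (cf (w j) a (nat (p j) - a)) * monom (monom 1 a) (nat (p j) - a) else 0)"
          unfolding R using True assms by simp
        also have "\<dots> = w j"
        proof (rule bipoly_eqI)
          fix a' b'
          have "cf (\<Sum>a\<le>nat (p j). if int a \<le> p j
            then kc (cf (w j) a (nat (p j) - a)) * monom (monom 1 a) (nat (p j) - a) else 0) a' b' =
            (\<Sum>a\<le>nat (p j). if a = a' then (if int a' \<le> p j \<and> nat (p j) - a' = b' then cf (w j) a' b' else 0) else 0)"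
            unfolding coeff_sum by (intro sum.cong) (auto simp: cf_kc)
          also have "\<dots> = (if int a' \<le> p j \<and> nat (p j) - a' = b' then cf (w j) a' b' else 0)"
            by auto
          also have "\<dots> = cf (w j) a' b'" using homogD[OF h, of b' a'] by (cases "cf (w j) a' b' = 0") auto
          finally show "cf (\<Sum>a\<le>nat (p j). if int a \<le> p j
            then kc (cf (w j) a (nat (p j) - a)) * monom (monom 1 a) (nat (p j) - a) else 0) a' b' = cf (w j) a' b'" .
        qed
        finally show ?thesis by simp
      qed
    qed
    moreover have "?R \<in> fS.span (monomial_basis S p)"
    proof (intro fS.span_sum)
      fix i a assume i: "i \<in> S"
      show "(if int a \<le> p i then fsc (cf (w i) a (nat (p i) - a)) (monomial_vec i a (nat (p i) - a)) else 0)
          \<in> fS.span (monomial_basis S p)"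
      proof (cases "int a \<le> p i")
        case True
        hence "monomial_vec i a (nat (p i) - a) \<in> monomial_basis S p"
          unfolding monomial_basis_def using i by (intro image_eqI[of _ _ "(i, a)"]) auto
        hence "fsc (cf (w i) a (nat (p i) - a)) (monomial_vec i a (nat (p i) - a)) \<in> fS.span (monomial_basis S p)"
          by (intro fS.span_scale fS.span_base)
        thus ?thesis using True by simp
      qed (simp add: fS.span_zero)
    qed
    ultimately show "w \<in> fS.span (monomial_basis S p)" by simp
  qed
qed

definition matrix_map :: "'i set \<Rightarrow> 'j set \<Rightarrow> ('i \<Rightarrow> 'j \<Rightarrow> 'k::field bipoly) \<Rightarrow> ('i \<Rightarrow> 'k bipoly) \<Rightarrow> 'j \<Rightarrow> 'k bipoly" where
  "matrix_map T S M w = (\<lambda>k. if k \<in> S then \<Sum>i\<in>T. w i * M i k else 0)"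

lemma linear_matrix_map: "Vector_Spaces.linear fsc fsc (matrix_map T S M)"
proof unfold_locales
  show "matrix_map T S M (v + w) = matrix_map T S M v + matrix_map T S M w" for v w
    unfolding matrix_map_def by (rule ext) (simp add: distrib_right sum.distrib)
  show "matrix_map T S M (fsc c w) = fsc c (matrix_map T S M w)" for c w
  proof -
    have "(\<Sum>i\<in>T. kc c * w i * M i k) = kc c * (\<Sum>i\<in>T. w i * M i k)" for k
      unfolding sum_distrib_left by (simp only: mult.assoc)
    thus ?thesis unfolding matrix_map_def fsc_def by (intro ext) simp
  qed
qed

text \<open>The rank-nullity inequality in a fixed degree of a complex \<open>U \<rightarrow> T \<rightarrow> S\<close> of graded
  free modules that is exact in the middle. If it is an equality, the second map is onto in that degree, since rank-nullity leaves
  no room for a cokernel.\<close>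

lemma graded_rank_bound:
  fixes M :: "'i \<Rightarrow> 'j \<Rightarrow> 'k::field bipoly" and M' :: "'l \<Rightarrow> 'i \<Rightarrow> 'k bipoly"
  assumes fin: "finite T" "finite S" "finite U"
    and M: "\<And>i j. i \<in> T \<Longrightarrow> j \<in> S \<Longrightarrow> p i + M_deg i j = q j \<and> M i j \<in> homog (M_deg i j)"
    and ker: "\<And>w. w \<in> graded_piece T p \<Longrightarrow> matrix_map T S M w = 0 \<Longrightarrow> \<exists>c \<in> graded_piece U r. w = matrix_map U T M' c"
  shows "(\<Sum>i\<in>T. nat (p i + 1)) \<le> (\<Sum>i\<in>U. nat (r i + 1)) + (\<Sum>i\<in>S. nat (q i + 1))"
    and "(\<Sum>i\<in>T. nat (p i + 1)) = (\<Sum>i\<in>U. nat (r i + 1)) + (\<Sum>i\<in>S. nat (q i + 1)) \<Longrightarrow>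
      matrix_map T S M ` graded_piece T p = graded_piece S q"
proof -
  define f where "f = matrix_map T S M"
  have f_lin: "Vector_Spaces.linear fsc fsc f" unfolding f_def by (rule linear_matrix_map)
  interpret h: Vector_Spaces.linear fsc fsc "matrix_map U T M'" by (rule linear_matrix_map)
  define Kb where "Kb = matrix_map U T M' ` monomial_basis U r"
  have fK: "finite Kb" unfolding Kb_def using finite_monomial_basis[OF fin(3)] by (rule finite_imageI)
  have cK: "card Kb \<le> (\<Sum>i\<in>U. nat (r i + 1))"
    unfolding Kb_def
    using card_image_le[OF finite_monomial_basis[OF fin(3)], of "matrix_map U T M'" r]
    by (simp only: card_monomial_basis[OF fin(3)])
  have K: "{x \<in> graded_piece T p. f x = 0} \<subseteq> fS.span Kb"
  proof
    fix x assume "x \<in> {x \<in> graded_piece T p. f x = 0}"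
    then obtain c where "c \<in> graded_piece U r" "x = matrix_map U T M' c" using ker unfolding f_def by blast
    thus "x \<in> fS.span Kb" unfolding Kb_def h.span_image span_monomial_basis[OF fin(3)] by blast
  qed
  have L: "f ` graded_piece T p \<subseteq> fS.span (monomial_basis S q)"
    unfolding span_monomial_basis[OF fin(2)]
  proof
    fix y assume "y \<in> f ` graded_piece T p"
    then obtain w where w: "w \<in> graded_piece T p" "y = f w" by blast
    have "(\<Sum>i\<in>T. w i * M i j) \<in> homog (q j)" if "j \<in> S" for j
    proof (rule homog_sum)
      fix i assume i: "i \<in> T"
      have "w i \<in> homog (p i)" using w(1) i unfolding graded_piece_def by blast
      thus "w i * M i j \<in> homog (q j)" using M[OF i that] homog_mult[of "w i" "p i" "M i j" "M_deg i j"] by simp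
    qed
    thus "y \<in> graded_piece S q" unfolding graded_piece_def w(2) f_def matrix_map_def by simp
  qed
  note X = monomial_basis_subset[of T p] independent_monomial_basis[of T p]
  have "card (monomial_basis T p :: ('i \<Rightarrow> 'k bipoly) set) \<le> card Kb + card (monomial_basis S q :: ('j \<Rightarrow> 'k bipoly) set)"
    by (rule fP.independent_card_le_kernel_image[OF f_lin subspace_graded_piece K fK L
          finite_monomial_basis[OF fin(2)] X])
  thus "(\<Sum>i\<in>T. nat (p i + 1)) \<le> (\<Sum>i\<in>U. nat (r i + 1)) + (\<Sum>i\<in>S. nat (q i + 1))"
    using cK unfolding card_monomial_basis[OF fin(1)] card_monomial_basis[OF fin(2)] by linarith
  assume eq: "(\<Sum>i\<in>T. nat (p i + 1)) = (\<Sum>i\<in>U. nat (r i + 1)) + (\<Sum>i\<in>S. nat (q i + 1))"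
  have "f ` graded_piece T p = fS.span (monomial_basis S q)"
    by (rule fP.image_eq_if_card_ge[OF f_lin subspace_graded_piece K fK L
          finite_monomial_basis[OF fin(2)] X])
       (use cK eq in \<open>simp add: card_monomial_basis[OF fin(1)] card_monomial_basis[OF fin(2)]\<close>)
  thus "matrix_map T S M ` graded_piece T p = graded_piece S q"
    unfolding f_def span_monomial_basis[OF fin(2)] .
qed

section \<open>Comparing a resolution with its dual\<close>

lemma sum_1_2: "(\<Sum>k=1..(2::nat). F k) = F 1 + (F 2 :: 'a::comm_monoid_add)"
  by (simp add: numeral_2_eq_2)

lemma column_span_mono: "v \<in> column_span \<phi> m \<Longrightarrow> v \<in> column_span \<phi> (Suc m)"
proof -
  assume "v \<in> column_span \<phi> m"
  then obtain c where c: "v = (\<lambda>i. \<Sum>j=1..m. \<phi> i j * c j)" unfolding column_span_def by blast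
  have "(\<Sum>j=1..Suc m. \<phi> i j * (c(Suc m := 0)) j) = (\<Sum>j=1..m. \<phi> i j * c j)" for i
    by (auto intro: sum.cong)
  thus ?thesis unfolding c by (intro column_spanI[where c = "c(Suc m := 0)"]) simp
qed

text \<open>The resolution of \<open>I\<close> together with the free bidual of the cokernel of all columns but the last.\<close>

locale resolution =
  fixes f :: "'v::finite \<Rightarrow> 'k::field bipoly" and \<phi> :: "'v \<Rightarrow> nat \<Rightarrow> 'k bipoly"
    and m :: nat and d :: "nat \<Rightarrow> nat" and \<delta> :: int and \<sigma> :: "nat \<Rightarrow> int"
  assumes card: "CARD('v) = m + 2" and m_pos: "1 \<le> m"
    and d_pos: "\<And>j. j \<in> {1..Suc m} \<Longrightarrow> 1 \<le> d j"
    and d_mono: "\<And>i j. i \<in> {1..Suc m} \<Longrightarrow> j \<in> {1..Suc m} \<Longrightarrow> i \<le> j \<Longrightarrow> d i \<le> d j"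
    and f_homog: "\<And>v. f v \<in> homog \<delta>"
    and f_nonzero: "\<exists>v. f v \<noteq> 0"
    and res: "graded_resolution f \<phi> (Suc m) d"
    and iso: "graded_iso (dual (dual (coker \<phi> m))) (twisted_free 2 \<sigma>)"
    and sigma: "\<sigma> 2 \<ge> 0" "\<sigma> 1 \<ge> \<sigma> 2" "\<sigma> 1 > 0"
begin

lemma phi_homog: "j \<in> {1..Suc m} \<Longrightarrow> \<phi> v j \<in> homog (int (d j))"
  and phi_inj: "(\<And>v. (\<Sum>j=1..Suc m. \<phi> v j * c j) = 0) \<Longrightarrow> j \<in> {1..Suc m} \<Longrightarrow> c j = 0"
  and syzygies: "{a. (\<Sum>v\<in>UNIV. a v * f v) = 0} = column_span \<phi> (Suc m)"
  using res unfolding graded_resolution_def by blast+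

lemma f_phi: "j \<in> {1..Suc m} \<Longrightarrow> (\<Sum>v\<in>UNIV. f v * \<phi> v j) = 0"
  using column_in_span[of j "Suc m" \<phi>] unfolding syzygies[symmetric] by (simp add: mult.commute)

text \<open>If \<open>c r\<close> is a combination of the first \<open>m\<close> columns, then \<open>r\<close> is a syzygy, hence
  a combination of all columns, and the coefficient of the last one is annihilated by \<open>c\<close>.\<close>

lemma torsionfree:
  assumes c: "c \<noteq> 0" and cr: "(\<lambda>v. c * r v) \<in> column_span \<phi> m"
  shows "r \<in> column_span \<phi> m"
proof -
  obtain e where e: "(\<lambda>v. c * r v) = (\<lambda>v. \<Sum>j=1..m. \<phi> v j * e j)"
    using cr unfolding column_span_def by blast
  have "(\<Sum>v\<in>UNIV. c * r v * f v) = 0" using column_span_mono[OF cr] unfolding syzygies[symmetric] by simp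
  hence "c * (\<Sum>v\<in>UNIV. r v * f v) = 0" unfolding sum_distrib_left by (simp only: mult.assoc)
  hence "r \<in> column_span \<phi> (Suc m)" using c unfolding syzygies[symmetric] by simp
  then obtain e' where e': "r = (\<lambda>v. \<Sum>j=1..Suc m. \<phi> v j * e' j)" unfolding column_span_def by blast
  define h where "h = (\<lambda>j. c * e' j - (e(Suc m := 0)) j)"
  have "(\<Sum>j=1..Suc m. \<phi> v j * h j) = 0" for v
  proof -
    have "(\<Sum>j=1..Suc m. \<phi> v j * (c * e' j)) = c * r v"
      unfolding e' sum_distrib_left by (simp only: mult.left_commute)
    moreover have "(\<Sum>j=1..Suc m. \<phi> v j * (e(Suc m := 0)) j) = c * r v"
      using fun_cong[OF e, of v] by (auto intro: sum.cong)
    ultimately show ?thesis unfolding h_def right_diff_distrib sum_subtractf by simp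
  qed
  hence "h (Suc m) = 0" by (rule phi_inj) simp
  hence "e' (Suc m) = 0" using c unfolding h_def by simp
  hence "r = (\<lambda>v. \<Sum>j=1..m. \<phi> v j * e' j)" unfolding e' by simp
  thus ?thesis by (rule column_spanI)
qed

text \<open>Replacing the coefficients by their components of the right degree does not change the combination.\<close>

lemma graded_coefficients:
  assumes w: "w \<in> column_span \<phi> m" and h: "\<And>v. w v \<in> homog p"
  shows "\<exists>c \<in> graded_piece {1..m} (\<lambda>j. p - int (d j)). w = matrix_map {1..m} UNIV (\<lambda>j v. \<phi> v j) c"
proof -
  obtain c where c: "w = (\<lambda>v. \<Sum>j=1..m. \<phi> v j * c j)" using w unfolding column_span_def by blast
  define c' where "c' = (\<lambda>j. if j \<in> {1..m} then hcomp (p - int (d j)) (c j) else 0)"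
  have "w v = (\<Sum>j=1..m. c' j * \<phi> v j)" for v
  proof -
    have "w v = hcomp p (w v)" using h by (simp add: hcomp_id)
    also have "\<dots> = (\<Sum>j=1..m. hcomp p (\<phi> v j * c j))" unfolding c hcomp_sum ..
    also have "\<dots> = (\<Sum>j=1..m. \<phi> v j * c' j)"
      unfolding c'_def using phi_homog by (intro sum.cong) (auto simp: hcomp_mult)
    finally show ?thesis by (simp only: mult.commute)
  qed
  hence "w = matrix_map {1..m} UNIV (\<lambda>j v. \<phi> v j) c'" unfolding matrix_map_def by auto
  moreover have "c' \<in> graded_piece {1..m} (\<lambda>j. p - int (d j))" unfolding graded_piece_def c'_def by simp
  ultimately show ?thesis by blast
qed

text \<open>The complex \<open>\<Oplus> R(-d\<^sub>j) \<rightarrow> R\<^sup>n \<rightarrow> R(\<sigma> 1) \<oplus> R(\<sigma>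
  2)\<close> and its dual are exact at \<open>R\<^sup>n\<close>. In degree \<open>p \<ge> d m - 1\<close> the first one yields
  \<open>(m + 2)(p + 1) \<le> m(p + 1) - \<Sum> d\<^sub>j + 2(p + 1) + \<sigma> 1 + \<sigma> 2\<close>, because then all \<open>p -
  d\<^sub>j + 1\<close> are nonnegative and equal to dimensions; the dual one yields the opposite inequality between \<open>\<sigma>
  1 + \<sigma> 2\<close> and \<open>\<Sum> d\<^sub>j\<close> in every large degree. So equality holds in the first estimate for all
  \<open>p \<ge> d m - 1\<close>, which makes \<open>\<Psi>\<close> surjective in these degrees.\<close>

theorem rank_two_coordinates:
  shows "\<exists>\<Psi>1 \<Psi>2 u1 u2. rank_two f \<phi> m d \<delta> \<Psi>1 \<Psi>2 (\<sigma> 1) (\<sigma> 2) u1 u2"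
    and "\<sigma> 1 + \<sigma> 2 = (\<Sum>i=1..m. int (d i))"
proof -
  obtain \<Psi> :: "'v \<Rightarrow> nat \<Rightarrow> 'k bipoly" where
    P1: "\<forall>v. \<forall>k\<in>{1..2}. \<Psi> v k \<in> homog (\<sigma> k)" and
    P2: "\<forall>j\<in>{1..m}. \<forall>k\<in>{1..2}. (\<Sum>v\<in>UNIV. \<Psi> v k * \<phi> v j) = 0" and
    P3: "\<forall>y. (\<forall>j\<in>{1..m}. (\<Sum>v\<in>UNIV. y v * \<phi> v j) = 0) \<longrightarrow>
      (\<exists>u. (\<forall>v. y v = (\<Sum>k=1..2. \<Psi> v k * u k)) \<and>
         (\<forall>l. (\<forall>v. y v \<in> homog l) \<longrightarrow> (\<forall>k\<in>{1..2}. u k \<in> homog (l - \<sigma> k))))" and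
    P4: "\<forall>r y. (\<forall>k\<in>{1..2}. (\<Sum>v\<in>UNIV. r v * \<Psi> v k) = 0) \<longrightarrow>
      (\<forall>j\<in>{1..m}. (\<Sum>v\<in>UNIV. y v * \<phi> v j) = 0) \<longrightarrow> (\<Sum>v\<in>UNIV. y v * r v) = 0"
    using double_dual_coordinates[OF iso] by (elim exE conjE) (rule that)
  have kernel: "r \<in> column_span \<phi> m" if "\<forall>k\<in>{1..2}. (\<Sum>v\<in>UNIV. r v * \<Psi> v k) = 0" for r
    by (rule torsionless_if_torsionfree[OF torsionfree]) (use P4 that in blast)+
  have bound1: "(\<Sum>v\<in>(UNIV :: 'v set). nat (p + 1)) \<le> (\<Sum>j=1..m. nat (p - int (d j) + 1)) + (\<Sum>k=1..2. nat (p + \<sigma> k + 1))"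
    and surj1: "(\<Sum>v\<in>(UNIV :: 'v set). nat (p + 1)) = (\<Sum>j=1..m. nat (p - int (d j) + 1)) + (\<Sum>k=1..2. nat (p + \<sigma> k + 1)) \<Longrightarrow>
      matrix_map UNIV {1..2} \<Psi> ` graded_piece UNIV (\<lambda>_. p) = graded_piece {1..2} (\<lambda>k. p + \<sigma> k)" for p
  proof -
    have a1: "\<And>i j. i \<in> UNIV \<Longrightarrow> j \<in> {1..2} \<Longrightarrow> p + \<sigma> j = p + \<sigma> j \<and> \<Psi> i j \<in> homog (\<sigma> j)" using P1 by blast
    have a2: "\<exists>c \<in> graded_piece {1..m} (\<lambda>j. p - int (d j)). w = matrix_map {1..m} UNIV (\<lambda>j v. \<phi> v j) c"
      if w: "w \<in> graded_piece UNIV (\<lambda>_. p)" "matrix_map UNIV {1..2} \<Psi> w = 0" for w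
    proof (rule graded_coefficients)
      have "(\<Sum>v\<in>UNIV. w v * \<Psi> v k) = 0" if "k \<in> {1..2}" for k
        using fun_cong[OF w(2), of k] that unfolding matrix_map_def by simp
      thus "w \<in> column_span \<phi> m" by (intro kernel ballI)
      show "w v \<in> homog p" for v using w(1) unfolding graded_piece_def by simp
    qed
    note b = graded_rank_bound[of UNIV "{1..2}" "{1..m}" "\<lambda>_. p" "\<lambda>_ k. \<sigma> k" "\<lambda>k. p + \<sigma> k" \<Psi>
        "\<lambda>j. p - int (d j)" "\<lambda>j v. \<phi> v j", OF finite finite_atLeastAtMost finite_atLeastAtMost a1 a2]
    show "(\<Sum>v\<in>(UNIV :: 'v set). nat (p + 1)) \<le> (\<Sum>j=1..m. nat (p - int (d j) + 1)) + (\<Sum>k=1..2. nat (p + \<sigma> k + 1))"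
      by (rule b(1))
    show "matrix_map UNIV {1..2} \<Psi> ` graded_piece UNIV (\<lambda>_. p) = graded_piece {1..2} (\<lambda>k. p + \<sigma> k)"
      if "(\<Sum>v\<in>(UNIV :: 'v set). nat (p + 1)) = (\<Sum>j=1..m. nat (p - int (d j) + 1)) + (\<Sum>k=1..2. nat (p + \<sigma> k + 1))"
      by (rule b(2)) (assumption | rule that)+
  qed
  have bound2: "(\<Sum>v\<in>(UNIV :: 'v set). nat (p + 1)) \<le> (\<Sum>k=1..2. nat (p - \<sigma> k + 1)) + (\<Sum>j=1..m. nat (p + int (d j) + 1))" for p
  proof (rule graded_rank_bound(1)[of UNIV "{1..m}" "{1..2}" "\<lambda>_. p" "\<lambda>_ j. int (d j)" "\<lambda>j. p + int (d j)" \<phi>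
        "\<lambda>k. p - \<sigma> k" "\<lambda>k v. \<Psi> v k"])
    show "p + int (d j) = p + int (d j) \<and> \<phi> v j \<in> homog (int (d j))" if "j \<in> {1..m}" for v j
      using phi_homog that by simp
    show "\<exists>c \<in> graded_piece {1..2} (\<lambda>k. p - \<sigma> k). w = matrix_map {1..2} UNIV (\<lambda>k v. \<Psi> v k) c"
      if w: "w \<in> graded_piece UNIV (\<lambda>_. p)" "matrix_map UNIV {1..m} \<phi> w = 0" for w
    proof -
      have "(\<Sum>v\<in>UNIV. w v * \<phi> v j) = 0" if "j \<in> {1..m}" for j
        using fun_cong[OF w(2), of j] that unfolding matrix_map_def by simp
      then obtain u where u: "\<forall>v. w v = (\<Sum>k=1..2. \<Psi> v k * u k)"
        "\<forall>l. (\<forall>v. w v \<in> homog l) \<longrightarrow> (\<forall>k\<in>{1..2}. u k \<in> homog (l - \<sigma> k))" using P3 by blast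
      have "\<forall>v. w v \<in> homog p" using w(1) unfolding graded_piece_def by simp
      hence uk: "\<forall>k\<in>{1..2}. u k \<in> homog (p - \<sigma> k)" using u(2) by blast
      define c where "c = (\<lambda>k. if k \<in> {1..2} then u k else 0)"
      have "c \<in> graded_piece {1..2} (\<lambda>k. p - \<sigma> k)" unfolding c_def graded_piece_def using uk by simp
      moreover have "w = matrix_map {1..2} UNIV (\<lambda>k v. \<Psi> v k) c"
      proof
        fix v
        have "w v = (\<Sum>k=1..2. \<Psi> v k * u k)" using u(1) by blast
        also have "\<dots> = (\<Sum>k\<in>{1..2}. c k * \<Psi> v k)" unfolding c_def by (intro sum.cong) (simp_all add: mult.commute)
        finally show "w v = matrix_map {1..2} UNIV (\<lambda>k v. \<Psi> v k) c v" unfolding matrix_map_def by simp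
      qed
      ultimately show ?thesis by blast
    qed
  qed simp_all
  have dle: "int (d j) \<le> int (d m)" if "j \<in> {1..m}" for j using that m_pos by (simp add: d_mono)
  have sum_d: "int (\<Sum>j=1..m. nat (p - int (d j) + 1)) = int m * (p + 1) - (\<Sum>j=1..m. int (d j))"
    if p: "p \<ge> int (d m) - 1" for p
  proof -
    have "int (\<Sum>j=1..m. nat (p - int (d j) + 1)) = (\<Sum>j=1..m. (p + 1) - int (d j))"
      unfolding of_nat_sum using dle p by (intro sum.cong) force+
    thus ?thesis by (simp add: sum_subtractf)
  qed
  have card_sum: "int (\<Sum>v\<in>(UNIV :: 'v set). nat (p + 1)) = (int m + 2) * (p + 1)" if "p \<ge> -1" for p
    using that by (simp add: card distrib_right)
  have le1: "(\<Sum>j=1..m. int (d j)) \<le> \<sigma> 1 + \<sigma> 2"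
  proof -
    let ?p = "int (d m)"
    have "int (\<Sum>v\<in>(UNIV :: 'v set). nat (?p + 1)) \<le>
        int (\<Sum>j=1..m. nat (?p - int (d j) + 1)) + int (\<Sum>k=1..2. nat (?p + \<sigma> k + 1))"
      using bound1[of ?p] by linarith
    moreover have "int (\<Sum>k=1..2. nat (?p + \<sigma> k + 1)) = 2 * (?p + 1) + \<sigma> 1 + \<sigma> 2"
      unfolding sum_1_2 using sigma by simp
    ultimately show ?thesis using sum_d[of ?p] card_sum[of ?p] by (simp add: algebra_simps)
  qed
  have le2: "\<sigma> 1 + \<sigma> 2 \<le> (\<Sum>j=1..m. int (d j))"
  proof -
    \<comment> \<open>a degree that is large enough for both \<open>?p - \<sigma> k + 1\<close> to be nonnegative\<close>
    let ?p = "\<sigma> 1 + \<sigma> 2"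
    have "int (\<Sum>v\<in>(UNIV :: 'v set). nat (?p + 1)) \<le>
        int (\<Sum>k=1..2. nat (?p - \<sigma> k + 1)) + int (\<Sum>j=1..m. nat (?p + int (d j) + 1))"
      using bound2[of ?p] by linarith
    moreover have "int (\<Sum>k=1..2. nat (?p - \<sigma> k + 1)) = 2 * (?p + 1) - \<sigma> 1 - \<sigma> 2"
      unfolding sum_1_2 using sigma by simp
    moreover have "int (\<Sum>j=1..m. nat (?p + int (d j) + 1)) = int m * (?p + 1) + (\<Sum>j=1..m. int (d j))"
    proof -
      have "int (\<Sum>j=1..m. nat (?p + int (d j) + 1)) = (\<Sum>j=1..m. (?p + 1) + int (d j))"
        unfolding of_nat_sum using sigma by (intro sum.cong) auto
      thus ?thesis by (simp add: sum.distrib)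
    qed
    ultimately show ?thesis using card_sum[of ?p] sigma by (simp add: algebra_simps)
  qed
  show sigma_sum: "\<sigma> 1 + \<sigma> 2 = (\<Sum>i=1..m. int (d i))" using le1 le2 by simp
  have surj: "\<exists>r. (\<forall>v. r v \<in> homog p) \<and> (\<Sum>v\<in>UNIV. r v * \<Psi> v 1) = w1 \<and> (\<Sum>v\<in>UNIV. r v * \<Psi> v 2) = w2"
    if p: "p \<ge> int (d m) - 1" and w: "w1 \<in> homog (p + \<sigma> 1)" "w2 \<in> homog (p + \<sigma> 2)" for p w1 w2
  proof -
    have "p \<ge> 0" using p d_pos[of m] m_pos by simp
    hence "int (\<Sum>k=1..2. nat (p + \<sigma> k + 1)) = 2 * (p + 1) + \<sigma> 1 + \<sigma> 2"
      unfolding sum_1_2 using sigma by simp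
    hence "int (\<Sum>v\<in>(UNIV :: 'v set). nat (p + 1)) =
        int ((\<Sum>j=1..m. nat (p - int (d j) + 1)) + (\<Sum>k=1..2. nat (p + \<sigma> k + 1)))"
      unfolding of_nat_add using card_sum[of p] sum_d[OF p] sigma_sum \<open>p \<ge> 0\<close> by (simp add: algebra_simps)
    hence img: "matrix_map UNIV {1..2} \<Psi> ` graded_piece UNIV (\<lambda>_. p) = graded_piece {1..2} (\<lambda>k. p + \<sigma> k)"
      by (intro surj1) (simp only: of_nat_eq_iff)
    define w where "w = (\<lambda>k::nat. if k = 1 then w1 else if k = 2 then w2 else 0)"
    have "{1..2::nat} = {1, 2}" by auto
    hence "w \<in> graded_piece {1..2} (\<lambda>k. p + \<sigma> k)"
      unfolding graded_piece_def w_def using \<open>w1 \<in> homog (p + \<sigma> 1)\<close> \<open>w2 \<in> homog (p + \<sigma> 2)\<close> by auto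
    then obtain r where r: "r \<in> graded_piece UNIV (\<lambda>_. p)" "w = matrix_map UNIV {1..2} \<Psi> r"
      unfolding img[symmetric] by blast
    have e: "(\<Sum>v\<in>UNIV. r v * \<Psi> v k) = w k" if "k \<in> {1..2}" for k
      unfolding r(2) matrix_map_def using that by (simp only: if_True)
    have "(\<Sum>v\<in>UNIV. r v * \<Psi> v 1) = w1" by (rule trans[OF e]) (simp_all add: w_def)
    moreover have "(\<Sum>v\<in>UNIV. r v * \<Psi> v 2) = w2" by (rule trans[OF e]) (simp_all add: w_def)
    moreover have "\<forall>v. r v \<in> homog p" using r(1) unfolding graded_piece_def by simp
    ultimately show ?thesis by blast
  qed
  have "\<forall>j\<in>{1..m}. (\<Sum>v\<in>UNIV. f v * \<phi> v j) = 0" using f_phi by simp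
  then obtain u where u: "\<forall>v. f v = (\<Sum>k=1..2. \<Psi> v k * u k)" using P3 by blast
  have "rank_two f \<phi> m d \<delta> (\<lambda>v. \<Psi> v 1) (\<lambda>v. \<Psi> v 2) (\<sigma> 1) (\<sigma> 2) (u 1) (u 2)"
  proof
    show "r \<in> column_span \<phi> m" if "(\<Sum>v\<in>UNIV. r v * \<Psi> v 1) = 0" "(\<Sum>v\<in>UNIV. r v * \<Psi> v 2) = 0" for r
    proof (rule kernel, rule ballI)
      fix k :: nat assume "k \<in> {1..2}"
      hence "k = 1 \<or> k = 2" by auto
      thus "(\<Sum>v\<in>UNIV. r v * \<Psi> v k) = 0" using that by blast
    qed
    show "f v = \<Psi> v 1 * u 1 + \<Psi> v 2 * u 2" for v using u[rule_format, of v] unfolding sum_1_2 .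
    show "{a. (\<Sum>v\<in>UNIV. a v * f v) = 0} = column_span \<phi> (Suc m)" by (rule syzygies)
    show "c j = 0" if "\<And>v. (\<Sum>j=1..Suc m. \<phi> v j * c j) = 0" "j \<in> {1..Suc m}" for c j
      using phi_inj that by blast
  qed (use m_pos d_pos d_mono f_homog f_nonzero phi_homog P1 P2 surj sigma in simp_all)
  thus "\<exists>\<Psi>1 \<Psi>2 u1 u2. rank_two f \<phi> m d \<delta> \<Psi>1 \<Psi>2 (\<sigma> 1) (\<sigma> 2) u1 u2" by blast
qed

end

section \<open>Counting the bidegrees\<close>

lemma le_quotient_iff:
  assumes "s > 0"
  shows "real j \<le> (real x - real y) / real_of_int s \<longleftrightarrow> int j * s \<le> int x - int y"
proof -
  have "real j \<le> (real x - real y) / real_of_int s \<longleftrightarrow> real j * real_of_int s \<le> real x - real y"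
    using assms by (simp add: pos_le_divide_eq)
  also have "\<dots> \<longleftrightarrow> real_of_int (int j * s) \<le> real_of_int (int x - int y)" by simp
  finally show ?thesis by (simp only: of_int_le_iff)
qed

lemma le_of_mult_le: "int j * s \<le> t \<Longrightarrow> s > 0 \<Longrightarrow> j \<le> nat t"
proof -
  assume a: "int j * s \<le> t" "s > 0"
  have "int j * 1 \<le> int j * s" using a(2) by (intro mult_left_mono) auto
  thus "j \<le> nat t" using a(1) by linarith
qed

context rank_two
begin

text \<open>In \<open>T\<close>-degree \<open>b = j + 1\<close> the only candidate is \<open>z\<^sub>1\<^sup>j H\<close>.\<close>

lemma high_generators_sigma2_zero:
  assumes s: "\<sigma>2 = 0"
  shows "high_generators K D B
    {j :: nat. real j \<le> (real (d (Suc m)) - real (d m)) / real_of_int \<sigma>1}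
    (\<lambda>j. (N - int j * \<sigma>1, j + 1))"
    (is "high_generators K D B ?J ?\<beta>")
proof (rule high_generators_K)
  have J: "?J = {j. int j * \<sigma>1 \<le> N - D}" using le_quotient_iff[OF sigma(3)] by simp
  have "?J \<subseteq> {..nat (N - D)}" unfolding J using le_of_mult_le sigma(3) by auto
  thus "finite ?J" using finite_subset by blast
  fix a b assume a: "D \<le> a"
  have "{x \<in> ?J. ?\<beta> x = (a, b)} = indices a b"
    unfolding J indices_def using a s by auto
  thus "card {x \<in> ?J. ?\<beta> x = (a, b)} = card (indices a b)" by simp
qed

text \<open>The pair \<open>(j, i)\<close> corresponds to the index \<open>i\<close> in \<open>T\<close>-degree \<open>b = j +
  1\<close>; the bounds on \<open>j\<close> and \<open>i\<close> together say that the \<open>x\<close>-degree is at least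
  \<open>D\<close>.\<close>

lemma high_generators_sigma_less:
  assumes s: "\<sigma>1 > \<sigma>2" "\<sigma>2 > 0"
  shows "high_generators K D B
    {(j :: nat, i :: nat). real j \<le> (real (d (Suc m)) - real (d m)) / real_of_int \<sigma>2 \<and>
       real i \<le> min (real j) ((real (d (Suc m)) - real (d m) - real j * real_of_int \<sigma>2)
         / (real_of_int \<sigma>1 - real_of_int \<sigma>2))}
    (\<lambda>(j, i). (N - int i * \<sigma>1 - (int j - int i) * \<sigma>2, j + 1))"
    (is "high_generators K D B ?J ?\<beta>")
proof (rule high_generators_K)
  have q: "real i \<le> (real (d (Suc m)) - real (d m) - real j * real_of_int \<sigma>2) / (real_of_int \<sigma>1 - real_of_int \<sigma>2)
      \<longleftrightarrow> int i * (\<sigma>1 - \<sigma>2) \<le> N - D - int j * \<sigma>2" for i j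
  proof -
    have "real i \<le> (real (d (Suc m)) - real (d m) - real j * real_of_int \<sigma>2) / (real_of_int \<sigma>1 - real_of_int \<sigma>2)
      \<longleftrightarrow> real i * (real_of_int \<sigma>1 - real_of_int \<sigma>2) \<le> real (d (Suc m)) - real (d m) - real j * real_of_int \<sigma>2"
      using s(1) by (simp add: pos_le_divide_eq)
    also have "\<dots> \<longleftrightarrow> real_of_int (int i * (\<sigma>1 - \<sigma>2)) \<le> real_of_int (N - D - int j * \<sigma>2)" by simp
    finally show ?thesis by (simp only: of_int_le_iff)
  qed
  have J: "?J = {(j, i). int j * \<sigma>2 \<le> N - D \<and> i \<le> j \<and> int i * (\<sigma>1 - \<sigma>2) \<le> N - D - int j * \<sigma>2}"
    using le_quotient_iff[OF s(2)] q by auto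
  have "?J \<subseteq> {..nat (N - D)} \<times> {..nat (N - D)}"
    unfolding J using le_of_mult_le[OF _ s(2)] by fastforce
  thus "finite ?J" using finite_subset by blast
  fix a b assume a: "D \<le> a"
  have "{x \<in> ?J. ?\<beta> x = (a, b)} = (\<lambda>i. (b - 1, i)) ` indices a b"
  proof (intro equalityI subsetI)
    fix x assume x: "x \<in> {x \<in> ?J. ?\<beta> x = (a, b)}"
    obtain j i where ji: "x = (j, i)" by (cases x)
    have "i \<le> j" "b = Suc j" "a = N - int i * \<sigma>1 - (int j - int i) * \<sigma>2"
      using x unfolding ji J by auto
    hence "i \<in> indices a b" "x = (b - 1, i)" unfolding indices_def ji using s by auto
    thus "x \<in> (\<lambda>i. (b - 1, i)) ` indices a b" by blast
  next
    fix x assume "x \<in> (\<lambda>i. (b - 1, i)) ` indices a b"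
    then obtain i where i: "i \<in> indices a b" "x = (b - 1, i)" by blast
    then obtain j where j: "b = Suc j" unfolding indices_def by (cases b) auto
    have ij: "i \<le> j" and e: "a = N - int i * \<sigma>1 - (int j - int i) * \<sigma>2"
      using i(1) unfolding indices_def j by auto
    have "int i * (\<sigma>1 - \<sigma>2) \<le> N - D - int j * \<sigma>2" using a e by (simp add: algebra_simps)
    moreover have "0 \<le> int i * (\<sigma>1 - \<sigma>2)" using s by simp
    ultimately show "x \<in> {x \<in> ?J. ?\<beta> x = (a, b)}" unfolding J using i(2) j ij e by simp
  qed
  thus "card {x \<in> ?J. ?\<beta> x = (a, b)} = card (indices a b)"
    by (simp only:) (rule card_image, simp add: inj_on_def)
qed

text \<open>All \<open>j + 1\<close> monomials of degree \<open>j\<close> in \<open>z\<^sub>1, z\<^sub>2\<close> give the same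
  bidegree.\<close>

lemma high_generators_sigma_equal:
  assumes s: "\<sigma>1 = \<sigma>2"
  shows "high_generators K D B
    {(j :: nat, l :: nat). real j \<le> (real (d (Suc m)) - real (d m)) / real_of_int \<sigma>1 \<and> l < j + 1}
    (\<lambda>(j, l). (N - int j * \<sigma>1, j + 1))"
    (is "high_generators K D B ?J ?\<beta>")
proof (rule high_generators_K)
  have J: "?J = {(j, l). int j * \<sigma>1 \<le> N - D \<and> l \<le> j}" using le_quotient_iff[OF sigma(3)] by auto
  have "?J \<subseteq> {..nat (N - D)} \<times> {..nat (N - D)}"
    unfolding J using le_of_mult_le[OF _ sigma(3)] by fastforce
  thus "finite ?J" using finite_subset by blast
  fix a b assume a: "D \<le> a"
  have "{x \<in> ?J. ?\<beta> x = (a, b)} = (\<lambda>i. (b - 1, i)) ` indices a b"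
  proof (intro equalityI subsetI)
    fix x assume x: "x \<in> {x \<in> ?J. ?\<beta> x = (a, b)}"
    obtain j i where ji: "x = (j, i)" by (cases x)
    have "i \<le> j" "b = Suc j" "a = N - int j * \<sigma>1" using x unfolding ji J by auto
    hence "i \<in> indices a b" "x = (b - 1, i)"
      unfolding indices_def ji using s sigma(3) by (auto simp: algebra_simps)
    thus "x \<in> (\<lambda>i. (b - 1, i)) ` indices a b" by blast
  next
    fix x assume "x \<in> (\<lambda>i. (b - 1, i)) ` indices a b"
    then obtain i where i: "i \<in> indices a b" "x = (b - 1, i)" by blast
    then obtain j where j: "b = Suc j" unfolding indices_def by (cases b) auto
    have ij: "i \<le> j" and e: "a = N - int j * \<sigma>1"
      using i(1) s unfolding indices_def j by (auto simp: algebra_simps)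
    thus "x \<in> {x \<in> ?J. ?\<beta> x = (a, b)}" unfolding J using i(2) j a by simp
  qed
  thus "card {x \<in> ?J. ?\<beta> x = (a, b)} = card (indices a b)"
    by (simp only:) (rule card_image, simp add: inj_on_def)
qed

end

theorem corollary3p13:
  fixes f :: "'v::finite \<Rightarrow> 'k::field bipoly"
    and I :: "'k bipoly set"
    and \<phi> :: "'v \<Rightarrow> nat \<Rightarrow> 'k bipoly"
    and n m s \<delta> :: nat
    and d :: "nat \<Rightarrow> nat"
    and \<sigma> :: "nat \<Rightarrow> int"
    and g :: "nat \<Rightarrow> ('k, 'v) tpoly"
    and K :: "('k, 'v) tpoly set"
    and B :: "('k, 'v) tpoly set"
  assumes "n = CARD('v)" and "n \<ge> 3"
    and "\<forall>i. f i \<in> homog (int \<delta>)"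
    and "minimally_generates f I"
    and "ideal_height I = 2"
    and "graded_resolution f \<phi> (n - 1) d"
    and "\<forall>i\<in>{1..n - 1}. 1 \<le> d i"
    and "\<forall>i\<in>{1..n - 1}. \<forall>j\<in>{1..n - 1}. i \<le> j \<longrightarrow> d i \<le> d j"
    and "m = n - 2" and "s = n - m"
    and "graded_iso (dual (dual (coker \<phi> m))) (twisted_free s \<sigma>)"
    and "\<forall>i\<in>{1..s}. \<forall>j\<in>{1..s}. i \<le> j \<longrightarrow> \<sigma> j \<le> \<sigma> i"
    and "\<sigma> s \<ge> 0" and "\<sigma> 1 > 0"
    and "g = syzygy_form \<phi>"
    and "K = rees_equations (ideal_mod I \<delta>) f"
    and "B = g ` {k \<in> {1..n - 2}. d k = d (n - 2)}"
  shows "s = 2 \<and> \<sigma> 1 + \<sigma> 2 = (\<Sum>i=1..n - 2. int (d i)) \<and>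
    inj_on g {k \<in> {1..n - 2}. d k = d (n - 2)} \<and>
    (\<sigma> 2 = 0 \<longrightarrow>
       high_generators K (int (d (n - 2))) B
         {j :: nat. real j \<le> (real (d (n - 1)) - real (d (n - 2))) / real_of_int (\<sigma> 1)}
         (\<lambda>j. (int (d (n - 1)) - int j * \<sigma> 1, j + 1))) \<and>
    (\<sigma> 1 > \<sigma> 2 \<and> \<sigma> 2 > 0 \<longrightarrow>
       high_generators K (int (d (n - 2))) B
         {(j :: nat, i :: nat).
            real j \<le> (real (d (n - 1)) - real (d (n - 2))) / real_of_int (\<sigma> 2) \<and>
            real i \<le> min (real j)
              ((real (d (n - 1)) - real (d (n - 2)) - real j * real_of_int (\<sigma> 2))
                / (real_of_int (\<sigma> 1) - real_of_int (\<sigma> 2)))}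
         (\<lambda>(j, i). (int (d (n - 1)) - int i * \<sigma> 1 - (int j - int i) * \<sigma> 2, j + 1))) \<and>
    (\<sigma> 1 = \<sigma> 2 \<longrightarrow>
       high_generators K (int (d (n - 2))) B
         {(j :: nat, l :: nat).
            real j \<le> (real (d (n - 1)) - real (d (n - 2))) / real_of_int (\<sigma> 1) \<and> l < j + 1}
         (\<lambda>(j, l). (int (d (n - 1)) - int j * \<sigma> 1, j + 1)))"
proof -
  have s: "s = 2" using assms(2,9,10) by simp
  have n1: "n - 1 = Suc m" and n2: "n - 2 = m" and card: "CARD('v) = m + 2" and m: "1 \<le> m"
    using assms(1,2,9) by simp_all
  have I: "I = ideal_gen (range f)" and min: "\<And>i. ideal_gen (f ` (UNIV - {i})) \<noteq> I"
    using assms(4) unfolding minimally_generates_def by auto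
  have fnz: "\<exists>v. f v \<noteq> 0"
  proof (rule ccontr)
    assume z: "\<nexists>v. f v \<noteq> 0"
    \<comment> \<open>if all generators were zero, each of them would be superfluous\<close>
    fix v :: 'v
    have "card (UNIV - {v}) \<noteq> 0" using card by (simp add: card_Diff_singleton)
    hence "UNIV - {v} \<noteq> {}" by (metis card.empty)
    hence "f ` (UNIV - {v}) = {0}" "range f = {0}" using z by auto
    thus False using min[of v] I by simp
  qed
  interpret R: resolution f \<phi> m d "int \<delta>" \<sigma>
  proof
    show "\<sigma> 1 \<ge> \<sigma> 2" using assms(12) s by simp
    show "d i \<le> d j" if "i \<in> {1..Suc m}" "j \<in> {1..Suc m}" "i \<le> j" for i j using assms(8) that n1 by metis
    show "1 \<le> d j" if "j \<in> {1..Suc m}" for j using assms(7) that n1 by metis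
    show "graded_resolution f \<phi> (Suc m) d" using assms(6) n1 by simp
    show "graded_iso (dual (dual (coker \<phi> m))) (twisted_free 2 \<sigma>)" using assms(11) s by simp
    show "\<sigma> 2 \<ge> 0" using assms(13) s by simp
  qed (use assms(3,14) card m fnz in blast)+
  obtain \<Psi>1 \<Psi>2 u1 u2 where "rank_two f \<phi> m d (int \<delta>) \<Psi>1 \<Psi>2 (\<sigma> 1) (\<sigma> 2) u1 u2"
    using R.rank_two_coordinates(1) by blast
  then interpret T: rank_two f \<phi> m d "int \<delta>" \<Psi>1 \<Psi>2 "\<sigma> 1" "\<sigma> 2" u1 u2 .
  obtain v0 where "f v0 \<noteq> 0" using fnz by blast
  hence K: "K = T.K"
    unfolding assms(16) T.K_def T.E_def using rees_equations_ideal[OF I] by simp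
  have B: "B = T.B" unfolding assms(15,17) T.B_def n2 ..
  have "inj_on g {k \<in> {1..n - 2}. d k = d (n - 2)}"
    unfolding assms(15) n2 by (rule inj_on_subset[OF T.g_inj]) auto
  thus ?thesis
    unfolding K B n1 n2
    using s R.rank_two_coordinates(2) T.high_generators_sigma2_zero T.high_generators_sigma_less
      T.high_generators_sigma_equal by blast
qed

end
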